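(* Consider an SJR model whose switching variables are $\mathrm{Ber}(\alpha)$, and let $\xi^*=(1-\alpha,\alpha)$. Let $\xi_1>\cdots>\xi_n>\xi^*$ be directions in $\mathscr U$, and let $(B^{\xi_1},\dots,B^{\xi_n})$ be the corresponding (south-west) Busemann processes of the SJR model. Let $(B_0^{\xi_1},\dots,B_0^{\xi_n})$ be the Busemann processes for the SWFPP model whose horizontal weights are identical to those of the SJR model, $W(x;1)=S(x)\widetilde W(x;1)$, and whose vertical weights are all zero. Then $(B^{\xi_1},\dots,B^{\xi_n})\overset{d}{=}(B_0^{\xi_1},\dots,B_0^{\xi_n})$ as processes indexed by pairs $(x,y)\in(\mathbb{Z}^2)^2$.
   Context: Directed edge-weight FPP on $\mathbb{Z}^2$: weight $W(x;1)$ on edge $(x-e_1,x)$, $W(x;2)$ on edge $(x-e_2,x)$; $L(x,y)$ is the minimal weight sum over up-right paths from $x$ to $y$. SJR model: i.i.d. switching variables $S(x)\sim\mathrm{Ber}(\alpha)$, independent of i.i.d. pairs $(\widetilde W(x;1),\widetilde W(x;2))$ of non-negative, non-constant weights with finite $2+\epsilon$ moments; set $W(x;1)=S(x)\widetilde W(x;1)$ and $W(x;2)=(1-S(x))\widetilde W(x;2)$. SWFPP: all vertical weights zero, horizontal weights non-negative. Directions $\mathscr U=\{(t,1-t):0<t<1\}$, ordered by first coordinate ($\xi>\zeta$ iff $\xi\cdot e_1>\zeta\cdot e_1$). South-west Busemann function in direction $\xi$: $B^\xi(x,y)=\lim_n(L(v_n,x)-L(v_n,y))$ along $|v_n|\to\infty$,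 $v_n/|v_n|\to-\xi$ (existing a.s. for fixed $\xi$). *)

theory Defs
  imports "HOL-Probability.Probability"
begin

text \<open>Lattice sites are pairs of integers. A weight configuration assigns to a site x
  and a direction i (1 or 2) the weight W x i of the edge (x - e_i, x).\<close>

type_synonym site = "int \<times> int"
type_synonym weights = "site \<Rightarrow> nat \<Rightarrow> real"

definition step :: "site \<Rightarrow> nat \<Rightarrow> site" where
  "step v i = (if i = 1 then (fst v + 1, snd v) else (fst v, snd v + 1))"

fun path_weight :: "weights \<Rightarrow> site \<Rightarrow> nat list \<Rightarrow> real" where
  "path_weight W v [] = 0"
| "path_weight W v (i # is) = W (step v i) i + path_weight W (step v i) is"

definition up_right_paths :: "site \<Rightarrow> site \<Rightarrow> nat list set" where
  "up_right_paths v x = {p. set p \<subseteq> {1, 2}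
       \<and> int (count_list p 1) = fst x - fst v \<and> int (count_list p 2) = snd x - snd v}"

definition passage_time :: "weights \<Rightarrow> site \<Rightarrow> site \<Rightarrow> real" where
  "passage_time W v x = Min (path_weight W v ` up_right_paths v x)"

definition norm1 :: "site \<Rightarrow> real" where
  "norm1 v = real_of_int \<bar>fst v\<bar> + real_of_int \<bar>snd v\<bar>"

text \<open>Admissible sequences for the south-west Busemann limit in direction xi = (t, 1-t):
  |v_n| \<rightarrow> \<infinity> and v_n/|v_n| \<rightarrow> -xi.\<close>
definition sw_admissible :: "real \<Rightarrow> (nat \<Rightarrow> site) \<Rightarrow> bool" where
  "sw_admissible t v \<longleftrightarrow> filterlim (\<lambda>n. norm1 (v n)) at_top sequentially
     \<and> ((\<lambda>n. (real_of_int (fst (v n)) / norm1 (v n), real_of_int (snd (v n)) / norm1 (v n)))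
          \<longlonglongrightarrow> (- t, - (1 - t)))"

definition busemann :: "weights \<Rightarrow> real \<Rightarrow> site \<Rightarrow> site \<Rightarrow> real" where
  "busemann W t x y = (THE c. \<forall>v. sw_admissible t v \<longrightarrow>
       ((\<lambda>n. passage_time W (v n) x - passage_time W (v n) y) \<longlonglongrightarrow> c))"

definition sjr_weights :: "(site \<Rightarrow> bool) \<Rightarrow> (site \<Rightarrow> real) \<Rightarrow> (site \<Rightarrow> real) \<Rightarrow> weights" where
  "sjr_weights S W1 W2 x i =
     (if i = 1 then (if S x then W1 x else 0)
      else if i = 2 then (if S x then 0 else W2 x) else 0)"

definition swfpp_weights :: "(site \<Rightarrow> bool) \<Rightarrow> (site \<Rightarrow> real) \<Rightarrow> weights" where
  "swfpp_weights S W1 x i = (if i = 1 then (if S x then W1 x else 0) else 0)"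

end

theory Submission
  imports Defs "HOL-Real_Asymp.Real_Asymp"
begin

text \<open>Write \<open>T\<close> and \<open>F\<close> for the passage times of the SJR model and of the SWFPP model with the same
  horizontal weights. Almost surely, for every direction \<open>(t, 1 - t)\<close> with \<open>t > 1 - \<alpha>\<close> and every \<open>c\<close>, all
  admissible sequences give \<open>T(v\<^sub>n, x) - T(v\<^sub>n, y) \<rightarrow> c\<close> iff they all give
  \<open>F(v\<^sub>n, x) - F(v\<^sub>n, y) \<rightarrow> c\<close>. Hence the two Busemann functions are equal almost surely, not only in law.

  For this it suffices that for every \<open>v\<close> far out in a narrow cone there is \<open>u\<close> far out in a slightly larger cone
  with \<open>T(u, x) - T(u, y) \<le> F(v, x) - F(v, y)\<close>, and the same with \<open>T\<close> and \<open>F\<close> exchanged. Every site has a free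
  incoming edge, vertical where \<open>S\<close> holds and horizontal elsewhere; following free edges backwards gives paths
  of weight zero with the asymptotic direction \<open>-(1 - \<alpha>, \<alpha>)\<close>. In the first case \<open>u\<close> is chosen in the column
  of \<open>v\<close>, where a geodesic of \<open>F\<close>, having climbed that column for free, leaves it; free paths control
  the height of this exit. In the second case a geodesic of \<open>T\<close> from \<open>v\<close> meets a free path close to \<open>v\<close>,
  and \<open>T(u, x) = F(u, x)\<close> if \<open>u\<close> is on a free path and \<open>x\<close> to the right of it. That they meet close to \<open>v\<close> rests
  on the fact that the time constant of \<open>F\<close>, divided by \<open>\<alpha> a - (1 - \<alpha>) b\<close>, is strictly larger in directions
  \<open>(a, b)\<close> closer to the horizontal axis.

  The strict inequality follows from the recursion for the mean of \<open>F\<close> together with a small probability of long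
  jumps to the left; an Efron-Stein bound for the variance transfers it from means to passage times.\<close>

section \<open>Passage times and free paths\<close>

text \<open>The inequality is one-sided, with \<open>u\<close> depending on \<open>v\<close>;
  swapping \<open>x\<close> and \<open>y\<close> supplies the other bound, and limits along
  sequences are therefore rewritten as uniform estimates on cones.

  The obstacle is that the strict slope inequality degenerates where the time constant of
  \<open>F\<close> vanishes. If \<beta> is the probability of a positive horizontal weight at a
  site, this happens for 1 - \<alpha> < t < 1 - \<beta>. There a second kind of free path is used,
  going down only at positive weights, and both differences are shown to be zero. For t \<ge> 1 -
  \<beta> the strict inequality acts by contradiction: if the geodesic of \<open>T\<close> met the
  free path only far from \<open>v\<close>, then \<open>F\<close> from a site displaced from
  \<open>v\<close> along (1 - \<alpha>, \<alpha>) would hardly exceed \<open>F\<close> from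
  \<open>v\<close>, although the drift towards \<open>x\<close> is nearly the same and the direction
  is flatter.

  All probability is packed into three properties of a single configuration,
  \<open>exit_law\<close>, \<open>row_law\<close> and \<open>gap_law\<close>. None of them mentions
  t, so one null set serves all directions.\<close>

definition below :: "site \<Rightarrow> site \<Rightarrow> bool" where
  "below v x \<longleftrightarrow> fst v \<le> fst x \<and> snd v \<le> snd x"

definition end_of_path :: "site \<Rightarrow> nat list \<Rightarrow> site" where
  "end_of_path v p = foldl step v p"

lemma path_weight_snoc:
  "path_weight W v (p @ [k]) = path_weight W v p + W (step (end_of_path v p) k) k"
  by (induction p arbitrary: v) (auto simp: end_of_path_def)

lemma end_of_path_counts:
  assumes "set p \<subseteq> {1, 2}"
  shows "end_of_path v p = (fst v + int (count_list p 1), snd v + int (count_list p 2))"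
  using assms
proof (induction p arbitrary: v)
  case Nil
  then show ?case by (simp add: end_of_path_def)
next
  case (Cons k p)
  have "end_of_path v (k # p) = end_of_path (step v k) p"
    by (simp add: end_of_path_def)
  also have "\<dots> = (fst (step v k) + int (count_list p 1), snd (step v k) + int (count_list p 2))"
    using Cons by simp
  also have "\<dots> = (fst v + int (count_list (k # p) 1), snd v + int (count_list (k # p) 2))"
    using Cons.prems by (auto simp: step_def)
  finally show ?case .
qed

lemma end_of_path_up_right:
  "p \<in> up_right_paths v x \<Longrightarrow> end_of_path v p = x"
  using end_of_path_counts[of p v] by (auto simp: up_right_paths_def)

lemma length_counts:
  fixes p :: "nat list"
  shows "set p \<subseteq> {1, 2} \<Longrightarrow> length p = count_list p 1 + count_list p 2"
  by (induction p) auto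

lemma finite_up_right_paths [simp]: "finite (up_right_paths v x)"
proof -
  have "up_right_paths v x \<subseteq>
      {p. set p \<subseteq> {1, 2} \<and> length p = nat (fst x - fst v) + nat (snd x - snd v)}"
    using length_counts by (auto simp: up_right_paths_def)
  then show ?thesis
    by (rule finite_subset) (simp add: finite_lists_length_eq)
qed

lemma up_right_paths_refl: "up_right_paths v v = {[]}"
proof -
  have "p = []" if "set p \<subseteq> {1, 2}" "count_list p 1 = 0" "count_list p 2 = 0" for p :: "nat list"
    using length_counts[OF that(1)] that by simp
  then show ?thesis by (auto simp: up_right_paths_def)
qed

lemma up_right_paths_nonempty: "below v x \<Longrightarrow> up_right_paths v x \<noteq> {}"
proof -
  assume "below v x"
  moreover have c: "count_list (replicate m k) l = (if k = l then m else 0)" for m and k l :: nat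
    by (induction m) auto
  ultimately have "replicate (nat (fst x - fst v)) 1 @ replicate (nat (snd x - snd v)) 2 \<in> up_right_paths v x"
    by (auto simp: up_right_paths_def below_def count_list_append c)
  then show ?thesis by blast
qed

lemma up_right_paths_snoc1:
  "p @ [1] \<in> up_right_paths v (a, b) \<longleftrightarrow> p \<in> up_right_paths v (a - 1, b)"
  by (auto simp: up_right_paths_def count_list_append)

lemma up_right_paths_snoc2:
  "p @ [2] \<in> up_right_paths v (a, b) \<longleftrightarrow> p \<in> up_right_paths v (a, b - 1)"
  by (auto simp: up_right_paths_def count_list_append)

lemma up_right_paths_empty: "\<not> below v x \<Longrightarrow> up_right_paths v x = {}"
  by (auto simp: up_right_paths_def below_def)

lemma up_right_paths_step:
  assumes "v \<noteq> (a, b)"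
  shows "up_right_paths v (a, b) = (\<lambda>p. p @ [1]) ` up_right_paths v (a - 1, b)
            \<union> (\<lambda>p. p @ [2]) ` up_right_paths v (a, b - 1)" (is "?L = ?R")
proof
  show "?R \<subseteq> ?L"
    by (auto simp only: image_iff Un_iff up_right_paths_snoc1 up_right_paths_snoc2)
  show "?L \<subseteq> ?R"
  proof
    fix p assume p: "p \<in> ?L"
    have "p \<noteq> []" using p assms by (cases v) (auto simp: up_right_paths_def)
    then obtain q k where q: "p = q @ [k]" by (metis rev_exhaust)
    have "k = 1 \<or> k = 2" using p q by (auto simp: up_right_paths_def)
    then show "p \<in> ?R"
      using p q by (auto simp only: image_iff Un_iff up_right_paths_snoc1 up_right_paths_snoc2)
  qed
qed

lemma path_weights_step1:
  "path_weight W v ` (\<lambda>p. p @ [1]) ` up_right_paths v (a - 1, b)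
     = (\<lambda>t. t + W (a, b) 1) ` path_weight W v ` up_right_paths v (a - 1, b)"
  by (auto simp: image_image path_weight_snoc end_of_path_up_right step_def intro!: image_cong)

lemma path_weights_step2:
  "path_weight W v ` (\<lambda>p. p @ [2]) ` up_right_paths v (a, b - 1)
     = (\<lambda>t. t + W (a, b) 2) ` path_weight W v ` up_right_paths v (a, b - 1)"
  by (auto simp: image_image path_weight_snoc end_of_path_up_right step_def intro!: image_cong)

lemma Min_image_plus:
  fixes A :: "real set"
  assumes "finite A" "A \<noteq> {}"
  shows "Min ((\<lambda>t. t + c) ` A) = Min A + c"
  using assms by (intro mono_Min_commute[symmetric]) (auto simp: mono_def)

lemma passage_time_refl [simp]: "passage_time W v v = 0"
  by (simp add: passage_time_def up_right_paths_refl)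

lemma passage_time_step:
  assumes "i < a" "j < b"
  shows "passage_time W (i, j) (a, b) =
    min (passage_time W (i, j) (a - 1, b) + W (a, b) 1) (passage_time W (i, j) (a, b - 1) + W (a, b) 2)"
proof -
  have ne: "up_right_paths (i, j) (a - 1, b) \<noteq> {}" "up_right_paths (i, j) (a, b - 1) \<noteq> {}"
    using assms by (auto intro!: up_right_paths_nonempty simp: below_def)
  show ?thesis
    unfolding passage_time_def using assms ne
    by (subst up_right_paths_step)
       (auto simp: image_Un Min_Un path_weights_step1 path_weights_step2 Min_image_plus
             simp del: image_image One_nat_def)
qed

lemma passage_time_row:
  assumes "i < a"
  shows "passage_time W (i, j) (a, j) = passage_time W (i, j) (a - 1, j) + W (a, j) 1"
proof -
  have ne: "up_right_paths (i, j) (a - 1, j) \<noteq> {}" "up_right_paths (i, j) (a, j - 1) = {}"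
    using assms by (auto intro!: up_right_paths_nonempty up_right_paths_empty simp: below_def)
  show ?thesis
    unfolding passage_time_def using assms ne
    by (subst up_right_paths_step)
       (auto simp: path_weights_step1 Min_image_plus simp del: image_image One_nat_def)
qed

lemma passage_time_col:
  assumes "j < b"
  shows "passage_time W (i, j) (i, b) = passage_time W (i, j) (i, b - 1) + W (i, b) 2"
proof -
  have ne: "up_right_paths (i, j) (i, b - 1) \<noteq> {}" "up_right_paths (i, j) (i - 1, b) = {}"
    using assms by (auto intro!: up_right_paths_nonempty up_right_paths_empty simp: below_def)
  show ?thesis
    unfolding passage_time_def using assms ne
    by (subst up_right_paths_step)
       (auto simp: path_weights_step2 Min_image_plus simp del: image_image One_nat_def)
qed

text \<open>The cases mirror the recursion of \<open>passage_time\<close> in its end point: the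
  start, one predecessor on the bottom row and on the left column, two elsewhere. Most deterministic
  comparisons below compare two such recursions case by case.\<close>

lemma quadrant_induct [consumes 2, case_names corner row col inner]:
  fixes i j a b :: int
  assumes "i \<le> a" "j \<le> b"
    and corner: "P i j"
    and row: "\<And>a. i < a \<Longrightarrow> P (a - 1) j \<Longrightarrow> P a j"
    and col: "\<And>b. j < b \<Longrightarrow> P i (b - 1) \<Longrightarrow> P i b"
    and inner: "\<And>a b. i < a \<Longrightarrow> j < b \<Longrightarrow> P (a - 1) b \<Longrightarrow> P a (b - 1) \<Longrightarrow> P a b"
  shows "P a b"
  using assms(1,2)
proof (induction "nat (a - i + (b - j))" arbitrary: a b rule: less_induct)
  case less
  consider "a = i" "b = j" | "i < a" "b = j" | "a = i" "j < b" | "i < a" "j < b"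
    using less.prems by linarith
  then show ?case
  proof cases
    case 1 then show ?thesis using corner by simp
  next
    case 2
    have "P (a - 1) j" using less.hyps[of "a - 1" j] 2 by auto
    then show ?thesis using row 2 by auto
  next
    case 3
    have "P i (b - 1)" using less.hyps[of i "b - 1"] 3 by auto
    then show ?thesis using col 3 by auto
  next
    case 4
    have "P (a - 1) b" "P a (b - 1)" using less.hyps[of "a - 1" b] less.hyps[of a "b - 1"] 4 less.prems by auto
    then show ?thesis using inner 4 by auto
  qed
qed

text \<open>Induction on the end point, starting from \<open>(k, l)\<close>. The right-hand side
  follows the recursion based at \<open>(k, l)\<close>; the left-hand side is at most each of its
  terms, since on the row or column through \<open>(k, l)\<close> its own minimum can only have more
  candidates.\<close>

lemma passage_time_triangle:
  assumes "i \<le> k" "j \<le> l" "k \<le> a" "l \<le> b"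
  shows "passage_time W (i, j) (a, b) \<le> passage_time W (i, j) (k, l) + passage_time W (k, l) (a, b)"
  using assms(3,4)
proof (induction rule: quadrant_induct)
  case corner
  then show ?case by simp
next
  case (row a)
  have "passage_time W (i, j) (a, l) \<le> passage_time W (i, j) (a - 1, l) + W (a, l) 1"
    using row assms passage_time_step[of i a j l W] passage_time_row[of i a W j] by (cases "j = l") auto
  then show ?case using row passage_time_row[of k a W l] by auto
next
  case (col b)
  have "passage_time W (i, j) (k, b) \<le> passage_time W (i, j) (k, b - 1) + W (k, b) 2"
    using col assms passage_time_step[of i k j b W] passage_time_col[of j b W i] by (cases "i = k") auto
  then show ?case using col passage_time_col[of l b W k] by auto
next
  case (inner a b)
  then show ?case using assms passage_time_step[of k a l b W] passage_time_step[of i a j b W] by auto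
qed

text \<open>Following free edges backwards from \<open>(a, b)\<close> (down where \<open>S\<close> holds, left elsewhere),
  \<open>exits_left S i j a b\<close> says that column \<open>i\<close> is reached before leaving the rows above \<open>j\<close>.\<close>

function exits_left :: "(site \<Rightarrow> bool) \<Rightarrow> int \<Rightarrow> int \<Rightarrow> int \<Rightarrow> int \<Rightarrow> bool" where
  "exits_left S i j a b = (if a \<le> i then True else if b \<le> j then False
     else if S (a, b) then exits_left S i j a (b - 1) else exits_left S i j (a - 1) b)"
  by auto
termination
  by (relation "Wellfounded.measure (\<lambda>(S, i, j, a, b). nat (a - i) + nat (b - j))") auto

declare exits_left.simps [simp del]

text \<open>The walk behind \<open>exits_left\<close>, continued forever, so that meeting times and
  sites of a free path can be named.\<close>

definition back_step :: "(site \<Rightarrow> bool) \<Rightarrow> site \<Rightarrow> site" where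
  "back_step S p = (if S p then (fst p, snd p - 1) else (fst p - 1, snd p))"

definition back_path :: "(site \<Rightarrow> bool) \<Rightarrow> site \<Rightarrow> nat \<Rightarrow> site" where
  "back_path S q n = (back_step S ^^ n) q"

lemma back_path_0 [simp]: "back_path S q 0 = q"
  by (simp add: back_path_def)

lemma back_path_Suc: "back_path S q (Suc n) = back_step S (back_path S q n)"
  by (simp add: back_path_def)

lemma back_path_Suc_shift: "back_path S q (Suc n) = back_path S (back_step S q) n"
  by (simp add: back_path_def funpow_swap1)

lemma back_path_add: "back_path S q (m + n) = back_path S (back_path S q m) n"
  by (simp add: back_path_def funpow_add add.commute[of m n])

lemma back_path_decreasing:
  assumes "m \<le> n"
  shows "fst (back_path S q n) \<le> fst (back_path S q m)" "snd (back_path S q n) \<le> snd (back_path S q m)"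
proof -
  have "fst (back_path S q n) \<le> fst (back_path S q m) \<and> snd (back_path S q n) \<le> snd (back_path S q m)"
    using assms by (induction rule: dec_induct) (auto simp: back_path_Suc back_step_def)
  then show "fst (back_path S q n) \<le> fst (back_path S q m)" "snd (back_path S q n) \<le> snd (back_path S q m)"
    by auto
qed

lemma back_path_level:
  "fst (back_path S q n) + snd (back_path S q n) = fst q + snd q - int n"
  by (induction n) (auto simp: back_path_Suc back_step_def)

lemma back_path_meets_row:
  assumes "m \<le> n" "snd (back_path S q n) \<le> b" "b \<le> snd (back_path S q m)"
  shows "\<exists>k. m \<le> k \<and> k \<le> n \<and> snd (back_path S q k) = b"
  using assms
proof (induction n rule: dec_induct)
  case base
  then show ?case by (intro exI[of _ m]) auto
next
  case (step n)
  show ?case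
  proof (cases "snd (back_path S q n) \<le> b")
    case True
    then show ?thesis using step by (meson le_Suc_eq)
  next
    case False
    then have "snd (back_path S q (Suc n)) = b"
      using step.prems by (auto simp: back_path_Suc back_step_def split: if_splits)
    then show ?thesis using step by (intro exI[of _ "Suc n"]) auto
  qed
qed

lemma back_path_meets_col:
  assumes "m \<le> n" "fst (back_path S q n) \<le> b" "b \<le> fst (back_path S q m)"
  shows "\<exists>k. m \<le> k \<and> k \<le> n \<and> fst (back_path S q k) = b"
  using assms
proof (induction n rule: dec_induct)
  case base
  then show ?case by (intro exI[of _ m]) auto
next
  case (step n)
  show ?case
  proof (cases "fst (back_path S q n) \<le> b")
    case True
    then show ?thesis using step by (meson le_Suc_eq)
  next
    case False
    then have "fst (back_path S q (Suc n)) = b"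
      using step.prems by (auto simp: back_path_Suc back_step_def split: if_splits)
    then show ?thesis using step by (intro exI[of _ "Suc n"]) auto
  qed
qed

text \<open>Turns the recursive predicate into geometry: the walk hits row \<open>j\<close> strictly
  to the right of column \<open>i\<close>. The converse is \<open>not_exits_leftI\<close>.\<close>

lemma not_exits_left_path:
  assumes "\<not> exits_left S i j a b" "j \<le> b"
  shows "\<exists>n k. back_path S (a, b) n = (k, j) \<and> i < k"
  using assms
proof (induction S i j a b rule: exits_left.induct)
  case (1 S i j a b)
  have a: "i < a" using 1(3) by (subst (asm) exits_left.simps) (auto split: if_splits)
  show ?case
  proof (cases "b \<le> j")
    case True
    then show ?thesis using 1(4) a by (intro exI[of _ 0] exI[of _ a]) auto
  next
    case b: False
    show ?thesis
    proof (cases "S (a, b)")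
      case True
      then have "\<not> exits_left S i j a (b - 1)" using 1(3) a b by (subst (asm) exits_left.simps) auto
      then obtain n k where "back_path S (a, b - 1) n = (k, j)" "i < k" using 1 a b True by fastforce
      then show ?thesis using True
        by (intro exI[of _ "Suc n"] exI[of _ k]) (auto simp: back_path_Suc_shift back_step_def)
    next
      case False
      then have "\<not> exits_left S i j (a - 1) b" using 1(3) a b by (subst (asm) exits_left.simps) auto
      then obtain n k where "back_path S (a - 1, b) n = (k, j)" "i < k" using 1 a b False by fastforce
      then show ?thesis using False
        by (intro exI[of _ "Suc n"] exI[of _ k]) (auto simp: back_path_Suc_shift back_step_def)
    qed
  qed
qed

lemma exits_left_path:
  assumes "exits_left S i j a b" "i \<le> a" "j \<le> b"
  shows "\<exists>n l. back_path S (a, b) n = (i, l) \<and> j \<le> l"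
  using assms
proof (induction S i j a b rule: exits_left.induct)
  case (1 S i j a b)
  show ?case
  proof (cases "a \<le> i")
    case True
    then show ?thesis using 1(4,5) by (intro exI[of _ 0] exI[of _ b]) auto
  next
    case a: False
    have b: "j < b" using 1(3) a by (subst (asm) exits_left.simps) (auto split: if_splits)
    show ?thesis
    proof (cases "S (a, b)")
      case True
      then have "exits_left S i j a (b - 1)" using 1(3) a b by (subst (asm) exits_left.simps) auto
      then obtain n l where "back_path S (a, b - 1) n = (i, l)" "j \<le> l" using 1 a b True by fastforce
      then show ?thesis using True
        by (intro exI[of _ "Suc n"] exI[of _ l]) (auto simp: back_path_Suc_shift back_step_def)
    next
      case False
      then have "exits_left S i j (a - 1) b" using 1(3) a b by (subst (asm) exits_left.simps) auto
      then obtain n l where "back_path S (a - 1, b) n = (i, l)" "j \<le> l" using 1 a b False by fastforce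
      then show ?thesis using False
        by (intro exI[of _ "Suc n"] exI[of _ l]) (auto simp: back_path_Suc_shift back_step_def)
    qed
  qed
qed

lemma not_exits_leftI:
  assumes "back_path S (a, b) n = (k, j)" "i < k"
  shows "\<not> exits_left S i j a b"
  using assms
proof (induction n arbitrary: a b)
  case 0
  then show ?case by (subst exits_left.simps) auto
next
  case (Suc n)
  have eq: "back_path S (back_step S (a, b)) n = (k, j)" using Suc by (simp add: back_path_Suc_shift)
  then have "\<not> exits_left S i j (fst (back_step S (a, b))) (snd (back_step S (a, b)))"
    using Suc by simp
  moreover have "i < a" using back_path_decreasing(1)[of 0 "Suc n" S "(a, b)"] Suc.prems by auto
  ultimately show ?case
    by (subst exits_left.simps) (auto simp: back_step_def split: if_splits)
qed

text \<open>Only signs and the zero pattern of the weights are recorded. The results thus serve the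
  SJR/SWFPP pair and, with \<open>S\<close> constantly true and \<open>W\<close> equal to
  \<open>W0\<close>, the field \<open>hweights\<close> on its own.\<close>

locale switched_weights =
  fixes S :: "site \<Rightarrow> bool" and W W0 :: weights
  assumes W1_nonneg: "\<And>z. 0 \<le> W z 1" and W2_nonneg: "\<And>z. 0 \<le> W z 2"
    and W1_off: "\<And>z. \<not> S z \<Longrightarrow> W z 1 = 0" and W2_off: "\<And>z. S z \<Longrightarrow> W z 2 = 0"
    and W0_1: "\<And>z. W0 z 1 = W z 1" and W0_2: "\<And>z. W0 z 2 = 0"
begin

abbreviation "T \<equiv> passage_time W"
abbreviation "F \<equiv> passage_time W0"

lemma F_col0:
  assumes "j \<le> b"
  shows "F (i, j) (i, b) = 0"
  using assms
proof (induction b rule: int_ge_induct)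
  case (step b)
  then show ?case using passage_time_col[of j "b + 1" W0 i] by (simp add: W0_2)
qed simp

lemma F_row:
  "i < a \<Longrightarrow> F (i, j) (a, j) = F (i, j) (a - 1, j) + W (a, j) 1"
  by (simp only: passage_time_row W0_1)

lemma F_step:
  "i < a \<Longrightarrow> j < b \<Longrightarrow> F (i, j) (a, b) = min (F (i, j) (a - 1, b) + W (a, b) 1) (F (i, j) (a, b - 1))"
  by (simp only: passage_time_step W0_1 W0_2 add_0_right)

lemma F_mono_up:
  assumes "i \<le> a" "j < b"
  shows "F (i, j) (a, b) \<le> F (i, j) (a, b - 1)"
  using assms by (cases "a = i") (auto simp: F_step F_col0)

text \<open>Both terms of the minimum are at least \<open>F (i, j) (a - 1, b)\<close>: the first by
  non-negativity, the second through \<open>F (i, j) (a - 1, b - 1)\<close>, because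
  \<open>F\<close> decreases upwards.\<close>

lemma F_mono_right:
  assumes "i < a" "j \<le> b"
  shows "F (i, j) (a - 1, b) \<le> F (i, j) (a, b)"
proof -
  have "i + 1 \<le> a" using assms by simp
  then show ?thesis using assms(2)
  proof (induction rule: quadrant_induct)
    case corner
    then show ?case using F_row[of i "i + 1" j] W1_nonneg[of "(i + 1, j)"] by simp
  next
    case (row a)
    then show ?case using F_row[of i a j] W1_nonneg[of "(a, j)"] by simp
  next
    case (col b)
    then show ?case using F_step[of i "i + 1" j b] W1_nonneg[of "(i + 1, b)"] F_col0 by simp
  next
    case (inner a b)
    then show ?case
      using F_step[of i a j b] W1_nonneg[of "(a, b)"] F_mono_up[of i "a - 1" j b] by auto
  qed
qed

lemma F_nonneg: "i \<le> a \<Longrightarrow> j \<le> b \<Longrightarrow> 0 \<le> F (i, j) (a, b)"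
proof (induction rule: quadrant_induct)
  case (row a)
  then show ?case using F_row[of i a j] W1_nonneg[of "(a, j)"] by simp
next
  case (col b)
  then show ?case by (simp add: F_col0)
next
  case (inner a b)
  then show ?case using F_step[of i a j b] W1_nonneg[of "(a, b)"] by simp
qed simp

lemma T_nonneg: "i \<le> a \<Longrightarrow> j \<le> b \<Longrightarrow> 0 \<le> T (i, j) (a, b)"
proof (induction rule: quadrant_induct)
  case (row a)
  then show ?case using passage_time_row[of i a W j] W1_nonneg[of "(a, j)"] by simp
next
  case (col b)
  then show ?case using passage_time_col[of j b W i] W2_nonneg[of "(i, b)"] by simp
next
  case (inner a b)
  then show ?case
    using passage_time_step[of i a j b W] W1_nonneg[of "(a, b)"] W2_nonneg[of "(a, b)"] by simp
qed simp

text \<open>Away from its first column, the passage time with free vertical edges solves the recursion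
  of the switched model: where \<open>S\<close> fails, arriving from the left is optimal anyway.\<close>

lemma F_step_switched:
  assumes "i < a" "j < b"
  shows "F (i, j) (a, b) = min (F (i, j) (a - 1, b) + W (a, b) 1) (F (i, j) (a, b - 1) + W (a, b) 2)"
proof (cases "S (a, b)")
  case True
  then show ?thesis using F_step assms W2_off by simp
next
  case False
  have "F (i, j) (a - 1, b) \<le> F (i, j) (a - 1, b - 1)" using assms by (intro F_mono_up) auto
  also have "\<dots> \<le> F (i, j) (a, b - 1)" using assms by (intro F_mono_right) auto
  finally show ?thesis using F_step[OF assms] W1_off[OF False] W2_nonneg[of "(a, b)"] by simp
qed

lemma F_le_T: "i \<le> a \<Longrightarrow> j \<le> b \<Longrightarrow> F (i, j) (a, b) \<le> T (i, j) (a, b)"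
proof (induction rule: quadrant_induct)
  case (row a)
  then show ?case using passage_time_row[of i a W j] F_row[of i a j] by simp
next
  case (col b)
  then show ?case using T_nonneg[of i i j b] by (simp add: F_col0)
next
  case (inner a b)
  then show ?case
    using passage_time_step[of i a j b W] F_step_switched[of i a j b] by linarith
qed simp

text \<open>The walk of \<open>B\<close> joins column \<open>i\<close> to \<open>(a, b)\<close> with
  horizontal edges of weight zero, and for \<open>F\<close> climbing is free. The field
  \<open>B\<close> is left open because it will be \<open>S\<close> as well as the set of positive
  horizontal weights.\<close>

lemma F_zero_if_exits_left:
  assumes "exits_left B i j a b" "\<And>z. \<not> B z \<Longrightarrow> W z 1 = 0" "i \<le> a" "j \<le> b"
  shows "F (i, j) (a, b) = 0"
proof -
  have "F (i, j) (a, b) \<le> 0"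
    using assms(3,4,1)
  proof (induction rule: quadrant_induct)
    case (row a)
    then show ?case by (subst (asm) (2) exits_left.simps) auto
  next
    case (col b)
    then show ?case by (simp add: F_col0)
  next
    case (inner a b)
    then show ?case
      using F_step[of i a j b] assms(2)[of "(a, b)"]
      by (subst (asm) (3) exits_left.simps) (auto split: if_splits simp: min_le_iff_disj)
  qed simp
  then show ?thesis using F_nonneg assms by (simp add: order_antisym)
qed

text \<open>A path from \<open>(i, j)\<close> enters column \<open>i + 1\<close> somewhere, and
  \<open>F\<close> reaches that site from \<open>(i + 1, j)\<close> for free.\<close>

lemma F_start_right:
  assumes "i < a" "j \<le> b"
  shows "F (i + 1, j) (a, b) \<le> F (i, j) (a, b)"
proof -
  have "i + 1 \<le> a" using assms by simp
  then show ?thesis using assms(2)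
  proof (induction rule: quadrant_induct)
    case corner
    then show ?case using F_nonneg by simp
  next
    case (row a)
    then show ?case using F_row[of i a j] F_row[of "i + 1" a j] by simp
  next
    case (col b)
    then show ?case using F_nonneg[of i "i + 1" j b] F_col0[of j b "i + 1"] by simp
  next
    case (inner a b)
    then show ?case
      using F_step[of i a j b] F_step[of "i + 1" a j b] by auto
  qed
qed

lemma F_start_right_le:
  assumes "i \<le> k" "k \<le> a" "j \<le> b"
  shows "F (k, j) (a, b) \<le> F (i, j) (a, b)"
  using assms(1,2)
proof (induction k rule: int_ge_induct)
  case (step k)
  then show ?case using F_start_right[of k a j b] assms(3) by auto
qed simp

lemma F_le_T_above:
  assumes "j \<le> l" "l \<le> b" "i \<le> a"
  shows "F (i, j) (a, b) \<le> T (i, l) (a, b)"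
proof -
  have "F (i, j) (a, b) \<le> F (i, j) (i, l) + F (i, l) (a, b)"
    using assms by (intro passage_time_triangle) auto
  then show ?thesis using F_col0[of j l i] F_le_T[of i a l b] assms by simp
qed


lemma T_step_down: "S (a, b) \<Longrightarrow> i \<le> a \<Longrightarrow> j < b \<Longrightarrow> T (i, j) (a, b) \<le> T (i, j) (a, b - 1)"
  using passage_time_step[of i a j b W] passage_time_col[of j b W i] W2_off[of "(a, b)"]
  by (cases "a = i") auto

lemma T_step_left: "W (a, b) 1 = 0 \<Longrightarrow> i < a \<Longrightarrow> j \<le> b \<Longrightarrow> T (i, j) (a, b) \<le> T (i, j) (a - 1, b)"
  using passage_time_step[of i a j b W] passage_time_row[of i a W j]
  by (cases "b = j") auto

text \<open>The witness \<open>l\<close> is the height at which the free path of \<open>S\<close>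
  from \<open>(a, b)\<close> enters column \<open>i\<close>. The last two hypotheses place this
  height between \<open>j\<close> and \<open>J\<close>, and the path is free for \<open>T\<close>
  too.\<close>

lemma T_zero_from_column:
  assumes "i \<le> a" "j \<le> b" "exits_left S i j a b" "b \<le> J \<or> \<not> exits_left S i J a b"
  shows "\<exists>l. j \<le> l \<and> l \<le> J \<and> l \<le> b \<and> T (i, l) (a, b) \<le> 0"
  using assms
proof (induction rule: quadrant_induct)
  case corner
  then show ?case by (auto simp: exits_left.simps[of S i J i j] intro!: exI[of _ j])
next
  case (row a)
  then show ?case by (auto simp: exits_left.simps[of S i j a j])
next
  case (col b)
  then show ?case by (auto simp: exits_left.simps[of S i J i b] intro!: exI[of _ b])
next
  case (inner a b)
  show ?case
  proof (cases "S (a, b)")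
    case True
    then have "exits_left S i j a (b - 1)" "b - 1 \<le> J \<or> \<not> exits_left S i J a (b - 1)"
      using inner.prems inner.hyps exits_left.simps[of S i j a b] exits_left.simps[of S i J a b] by auto
    then obtain l where l: "j \<le> l" "l \<le> J" "l \<le> b - 1" "T (i, l) (a, b - 1) \<le> 0"
      using inner.IH(2) by auto
    then have "T (i, l) (a, b) \<le> 0"
      using T_step_down[OF True, of i l] inner.hyps by auto
    with l show ?thesis by (intro exI[of _ l]) auto
  next
    case False
    then have "exits_left S i j (a - 1) b" "b \<le> J \<or> \<not> exits_left S i J (a - 1) b"
      using inner.prems inner.hyps exits_left.simps[of S i j a b] exits_left.simps[of S i J a b] by auto
    then obtain l where l: "j \<le> l" "l \<le> J" "l \<le> b" "T (i, l) (a - 1, b) \<le> 0"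
      using inner.IH(1) by auto
    then have "T (i, l) (a, b) \<le> 0"
      using T_step_left[OF W1_off[OF False], of i l] inner.hyps by auto
    with l show ?thesis by (intro exI[of _ l]) auto
  qed
qed

text \<open>Follow the free path of \<open>(c, b)\<close> to the left along row \<open>b\<close>
  until it goes down; this happens before column \<open>i\<close>, because the path enters that
  column no higher than \<open>J\<close>. It hands the hypothesis of \<open>F_attained_low\<close>
  to row \<open>b - 1\<close>.\<close>

lemma separating_path_row_below:
  assumes "i \<le> c" "J < b" "j < b" "exits_left S i j c b" "\<not> exits_left S i J c b"
  shows "\<exists>c'. i \<le> c' \<and> c' \<le> c \<and> exits_left S i j c' (b - 1) \<and> \<not> exits_left S i J c' (b - 1)"
  using assms(1,4,5)
proof (induction c rule: int_ge_induct)
  case base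
  then show ?case by (simp add: exits_left.simps[of S i J i b])
next
  case (step c)
  show ?case
  proof (cases "S (c + 1, b)")
    case True
    then show ?thesis using step assms exits_left.simps[of S i j "c + 1" b] exits_left.simps[of S i J "c + 1" b]
      by (intro exI[of _ "c + 1"]) auto
  next
    case False
    then have "exits_left S i j c b" "\<not> exits_left S i J c b"
      using step assms exits_left.simps[of S i j "c + 1" b] exits_left.simps[of S i J "c + 1" b] by auto
    then show ?thesis using step.IH by fastforce
  qed
qed

text \<open>An optimal path for \<open>F\<close> climbs the first column for free and then avoids all positive vertical
  weights; a free path that separates \<open>(i, J)\<close> from \<open>(a, b)\<close> bounds the height of its exit.\<close>

lemma F_attained_low:
  assumes "i \<le> a" "j \<le> b" "j \<le> J"
    and "b \<le> J \<or> (\<exists>c. i \<le> c \<and> c \<le> a \<and> exits_left S i j c b \<and> \<not> exits_left S i J c b)"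
  shows "\<exists>l. j \<le> l \<and> l \<le> J \<and> l \<le> b \<and> T (i, l) (a, b) \<le> F (i, j) (a, b)"
  using assms(1,2,4)
proof (induction rule: quadrant_induct)
  case corner
  then show ?case using assms(3) by (intro exI[of _ j]) auto
next
  case (row a)
  have "\<exists>l. j \<le> l \<and> l \<le> J \<and> l \<le> j \<and> T (i, l) (a - 1, j) \<le> F (i, j) (a - 1, j)"
    using row.IH assms(3) by simp
  then have "T (i, j) (a - 1, j) \<le> F (i, j) (a - 1, j)" by (metis order_antisym)
  then have "T (i, j) (a, j) \<le> F (i, j) (a, j)"
    using passage_time_row[of i a W j] F_row[of i a j] row.hyps by simp
  then show ?case using assms(3) by (intro exI[of _ j]) auto
next
  case (col b)
  show ?case
  proof (cases "b \<le> J")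
    case True
    then show ?thesis using col F_col0[of j b i] by (intro exI[of _ b]) auto
  next
    case False
    then obtain c where "c = i" "\<not> exits_left S i J c b" using col.prems by auto
    then show ?thesis by (auto simp: exits_left.simps[of S i J i b])
  qed
next
  case (inner a b)
  show ?case
  \<comment> \<open>If the free path of \<open>(a, b)\<close> itself enters column \<open>i\<close>
    between \<open>j\<close> and \<open>J\<close>, then \<open>(a, b)\<close> is reached from there
    for free. Otherwise a separating site of row \<open>b\<close>, if one is required, lies strictly
    to the left, so both predecessors inherit the hypothesis.\<close>
  proof (cases "exits_left S i j a b \<and> (b \<le> J \<or> \<not> exits_left S i J a b)")
    case True
    then obtain l where "j \<le> l" "l \<le> J" "l \<le> b" "T (i, l) (a, b) \<le> 0"
      using T_zero_from_column[of i a j b J] inner.hyps by auto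
    then show ?thesis using F_nonneg[of i a j b] inner.hyps by (intro exI[of _ l]) auto
  next
    case nmid: False
    have left: "b \<le> J \<or> (\<exists>c. i \<le> c \<and> c \<le> a - 1 \<and> exits_left S i j c b \<and> \<not> exits_left S i J c b)"
      using inner.prems nmid by (metis zle_diff1_eq order_le_less)
    have down: "b - 1 \<le> J \<or> (\<exists>c. i \<le> c \<and> c \<le> a \<and> exits_left S i j c (b - 1) \<and> \<not> exits_left S i J c (b - 1))"
    proof (cases "b \<le> J")
      case False
      then obtain c where "i \<le> c" "c \<le> a" "exits_left S i j c b" "\<not> exits_left S i J c b"
        using inner.prems by auto
      then show ?thesis using separating_path_row_below[of i c J b j] False inner.hyps by fastforce
    qed simp
    obtain l1 where l1: "j \<le> l1" "l1 \<le> J" "l1 \<le> b" "T (i, l1) (a - 1, b) \<le> F (i, j) (a - 1, b)"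
      using inner.IH(1)[OF left] by auto
    obtain l2 where l2: "j \<le> l2" "l2 \<le> J" "l2 \<le> b - 1" "T (i, l2) (a, b - 1) \<le> F (i, j) (a, b - 1)"
      using inner.IH(2)[OF down] by auto
    have "T (i, l1) (a, b) \<le> F (i, j) (a - 1, b) + W (a, b) 1"
      using l1 inner.hyps passage_time_step[of i a l1 b W] passage_time_row[of i a W l1] by (cases "l1 = b") auto
    moreover have "T (i, l2) (a, b) \<le> F (i, j) (a, b - 1) + W (a, b) 2"
      using l2 inner.hyps passage_time_step[of i a l2 b W] by auto
    ultimately have "T (i, l1) (a, b) \<le> F (i, j) (a, b) \<or> T (i, l2) (a, b) \<le> F (i, j) (a, b)"
      using F_step_switched[of i a j b] inner.hyps by (auto simp: min_def)
    then show ?thesis using l1 l2 by force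
  qed
qed

text \<open>Side of a site relative to a finite piece of a path, tested along its row, or along its
  column for \<open>above_of\<close>; sites of the path count for both sides. The next lemmas form a
  discrete Jordan argument: until the path ends, a step back from a site off the path stays on the
  same side.\<close>

definition right_of :: "(nat \<Rightarrow> site) \<Rightarrow> nat \<Rightarrow> int \<Rightarrow> int \<Rightarrow> bool" where
  "right_of z n0 a b \<longleftrightarrow> (\<exists>n\<le>n0. snd (z n) = b \<and> fst (z n) \<le> a)"

definition above_of :: "(nat \<Rightarrow> site) \<Rightarrow> nat \<Rightarrow> int \<Rightarrow> int \<Rightarrow> bool" where
  "above_of z n0 a b \<longleftrightarrow> (\<exists>n\<le>n0. fst (z n) = a \<and> snd (z n) \<le> b)"

lemma right_of_left:
  assumes "right_of z n0 a b" "(a, b) \<notin> z ` {..n0}"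
  shows "right_of z n0 (a - 1) b"
proof -
  obtain n where n: "n \<le> n0" "snd (z n) = b" "fst (z n) \<le> a" using assms(1) by (auto simp: right_of_def)
  have "fst (z n) \<noteq> a" using assms(2) n by (metis atMost_iff image_eqI prod.collapse)
  with n show ?thesis by (auto simp: right_of_def)
qed

lemma above_of_down:
  assumes "above_of z n0 a b" "(a, b) \<notin> z ` {..n0}"
  shows "above_of z n0 a (b - 1)"
proof -
  obtain n where n: "n \<le> n0" "fst (z n) = a" "snd (z n) \<le> b" using assms(1) by (auto simp: above_of_def)
  have "snd (z n) \<noteq> b" using assms(2) n by (metis atMost_iff image_eqI prod.collapse)
  with n show ?thesis by (auto simp: above_of_def)
qed

lemma right_of_down:
  assumes "right_of (back_path B q) n0 a b" "snd (back_path B q n0) \<le> b'" "b' \<le> b"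
  shows "right_of (back_path B q) n0 a b'"
proof -
  obtain n where n: "n \<le> n0" "snd (back_path B q n) = b" "fst (back_path B q n) \<le> a"
    using assms(1) by (auto simp: right_of_def)
  then obtain k where "n \<le> k" "k \<le> n0" "snd (back_path B q k) = b'"
    using back_path_meets_row[of n n0 B q b'] assms by auto
  then show ?thesis
    using back_path_decreasing(1)[of n k B q] n by (auto simp: right_of_def intro!: exI[of _ k])
qed

lemma above_of_left:
  assumes "above_of (back_path B q) n0 a b" "fst (back_path B q n0) \<le> a'" "a' \<le> a"
  shows "above_of (back_path B q) n0 a' b"
proof -
  obtain n where n: "n \<le> n0" "fst (back_path B q n) = a" "snd (back_path B q n) \<le> b"
    using assms(1) by (auto simp: above_of_def)
  then obtain k where "n \<le> k" "k \<le> n0" "fst (back_path B q k) = a'"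
    using back_path_meets_col[of n n0 B q a'] assms by auto
  then show ?thesis
    using back_path_decreasing(2)[of n k B q] n by (auto simp: above_of_def intro!: exI[of _ k])
qed

lemma right_of_bound: "right_of (back_path B q) n0 a b \<Longrightarrow> fst (back_path B q n0) \<le> a"
  using back_path_decreasing(1)[of _ n0 B q] unfolding right_of_def by fastforce

lemma above_of_bound: "above_of (back_path B q) n0 a b \<Longrightarrow> snd (back_path B q n0) \<le> b"
  using back_path_decreasing(2)[of _ n0 B q] unfolding above_of_def by fastforce

text \<open>A choice of an incoming edge of weight zero at every site. Besides \<open>S\<close>, the
  set of sites with positive horizontal weight is such a field: there the switch is on, so the
  vertical weight is zero. Its paths go down less often and are flatter.\<close>

definition free_field :: "(site \<Rightarrow> bool) \<Rightarrow> bool" where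
  "free_field B \<longleftrightarrow> (\<forall>z. (B z \<longrightarrow> W z 2 = 0) \<and> (\<not> B z \<longrightarrow> W z 1 = 0))"

lemma free_field_S: "free_field S"
  using W1_off W2_off by (auto simp: free_field_def)

lemma T_back_path_zero:
  assumes "free_field B" "m \<le> n"
  shows "T (back_path B q n) (back_path B q m) = 0"
  using assms(2)
proof (induction rule: inc_induct)
  case base
  then show ?case by simp
next
  case (step m)
  obtain a b where ab: "back_path B q m = (a, b)" by fastforce
  obtain i j where ij: "back_path B q n = (i, j)" by fastforce
  have le: "i \<le> fst (back_path B q (Suc m))" "j \<le> snd (back_path B q (Suc m))"
    using back_path_decreasing[of "Suc m" n B q] step.hyps ij by auto
  have "T (i, j) (a, b) \<le> 0"
  proof (cases "B (a, b)")
    case True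
    then have "back_path B q (Suc m) = (a, b - 1)" by (simp add: back_path_Suc back_step_def ab)
    moreover have "W (a, b) 2 = 0" using True assms(1) by (simp add: free_field_def)
    ultimately show ?thesis
      using step.IH le ij passage_time_step[of i a j b W] passage_time_col[of j b W i] by (cases "a = i") auto
  next
    case False
    then have "back_path B q (Suc m) = (a - 1, b)" by (simp add: back_path_Suc back_step_def ab)
    moreover have "W (a, b) 1 = 0" using False assms(1) by (simp add: free_field_def)
    ultimately show ?thesis
      using step.IH le ij T_step_left[of a b i j] by auto
  qed
  moreover have "0 \<le> T (i, j) (a, b)"
    using T_nonneg back_path_decreasing[of m n B q] step.hyps ij ab by auto
  ultimately show ?case using ij ab by simp
qed

text \<open>The path ends in row \<open>j\<close> to the right of \<open>(i, j)\<close>, hence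
  separates it from \<open>(a, b)\<close>, and a geodesic must meet it. The induction follows one
  optimal last edge; the splitting at the predecessor extends along that edge.\<close>

lemma T_split_at_back_path:
  assumes end_row: "back_path B q n0 = (k, j)" "i < k"
    and "i \<le> a" "j \<le> b" "right_of (back_path B q) n0 a b"
  shows "\<exists>n\<le>n0. \<exists>c d. back_path B q n = (c, d) \<and> i \<le> c \<and> c \<le> a \<and> j \<le> d \<and> d \<le> b
           \<and> T (i, j) (a, b) = T (i, j) (c, d) + T (c, d) (a, b)"
  using assms(3-5)
proof (induction "nat (a - i + (b - j))" arbitrary: a b rule: less_induct)
  case less
  let ?Q = "\<lambda>a b. \<exists>n\<le>n0. \<exists>c d. back_path B q n = (c, d) \<and> i \<le> c \<and> c \<le> a \<and> j \<le> d \<and> d \<le> b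
           \<and> T (i, j) (a, b) = T (i, j) (c, d) + T (c, d) (a, b)"
  show ?case
  proof (cases "(a, b) \<in> back_path B q ` {..n0}")
    case True
    then obtain n where "n \<le> n0" "back_path B q n = (a, b)" by (metis atMost_iff imageE)
    then show ?thesis using less.prems by (intro exI[of _ n]) auto
  next
    case False
    have ai: "i < a" using right_of_bound[OF less.prems(3)] end_row by simp
    have "right_of (back_path B q) n0 (a - 1) b" using right_of_left False less.prems by blast
    then have Ql: "?Q (a - 1) b" using less.hyps[of "a - 1" b] less.prems ai by auto
    have Qd: "?Q a (b - 1)" if "j < b"
    proof -
      have "right_of (back_path B q) n0 a (b - 1)"
        using right_of_down[OF less.prems(3), of "b - 1"] end_row that by simp
      then show ?thesis using less.hyps[of a "b - 1"] less.prems that by auto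
    qed
    have ext1: "?Q a b" if "T (i, j) (a, b) = T (i, j) (a - 1, b) + W (a, b) 1"
    proof -
      obtain n c d where n: "n \<le> n0" "back_path B q n = (c, d)" "i \<le> c" "c \<le> a - 1" "j \<le> d" "d \<le> b"
           "T (i, j) (a - 1, b) = T (i, j) (c, d) + T (c, d) (a - 1, b)" using Ql by auto
      have "T (c, d) (a, b) \<le> T (c, d) (a - 1, b) + W (a, b) 1"
        using n passage_time_step[of c a d b W] passage_time_row[of c a W d] by (cases "b = d") auto
      moreover have "T (i, j) (a, b) \<le> T (i, j) (c, d) + T (c, d) (a, b)"
        using n by (intro passage_time_triangle) auto
      ultimately have "T (i, j) (a, b) = T (i, j) (c, d) + T (c, d) (a, b)" using n that by auto
      then show ?thesis using n by (intro exI[of _ n]) auto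
    qed
    have ext2: "?Q a b" if jb: "j < b" and "T (i, j) (a, b) = T (i, j) (a, b - 1) + W (a, b) 2"
    proof -
      obtain n c d where n: "n \<le> n0" "back_path B q n = (c, d)" "i \<le> c" "c \<le> a" "j \<le> d" "d \<le> b - 1"
           "T (i, j) (a, b - 1) = T (i, j) (c, d) + T (c, d) (a, b - 1)" using Qd jb by auto
      have "T (c, d) (a, b) \<le> T (c, d) (a, b - 1) + W (a, b) 2"
        using n passage_time_step[of c a d b W] passage_time_col[of d b W c] by (cases "a = c") auto
      moreover have "T (i, j) (a, b) \<le> T (i, j) (c, d) + T (c, d) (a, b)"
        using n by (intro passage_time_triangle) auto
      ultimately have "T (i, j) (a, b) = T (i, j) (c, d) + T (c, d) (a, b)" using n that by auto
      then show ?thesis using n by (intro exI[of _ n]) auto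
    qed
    show ?thesis
    proof (cases "b = j")
      case True
      then show ?thesis using ext1 passage_time_row[of i a W j] ai by simp
    next
      case False
      then have "j < b" using less.prems by simp
      then show ?thesis using ext1 ext2 passage_time_step[of i a j b W] ai by (auto simp: min_def split: if_splits)
    qed
  qed
qed

text \<open>The two recursions differ only in column \<open>i\<close>. To the right of a free path
  ending at \<open>(i, j)\<close> that column is never consulted: sites on the path have
  \<open>T\<close> equal to 0, and the others satisfy \<open>i < a\<close>.\<close>

lemma T_eq_F_from_back_path:
  assumes start: "back_path S q n0 = (i, j)"
    and "i \<le> a" "j \<le> b" "right_of (back_path S q) n0 a b"
  shows "T (i, j) (a, b) = F (i, j) (a, b)"
proof -
  have "T (i, j) (a, b) \<le> F (i, j) (a, b)"
    using assms(2-4)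
  proof (induction "nat (a - i + (b - j))" arbitrary: a b rule: less_induct)
    case less
    show ?case
    proof (cases "(a, b) \<in> back_path S q ` {..n0}")
      case True
      then obtain n where "n \<le> n0" "back_path S q n = (a, b)" by (metis atMost_iff imageE)
      then have "T (i, j) (a, b) = 0" using T_back_path_zero[OF free_field_S, of n n0 q] start by simp
      then show ?thesis using F_nonneg less.prems by simp
    next
      case False
      have r: "right_of (back_path S q) n0 (a - 1) b" using right_of_left False less.prems by blast
      have ai: "i < a" using right_of_bound[OF r] start by simp
      have l: "T (i, j) (a - 1, b) \<le> F (i, j) (a - 1, b)"
        using less.hyps[of "a - 1" b] less.prems ai r by auto
      show ?thesis
      proof (cases "b = j")
        case True
        then show ?thesis using l passage_time_row[of i a W j] F_row[of i a j] ai by simp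
      next
        case False
        then have jb: "j < b" using less.prems by simp
        have "right_of (back_path S q) n0 a (b - 1)"
          using right_of_down[OF less.prems(3), of "b - 1"] start jb by simp
        then have "T (i, j) (a, b - 1) \<le> F (i, j) (a, b - 1)"
          using less.hyps[of a "b - 1"] less.prems jb by auto
        then show ?thesis
          using l passage_time_step[of i a j b W] F_step_switched[of i a j b] ai jb by auto
      qed
    qed
  qed
  then show ?thesis using F_le_T assms by (simp add: order_antisym)
qed

text \<open>A geodesic to \<open>(a, b)\<close> meets the free path of \<open>(c, d)\<close>, and
  from the meeting point \<open>(c, d)\<close> is reached at no cost.\<close>

lemma T_le_of_right_of:
  assumes "free_field B" "back_path B (c, d) n0 = (k, j)" "i < k" "i \<le> a" "j \<le> b"
    and "right_of (back_path B (c, d)) n0 a b"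
  shows "T (i, j) (c, d) \<le> T (i, j) (a, b)"
proof -
  obtain n c' d' where n: "n \<le> n0" "back_path B (c, d) n = (c', d')" "i \<le> c'" "c' \<le> a" "j \<le> d'" "d' \<le> b"
      "T (i, j) (a, b) = T (i, j) (c', d') + T (c', d') (a, b)"
    using T_split_at_back_path[OF assms(2-6)] by auto
  have "T (i, j) (c, d) \<le> T (i, j) (c', d') + T (c', d') (c, d)"
    using n back_path_decreasing[of 0 n B "(c, d)"] by (intro passage_time_triangle) auto
  moreover have "T (c', d') (c, d) = 0" using T_back_path_zero[OF assms(1), of 0 n "(c, d)"] n by simp
  moreover have "0 \<le> T (c', d') (a, b)" using T_nonneg n by simp
  ultimately show ?thesis using n by simp
qed

text \<open>Counterpart for targets above a path that ends in column \<open>i\<close> at or above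
  the starting point: tracing the recursion back from \<open>(a, b)\<close> hits the path, and from
  there \<open>(c, d)\<close> costs nothing.\<close>

lemma T_le_of_above_of:
  assumes "free_field B" "back_path B (c, d) n0 = (i, k)" "j \<le> k" "i \<le> a" "j \<le> b"
    and "above_of (back_path B (c, d)) n0 a b"
  shows "T (i, j) (c, d) \<le> T (i, j) (a, b)"
  using assms(4-6)
proof (induction "nat (a - i + (b - j))" arbitrary: a b rule: less_induct)
  case less
  show ?case
  proof (cases "(a, b) \<in> back_path B (c, d) ` {..n0}")
    case True
    then obtain n where n: "n \<le> n0" "back_path B (c, d) n = (a, b)" by (metis atMost_iff imageE)
    have "T (i, j) (c, d) \<le> T (i, j) (a, b) + T (a, b) (c, d)"
      using n back_path_decreasing[of 0 n B "(c, d)"] less.prems by (intro passage_time_triangle) auto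
    then show ?thesis using T_back_path_zero[OF assms(1), of 0 n "(c, d)"] n by simp
  next
    case False
    have r: "above_of (back_path B (c, d)) n0 a (b - 1)" using above_of_down False less.prems by blast
    have bj: "j < b" using above_of_bound[OF r] assms(2,3) by simp
    have l: "T (i, j) (c, d) \<le> T (i, j) (a, b - 1)"
      using less.hyps[of a "b - 1"] less.prems bj r by auto
    show ?thesis
    proof (cases "a = i")
      case True
      then show ?thesis using l passage_time_col[of j b W i] bj W2_nonneg[of "(i, b)"] by simp
    next
      case False
      then have ia: "i < a" using less.prems by simp
      have "above_of (back_path B (c, d)) n0 (a - 1) b"
        using above_of_left[OF less.prems(3), of "a - 1"] assms(2) ia by simp
      then have "T (i, j) (c, d) \<le> T (i, j) (a - 1, b)"
        using less.hyps[of "a - 1" b] less.prems ia by auto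
      then show ?thesis
        using l passage_time_step[of i a j b W] bj ia W2_nonneg[of "(a, b)"] W1_nonneg[of "(a, b)"] by simp
    qed
  qed
qed

end

section \<open>Coalescence in a cone of directions\<close>

text \<open>The linear functional that vanishes on the direction (1 - \<alpha>, \<alpha>) of free
  paths and is positive on flatter directions; (t, 1 - t) has drift t - (1 - \<alpha>).\<close>

definition drift :: "real \<Rightarrow> real \<Rightarrow> real \<Rightarrow> real" where
  "drift \<alpha> a b = \<alpha> * a - (1 - \<alpha>) * b"

lemma drift_bound:
  assumes "0 \<le> \<alpha>" "\<alpha> \<le> 1" "\<bar>a\<bar> \<le> e" "\<bar>b\<bar> \<le> e"
  shows "\<bar>drift \<alpha> a b\<bar> \<le> e"
proof -
  have "\<bar>drift \<alpha> a b\<bar> \<le> \<bar>\<alpha> * a\<bar> + \<bar>(1 - \<alpha>) * b\<bar>" unfolding drift_def by linarith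
  also have "\<dots> = \<alpha> * \<bar>a\<bar> + (1 - \<alpha>) * \<bar>b\<bar>" using assms by (simp add: abs_mult)
  also have "\<dots> \<le> \<alpha> * e + (1 - \<alpha>) * e"
    using assms by (intro add_mono mult_left_mono) auto
  finally show ?thesis by (simp add: algebra_simps)
qed

definition in_cone :: "real \<Rightarrow> real \<Rightarrow> real \<Rightarrow> site \<Rightarrow> bool" where
  "in_cone t \<rho> R v \<longleftrightarrow> R \<le> norm1 v \<and> \<bar>real_of_int (fst v) + t * norm1 v\<bar> \<le> \<rho> * norm1 v
     \<and> \<bar>real_of_int (snd v) + (1 - t) * norm1 v\<bar> \<le> \<rho> * norm1 v"

lemma norm1_nonneg [simp]: "0 \<le> norm1 v"
  by (simp add: norm1_def)

lemma abs_scaled_le_iff: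
  fixes N :: real
  assumes "0 < N"
  shows "\<bar>a / N + s\<bar> \<le> e \<longleftrightarrow> \<bar>a + s * N\<bar> \<le> e * N"
proof -
  have "a / N + s = (a + s * N) / N" using assms by (simp add: field_simps)
  then show ?thesis using assms by (simp add: pos_divide_le_eq)
qed

text \<open>The domination lemmas produce some \<open>u\<close> from \<open>v\<close> with no
  control of sequences, so convergence is restated on cones. If the estimate failed for some
  \<delta>, counterexamples in cones of aperture \<open>1 / Suc n\<close> and radius
  \<open>Suc n\<close> would form an admissible sequence.\<close>

lemma sw_admissible_limit_iff:
  fixes f :: "site \<Rightarrow> real"
  shows "(\<forall>v. sw_admissible t v \<longrightarrow> (\<lambda>n. f (v n)) \<longlonglongrightarrow> c) \<longleftrightarrow>
         (\<forall>\<delta>>0. \<exists>\<rho>>0. \<exists>R. \<forall>v. in_cone t \<rho> R v \<longrightarrow> \<bar>f v - c\<bar> < \<delta>)" (is "?L \<longleftrightarrow> ?R")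
proof
  assume R: ?R
  show ?L
  proof (intro allI impI)
    fix v assume "sw_admissible t v"
    then have inf: "filterlim (\<lambda>n. norm1 (v n)) at_top sequentially"
      and lim: "((\<lambda>n. (real_of_int (fst (v n)) / norm1 (v n), real_of_int (snd (v n)) / norm1 (v n)))
          \<longlonglongrightarrow> (- t, - (1 - t)))" by (auto simp: sw_admissible_def)
    have lim1: "(\<lambda>n. real_of_int (fst (v n)) / norm1 (v n)) \<longlonglongrightarrow> - t"
      using tendsto_fst[OF lim] by simp
    have lim2: "(\<lambda>n. real_of_int (snd (v n)) / norm1 (v n)) \<longlonglongrightarrow> - (1 - t)"
      using tendsto_snd[OF lim] by simp
    show "(\<lambda>n. f (v n)) \<longlonglongrightarrow> c"
      unfolding tendsto_iff
    proof (intro allI impI)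
      fix \<delta> :: real assume "\<delta> > 0"
      then obtain \<rho> R where \<rho>: "\<rho> > 0" and fR: "\<And>v. in_cone t \<rho> R v \<Longrightarrow> \<bar>f v - c\<bar> < \<delta>"
        using R by blast
      have "\<forall>\<^sub>F n in sequentially. max R 1 \<le> norm1 (v n)"
        using inf unfolding filterlim_at_top by blast
      moreover have "\<forall>\<^sub>F n in sequentially. dist (real_of_int (fst (v n)) / norm1 (v n)) (- t) < \<rho>"
        using lim1 \<rho> by (simp add: tendsto_iff)
      moreover have "\<forall>\<^sub>F n in sequentially. dist (real_of_int (snd (v n)) / norm1 (v n)) (- (1 - t)) < \<rho>"
        using lim2 \<rho> by (simp add: tendsto_iff)
      ultimately show "\<forall>\<^sub>F n in sequentially. dist (f (v n)) c < \<delta>"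
      proof eventually_elim
        case (elim n)
        let ?N = "norm1 (v n)"
        have N: "?N > 0" using elim by simp
        have "\<bar>real_of_int (fst (v n)) / ?N + t\<bar> \<le> \<rho>"
          and "\<bar>real_of_int (snd (v n)) / ?N + (1 - t)\<bar> \<le> \<rho>"
          using elim by (auto simp: dist_real_def)
        then have "in_cone t \<rho> R (v n)"
          unfolding abs_scaled_le_iff[OF N] using elim by (simp add: in_cone_def)
        then show ?case using fR by (simp add: dist_real_def)
      qed
    qed
  qed
next
  assume L: ?L
  show ?R
  proof (rule ccontr)
    assume "\<not> ?R"
    then obtain \<delta> :: real where "\<delta> > 0" and
      bad: "\<And>\<rho> R. \<rho> > 0 \<Longrightarrow> \<exists>v. in_cone t \<rho> R v \<and> \<not> \<bar>f v - c\<bar> < \<delta>" by blast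
    have "\<exists>v. in_cone t (1 / real (Suc n)) (real (Suc n)) v \<and> \<not> \<bar>f v - c\<bar> < \<delta>" for n
      using bad by simp
    then obtain v where v: "\<And>n. in_cone t (1 / real (Suc n)) (real (Suc n)) (v n)"
      and vf: "\<And>n. \<not> \<bar>f (v n) - c\<bar> < \<delta>" by metis
    have large: "real (Suc n) \<le> norm1 (v n)" for n using v by (auto simp: in_cone_def)
    have inf: "filterlim (\<lambda>n. norm1 (v n)) at_top sequentially"
      by (rule filterlim_at_top_mono[OF filterlim_compose[OF filterlim_real_sequentially filterlim_Suc]])
         (use large in auto)
    have "dist (real_of_int (fst (v n)) / norm1 (v n)) (- t) \<le> 1 / real (Suc n)" for n
    proof -
      have N: "norm1 (v n) > 0" using large[of n] by simp
      have "\<bar>real_of_int (fst (v n)) / norm1 (v n) + t\<bar> \<le> 1 / real (Suc n)"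
        unfolding abs_scaled_le_iff[OF N] using v[of n] by (auto simp: in_cone_def)
      then show ?thesis by (simp add: dist_real_def)
    qed
    then have lim1: "(\<lambda>n. real_of_int (fst (v n)) / norm1 (v n)) \<longlonglongrightarrow> - t"
      by (intro metric_tendsto_imp_tendsto[OF LIMSEQ_inverse_real_of_nat])
         (auto simp: dist_real_def divide_inverse)
    have "dist (real_of_int (snd (v n)) / norm1 (v n)) (- (1 - t)) \<le> 1 / real (Suc n)" for n
    proof -
      have N: "norm1 (v n) > 0" using large[of n] by simp
      have "\<bar>real_of_int (snd (v n)) / norm1 (v n) + (1 - t)\<bar> \<le> 1 / real (Suc n)"
        unfolding abs_scaled_le_iff[OF N] using v[of n] by (auto simp: in_cone_def)
      then show ?thesis by (simp add: dist_real_def)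
    qed
    then have lim2: "(\<lambda>n. real_of_int (snd (v n)) / norm1 (v n)) \<longlonglongrightarrow> - (1 - t)"
      by (intro metric_tendsto_imp_tendsto[OF LIMSEQ_inverse_real_of_nat])
         (auto simp: dist_real_def divide_inverse)
    have "sw_admissible t v" using inf tendsto_Pair[OF lim1 lim2] by (simp add: sw_admissible_def)
    then have "(\<lambda>n. f (v n)) \<longlonglongrightarrow> c" using L by blast
    then have "\<forall>\<^sub>F n in sequentially. \<bar>f (v n) - c\<bar> < \<delta>"
      using \<open>\<delta> > 0\<close> by (auto simp: tendsto_iff dist_real_def)
    then show False using vf by (auto simp: eventually_sequentially)
  qed
qed

lemma norm1_diff: "\<bar>norm1 u - norm1 v\<bar> \<le> norm1 (u - v)"
  unfolding norm1_def fst_diff snd_diff of_int_diff of_int_abs by linarith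

lemma in_cone_near:
  assumes v: "in_cone t (\<rho> / 4) (2 * R) v" and R: "0 < R" and t: "0 \<le> t" "t \<le> 1"
    and \<epsilon>: "\<epsilon> \<le> \<rho> / 8" "\<epsilon> \<le> 1 / 2" and \<rho>: "0 < \<rho>"
    and near: "norm1 (u - v) \<le> \<epsilon> * norm1 v"
  shows "in_cone t \<rho> R u"
proof -
  let ?N = "norm1 v"
  have N: "2 * R \<le> ?N" using v by (simp add: in_cone_def)
  have "\<epsilon> * ?N \<le> 1 / 2 * ?N" using \<epsilon> by (intro mult_right_mono) auto
  then have half: "?N / 2 \<le> norm1 u" using norm1_diff[of u v] near by linarith
  have d: "\<bar>norm1 u - ?N\<bar> \<le> \<epsilon> * ?N" using norm1_diff[of u v] near by linarith
  have "\<epsilon> * ?N \<le> \<rho> / 8 * ?N" using \<epsilon> by (intro mult_right_mono) auto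
  then have e8: "\<epsilon> * ?N \<le> \<rho> * ?N / 8" by simp
  have \<rho>h: "\<rho> * ?N / 2 \<le> \<rho> * norm1 u" using mult_left_mono[OF half, of \<rho>] \<rho> by simp
  have c: "\<bar>real_of_int (fst u) - real_of_int (fst v)\<bar> \<le> \<epsilon> * ?N" "\<bar>real_of_int (snd u) - real_of_int (snd v)\<bar> \<le> \<epsilon> * ?N"
    using near by (auto simp: norm1_def)
  have t1: "\<bar>t * norm1 u - t * ?N\<bar> \<le> \<epsilon> * ?N"
  proof -
    have "\<bar>t * norm1 u - t * ?N\<bar> = t * \<bar>norm1 u - ?N\<bar>"
      using t by (simp add: abs_mult flip: right_diff_distrib)
    also have "\<dots> \<le> 1 * (\<epsilon> * ?N)" using t d by (intro mult_mono) auto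
    finally show ?thesis by simp
  qed
  have t2: "\<bar>(1 - t) * norm1 u - (1 - t) * ?N\<bar> \<le> \<epsilon> * ?N"
  proof -
    have "\<bar>(1 - t) * norm1 u - (1 - t) * ?N\<bar> = (1 - t) * \<bar>norm1 u - ?N\<bar>"
      using t by (simp add: abs_mult flip: right_diff_distrib)
    also have "\<dots> \<le> 1 * (\<epsilon> * ?N)" using t d by (intro mult_mono) auto
    finally show ?thesis by simp
  qed
  have v1: "\<bar>real_of_int (fst v) + t * ?N\<bar> \<le> \<rho> * ?N / 4" and v2: "\<bar>real_of_int (snd v) + (1 - t) * ?N\<bar> \<le> \<rho> * ?N / 4"
    using v by (auto simp: in_cone_def)
  \<comment> \<open>With N for \<open>norm1 v\<close>, the three errors add up to (1/8 + 1/8 + 1/4)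
    \<rho> N = \<rho> N / 2, and N / 2 is at most \<open>norm1 u\<close>.\<close>
  have "\<bar>real_of_int (fst u) + t * norm1 u\<bar> \<le> \<rho> * norm1 u" using c(1) t1 v1 e8 \<rho>h by linarith
  moreover have "\<bar>real_of_int (snd u) + (1 - t) * norm1 u\<bar> \<le> \<rho> * norm1 u" using c(2) t2 v2 e8 \<rho>h by linarith
  moreover have "R \<le> norm1 u" using half N by linarith
  ultimately show ?thesis by (simp add: in_cone_def)
qed

text \<open>One inequality suffices because it is assumed for all pairs: for (x, y) it bounds the
  difference of \<open>f\<close> from below, for (y, x) from above.\<close>

lemma sw_limit_transfer:
  fixes f g :: "site \<Rightarrow> site \<Rightarrow> real"
  assumes dom: "\<And>x y \<rho> R. 0 < \<rho> \<Longrightarrow> 0 < R \<Longrightarrow> \<exists>\<rho>'>0. \<exists>R'. \<forall>v. in_cone t \<rho>' R' v \<longrightarrow>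
       (\<exists>u. in_cone t \<rho> R u \<and> g u x - g u y \<le> f v x - f v y)"
    and lim: "\<forall>v. sw_admissible t v \<longrightarrow> (\<lambda>n. g (v n) x - g (v n) y) \<longlonglongrightarrow> c"
  shows "\<forall>v. sw_admissible t v \<longrightarrow> (\<lambda>n. f (v n) x - f (v n) y) \<longlonglongrightarrow> c"
  unfolding sw_admissible_limit_iff[of t "\<lambda>v. f v x - f v y" c]
proof (intro allI impI)
  fix \<delta> :: real assume "\<delta> > 0"
  then obtain \<rho> R where \<rho>: "\<rho> > 0" and g: "\<And>v. in_cone t \<rho> R v \<Longrightarrow> \<bar>g v x - g v y - c\<bar> < \<delta>"
    using lim unfolding sw_admissible_limit_iff[of t "\<lambda>v. g v x - g v y" c] by blast
  define R0 where "R0 = max R 1"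
  have g': "\<bar>g v x - g v y - c\<bar> < \<delta>" if "in_cone t \<rho> R0 v" for v
    using that by (intro g) (auto simp: in_cone_def R0_def)
  have R0: "0 < R0" by (simp add: R0_def)
  obtain \<rho>1 R1 where 1: "\<rho>1 > 0" "\<And>v. in_cone t \<rho>1 R1 v \<Longrightarrow>
       \<exists>u. in_cone t \<rho> R0 u \<and> g u x - g u y \<le> f v x - f v y"
    using dom[OF \<rho> R0, of x y] by blast
  obtain \<rho>2 R2 where 2: "\<rho>2 > 0" "\<And>v. in_cone t \<rho>2 R2 v \<Longrightarrow>
       \<exists>u. in_cone t \<rho> R0 u \<and> g u y - g u x \<le> f v y - f v x"
    using dom[OF \<rho> R0, of y x] by blast
  have "\<bar>f v x - f v y - c\<bar> < \<delta>" if v: "in_cone t (min \<rho>1 \<rho>2) (max R1 R2) v" for v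
  proof -
    have "min \<rho>1 \<rho>2 * norm1 v \<le> \<rho>1 * norm1 v" "min \<rho>1 \<rho>2 * norm1 v \<le> \<rho>2 * norm1 v"
      by (auto intro!: mult_right_mono)
    then have "in_cone t \<rho>1 R1 v" "in_cone t \<rho>2 R2 v" using v by (auto simp: in_cone_def)
    then obtain u1 u2 where "in_cone t \<rho> R0 u1" "g u1 x - g u1 y \<le> f v x - f v y"
      "in_cone t \<rho> R0 u2" "g u2 y - g u2 x \<le> f v y - f v x" using 1(2) 2(2) by blast
    then show ?thesis using g'[of u1] g'[of u2] by linarith
  qed
  then show "\<exists>\<rho>>0. \<exists>R. \<forall>v. in_cone t \<rho> R v \<longrightarrow> \<bar>f v x - f v y - c\<bar> < \<delta>"
    using 1(1) 2(1) by (intro exI[of _ "min \<rho>1 \<rho>2"]) auto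
qed

text \<open>Law of large numbers for free paths, uniform over a box: at scale N they follow the
  direction (1 - \<alpha>, \<alpha>) up to \<delta> N.\<close>

definition exit_law :: "real \<Rightarrow> (site \<Rightarrow> bool) \<Rightarrow> bool" where
  "exit_law \<alpha> B \<longleftrightarrow> (\<forall>\<delta>>0. \<exists>N0. \<forall>N\<ge>N0. \<forall>i j a b. i \<le> a \<longrightarrow> j \<le> b \<longrightarrow>
      norm1 (i, j) \<le> N \<longrightarrow> norm1 (a, b) \<le> N \<longrightarrow>
      (drift \<alpha> (real_of_int (a - i)) (real_of_int (b - j)) \<le> - \<delta> * N \<longrightarrow> exits_left B i j a b) \<and>
      (\<delta> * N \<le> drift \<alpha> (real_of_int (a - i)) (real_of_int (b - j)) \<longrightarrow> \<not> exits_left B i j a b))"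

text \<open>Bounds the cost of shifting a starting point horizontally by a small multiple of N, at
  all places of a box at once.\<close>

definition row_law :: "weights \<Rightarrow> bool" where
  "row_law W \<longleftrightarrow> (\<forall>\<delta>>0. \<exists>\<kappa>>0. \<exists>N0. \<forall>N\<ge>N0. \<forall>i j. \<forall>m::nat. norm1 (i, j) \<le> N \<longrightarrow> real m \<le> \<kappa> * N \<longrightarrow>
      (\<Sum>l=1..m. W (i + int l, j) 1) \<le> \<delta> * N)"

lemma in_cone_drift:
  assumes "0 \<le> \<alpha>" "\<alpha> \<le> 1" "in_cone t \<eta> R (i, j)" "N = norm1 (i, j)"
    and "\<bar>real_of_int x1\<bar> \<le> \<eta> * N" "\<bar>real_of_int x2\<bar> \<le> \<eta> * N"
  shows "\<bar>drift \<alpha> (real_of_int (x1 - i)) (real_of_int (x2 - j)) - (t - (1 - \<alpha>)) * N\<bar> \<le> 2 * \<eta> * N"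
proof -
  have "drift \<alpha> (real_of_int (x1 - i)) (real_of_int (x2 - j)) - (t - (1 - \<alpha>)) * N
      = drift \<alpha> (x1 - (i + t * N)) (x2 - (j + (1 - t) * N))"
    by (simp add: drift_def algebra_simps)
  moreover have "\<bar>\<dots>\<bar> \<le> 2 * \<eta> * N"
    using assms by (intro drift_bound) (auto simp: in_cone_def)
  ultimately show ?thesis by simp
qed

text \<open>Rounds A / D up to a square. Neighbouring squares there differ by about
  \<open>2 * sqrt (A / D)\<close>, which is o(N) for A up to C N. The rounding is called for because
  \<open>gap_law\<close> speaks of multiples by \<open>k\<^sup>2\<close> only.\<close>

lemma square_between:
  fixes D \<eta> C :: real
  assumes "0 < D" "0 < \<eta>"
  shows "\<exists>N0. \<forall>N\<ge>N0. \<forall>A. 0 \<le> A \<longrightarrow> A \<le> C * N \<longrightarrow>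
           (\<exists>k::nat. A \<le> (real k)\<^sup>2 * D \<and> (real k)\<^sup>2 * D \<le> A + \<eta> * N)"
proof (rule exI, intro allI impI)
  fix N A assume N: "2 * (2 * \<bar>C\<bar> * D / \<eta> + D) / \<eta> \<le> N" and A: "0 \<le> A" "A \<le> C * N"
  define k where "k = nat \<lceil>sqrt (A / D)\<rceil>"
  have AD: "0 \<le> A / D" using A assms by simp
  have "0 \<le> 2 * (2 * \<bar>C\<bar> * D / \<eta> + D) / \<eta>" using assms by (intro divide_nonneg_pos mult_nonneg_nonneg add_nonneg_nonneg) auto
  then have N0: "0 \<le> N" using N by linarith
  have k1: "sqrt (A / D) \<le> real k" unfolding k_def using AD by (simp add: real_nat_ceiling_ge)
  have "0 \<le> \<lceil>sqrt (A / D)\<rceil>" using AD by (simp add: ceiling_mono[of 0, simplified])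
  then have k2: "real k \<le> sqrt (A / D) + 1" unfolding k_def by simp
  have "A / D \<le> (real k)\<^sup>2" using power_mono[OF k1 real_sqrt_ge_zero[OF AD], of 2] unfolding real_sqrt_pow2[OF AD] .
  then have 1: "A \<le> (real k)\<^sup>2 * D" using assms by (simp add: field_simps)
  have "(real k)\<^sup>2 \<le> (sqrt (A / D) + 1)\<^sup>2" using k2 by (intro power_mono) auto
  also have "\<dots> = A / D + 2 * sqrt (A / D) + 1" using real_sqrt_pow2[OF AD] by (simp only: power2_sum power_one mult_1_right)
  finally have "(real k)\<^sup>2 * D \<le> (A / D + 2 * sqrt (A / D) + 1) * D" using assms by (intro mult_right_mono) auto
  then have 2: "(real k)\<^sup>2 * D \<le> A + 2 * (sqrt (A / D) * D) + D" using assms by (simp add: distrib_right)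
  have "sqrt (A / D) * D = sqrt (A * D)"
    using assms A AD by (intro real_sqrt_unique[symmetric]) (auto simp: power2_eq_square field_simps)
  also have "\<dots> \<le> sqrt (2 * \<bar>C\<bar> * D / \<eta> * (\<eta> * N / 2))"
  proof -
    have "A * D \<le> \<bar>C\<bar> * N * D" using A N0 assms
      by (intro mult_right_mono order_trans[OF A(2)]) (auto intro: mult_right_mono)
    then show ?thesis using assms by (auto simp: field_simps)
  qed
  \<comment> \<open>Arithmetic-geometric mean, with the factors balanced so that the growing part is
    only \<eta> N / 2.\<close>
  also have "\<dots> \<le> (2 * \<bar>C\<bar> * D / \<eta> + \<eta> * N / 2) / 2"
    using assms N0 by (intro arith_geo_mean_sqrt) auto
  finally have "2 * (sqrt (A / D) * D) + D \<le> 2 * \<bar>C\<bar> * D / \<eta> + D + \<eta> * N / 2" by simp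
  also have "\<dots> \<le> \<eta> * N" using N assms by (simp add: field_simps)
  finally show "\<exists>k::nat. A \<le> (real k)\<^sup>2 * D \<and> (real k)\<^sup>2 * D \<le> A + \<eta> * N"
    using 1 2 by (intro exI[of _ k]) auto
qed

lemma ex_pos_lower_bound:
  fixes A :: "real set"
  assumes "finite A" "\<forall>a\<in>A. 0 < a"
  shows "\<exists>\<eta>>0. \<forall>a\<in>A. \<eta> \<le> a"
  using assms by (intro exI[of _ "Min (insert 1 A)"]) auto

lemma rational_between:
  fixes a b :: real
  assumes "0 < a" "a < b"
  shows "\<exists>P Q :: nat. 0 < Q \<and> a < real P / real Q \<and> real P / real Q < b"
proof -
  obtain r where r: "r \<in> \<rat>" "a < r" "r < b" using Rats_dense_in_real assms(2) by blast
  then have "0 < r" using assms by simp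
  then obtain m n :: nat where "n \<noteq> 0" "\<bar>r\<bar> = real m / real n" using Rats_abs_nat_div_natE r(1) by metis
  then show ?thesis using r \<open>0 < r\<close> by (intro exI[of _ m] exI[of _ n]) auto
qed

context switched_weights
begin

text \<open>Take \<open>u = (i, l)\<close> with the exit height \<open>l\<close> of
  \<open>F_attained_low\<close>: \<open>T\<close> from \<open>u\<close> to \<open>x\<close> is at
  most \<open>F\<close> from \<open>v\<close>, and \<open>F\<close> from \<open>v\<close> to
  \<open>y\<close> is at most \<open>T\<close> from \<open>u\<close> by climbing column
  \<open>i\<close>. A free path started in the row of \<open>x\<close> gives
  \<open>l \<le> j + K\<close> with K about \<epsilon> N, so \<open>u\<close> stays in the
  cone.\<close>

lemma F_difference_dominates:
  assumes law: "exit_law \<alpha> S" and \<alpha>: "0 < \<alpha>" "\<alpha> < 1" and t: "1 - \<alpha> < t" "t < 1"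
    and \<rho>: "0 < \<rho>" and R: "0 < R"
  shows "\<exists>\<rho>'>0. \<exists>R'. \<forall>v. in_cone t \<rho>' R' v \<longrightarrow>
           (\<exists>u. in_cone t \<rho> R u \<and> T u x - T u y \<le> F v x - F v y)"
proof -
  obtain x1 x2 where x: "x = (x1, x2)" by fastforce
  obtain y1 y2 where y: "y = (y1, y2)" by fastforce
  define \<gamma> where "\<gamma> = t - (1 - \<alpha>)"
  have \<gamma>: "0 < \<gamma>" using t by (simp add: \<gamma>_def)
  obtain \<epsilon> where \<epsilon>: "0 < \<epsilon>" "\<epsilon> \<le> \<rho> / 8" "\<epsilon> \<le> 1 / 2" "\<epsilon> \<le> (1 - t) / 2"
    using ex_pos_lower_bound[of "{\<rho> / 8, 1 / 2, (1 - t) / 2}"] \<rho> t by auto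
  obtain \<eta> where \<eta>: "0 < \<eta>" and \<eta>b: "\<eta> \<le> \<rho> / 4" "\<eta> \<le> \<gamma> / 8" "\<eta> \<le> (1 - \<alpha>) * \<epsilon> / 8"
      "\<eta> \<le> (1 - \<alpha>) * (1 - t) / 8" "\<eta> \<le> 1 / 8"
    using ex_pos_lower_bound[of "{\<rho> / 4, \<gamma> / 8, (1 - \<alpha>) * \<epsilon> / 8, (1 - \<alpha>) * (1 - t) / 8, 1 / 8}"] \<rho> \<gamma> \<epsilon> \<alpha> t
    by auto
  have \<eta>b: "\<eta> \<le> \<rho> / 4" "8 * \<eta> \<le> \<gamma>" "8 * \<eta> \<le> (1 - \<alpha>) * \<epsilon>" "8 * \<eta> \<le> (1 - \<alpha>) * (1 - t)" "\<eta> \<le> 1 / 8"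
    by (insert \<eta>b, linarith+)
  have "(1 - \<alpha>) * (1 - t) \<le> 1 - t" using \<alpha> t by (simp add: mult_left_le_one_le)
  then have \<eta>t: "8 * \<eta> \<le> 1 - t" "8 * \<eta> \<le> t" using \<eta>b \<alpha> by (auto simp: \<gamma>_def)
  \<comment> \<open>All sites below have norm at most 3 N, so the law is applied at scale 3 N, with
    error (\<eta> / 3) 3 N = \<eta> N.\<close>
  obtain N0 where N0: "\<And>N i j a b. N0 \<le> N \<Longrightarrow> i \<le> a \<Longrightarrow> j \<le> b \<Longrightarrow> norm1 (i, j) \<le> N \<Longrightarrow> norm1 (a, b) \<le> N \<Longrightarrow>
      (drift \<alpha> (real_of_int (a - i)) (real_of_int (b - j)) \<le> - (\<eta> / 3) * N \<longrightarrow> exits_left S i j a b) \<and>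
      (\<eta> / 3 * N \<le> drift \<alpha> (real_of_int (a - i)) (real_of_int (b - j)) \<longrightarrow> \<not> exits_left S i j a b)"
    using law \<eta> unfolding exit_law_def by (metis divide_pos_pos zero_less_numeral)
  define Cx where "Cx = \<bar>real_of_int x1\<bar> + \<bar>real_of_int x2\<bar> + \<bar>real_of_int y1\<bar> + \<bar>real_of_int y2\<bar> + 4"
  define R' where "R' = Max {2 * R, N0, Cx / \<eta>}"
  have "\<exists>u. in_cone t \<rho> R u \<and> T u x - T u y \<le> F v x - F v y" if v: "in_cone t \<eta> R' v" for v
  proof -
    obtain i j where ij: "v = (i, j)" by fastforce
    define N where "N = norm1 v"
    have NR: "2 * R \<le> N" "N0 \<le> N" "Cx / \<eta> \<le> N" using v by (auto simp: in_cone_def R'_def N_def)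
    have Npos: "0 < N" using NR R by linarith
    have Cx: "Cx \<le> \<eta> * N" using NR(3) \<eta> by (simp add: field_simps)
    have bx: "\<bar>real_of_int x1\<bar> \<le> \<eta> * N" "\<bar>real_of_int x2\<bar> \<le> \<eta> * N" "\<bar>real_of_int y1\<bar> \<le> \<eta> * N"
       "\<bar>real_of_int y2\<bar> \<le> \<eta> * N" "4 \<le> \<eta> * N" using Cx by (auto simp: Cx_def)
    have bi: "\<bar>real_of_int i + t * N\<bar> \<le> \<eta> * N" "\<bar>real_of_int j + (1 - t) * N\<bar> \<le> \<eta> * N"
      using v by (auto simp: in_cone_def ij N_def)
    note mm = mult_right_mono[OF _ less_imp_le[OF Npos]]
    have m1: "8 * (\<eta> * N) \<le> \<gamma> * N" using mm[OF \<eta>b(2)] by simp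
    have m2: "8 * (\<eta> * N) \<le> (1 - \<alpha>) * (\<epsilon> * N)" using mm[OF \<eta>b(3)] by simp
    have m3: "8 * (\<eta> * N) \<le> (1 - \<alpha>) * ((1 - t) * N)" using mm[OF \<eta>b(4)] by simp
    have m4: "\<eta> * N \<le> 1 / 8 * N" using mm[OF \<eta>b(5)] by simp
    have m5: "8 * (\<eta> * N) \<le> (1 - t) * N" using mm[OF \<eta>t(1)] by simp
    have m6: "8 * (\<eta> * N) \<le> t * N" using mm[OF \<eta>t(2)] by simp
    have m7: "\<epsilon> * N \<le> 1 / 2 * N" using mm[OF \<epsilon>(3)] by simp
    have m8: "\<epsilon> * N \<le> (1 - t) * N / 2" using mm[OF \<epsilon>(4)] by simp
    define K where "K = \<lfloor>\<epsilon> * N\<rfloor>"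
    have K: "real_of_int K \<le> \<epsilon> * N" "\<epsilon> * N - 1 \<le> real_of_int K" "0 \<le> K"
      unfolding K_def using \<epsilon>(1) Npos by (simp_all add: algebra_simps) linarith?
    \<comment> \<open>The separating path starts at \<open>(c, x2)\<close>. Its drift from
      \<open>(i, j)\<close> is just below -\<eta> N, so it enters column \<open>i\<close> at or
      above row \<open>j\<close>. Raising the base by K adds (1 - \<alpha>) K, almost 8 \<eta> N or
      more, so the entry is not above row \<open>j + K\<close>.\<close>
    define c where "c = i + \<lfloor>((1 - \<alpha>) * (real_of_int x2 - real_of_int j) - \<eta> * N) / \<alpha>\<rfloor>"
    have c1: "real_of_int (c - i) \<le> ((1 - \<alpha>) * (real_of_int x2 - real_of_int j) - \<eta> * N) / \<alpha>"
      and c2: "((1 - \<alpha>) * (real_of_int x2 - real_of_int j) - \<eta> * N) / \<alpha> - 1 \<le> real_of_int (c - i)"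
      unfolding c_def by linarith+
    have dc1: "drift \<alpha> (real_of_int (c - i)) (real_of_int (x2 - j)) \<le> - (\<eta> * N)"
      using c1 \<alpha> by (simp add: drift_def field_simps)
    have dc2: "- (\<eta> * N) - \<alpha> \<le> drift \<alpha> (real_of_int (c - i)) (real_of_int (x2 - j))"
      using c2 \<alpha> by (simp add: drift_def field_simps)
    have xj: "(1 - t) * N - 2 * (\<eta> * N) \<le> real_of_int x2 - real_of_int j" using bi(2) bx(2) by linarith
    have "(1 - \<alpha>) * ((1 - t) * N - 2 * (\<eta> * N)) \<le> (1 - \<alpha>) * (real_of_int x2 - real_of_int j)"
      using xj \<alpha> by (intro mult_left_mono) auto
    moreover have "(1 - \<alpha>) * (2 * (\<eta> * N)) \<le> 2 * (\<eta> * N)"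
      using \<alpha> \<eta> Npos by (intro mult_left_le_one_le) auto
    ultimately have "\<eta> * N \<le> (1 - \<alpha>) * (real_of_int x2 - real_of_int j)"
      using m3 bx(5) by (simp only: right_diff_distrib)
    then have ic: "i \<le> c" unfolding c_def using \<alpha> by simp
    have dx: "\<bar>drift \<alpha> (real_of_int (x1 - i)) (real_of_int (x2 - j)) - \<gamma> * N\<bar> \<le> 2 * (\<eta> * N)"
      using in_cone_drift[of \<alpha> t \<eta> R' i j N x1 x2] v bx \<alpha> by (simp add: ij N_def \<gamma>_def)
    have "drift \<alpha> (real_of_int (x1 - i)) (real_of_int (x2 - j)) - drift \<alpha> (real_of_int (c - i)) (real_of_int (x2 - j))
        = \<alpha> * real_of_int (x1 - c)" by (simp add: drift_def algebra_simps)
    then have "0 < \<alpha> * real_of_int (x1 - c)" using dx dc1 m1 bx(5) by linarith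
    then have cx: "c \<le> x1" using \<alpha> by (simp add: zero_less_mult_iff)
    have jx: "j \<le> x2" using xj m5 bx(5) by linarith
    have iy: "i \<le> y1" using bi(1) bx(3) m6 by linarith
    have JK: "real_of_int (j + K) \<le> - (\<eta> * N)" using bi(2) K(1) m8 m5 by linarith
    have Jx: "j + K \<le> x2" "j + K \<le> y2" using JK bx(2,4) by linarith+
    have nv: "norm1 (i, j) \<le> 3 * N" using Npos by (simp add: N_def ij)
    have absij: "\<bar>real_of_int i\<bar> + \<bar>real_of_int j\<bar> = N" by (simp add: N_def ij norm1_def)
    have nc: "norm1 (c, x2) \<le> 3 * N"
    proof -
      have "\<bar>real_of_int c\<bar> \<le> \<bar>real_of_int i\<bar> + \<bar>real_of_int x1\<bar>" using ic cx by linarith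
      then show ?thesis unfolding norm1_def fst_conv snd_conv using absij bx(1,2) m4 Npos by linarith
    qed
    have nJ: "norm1 (i, j + K) \<le> 3 * N"
      unfolding norm1_def fst_conv snd_conv of_int_add using absij K m7 Npos by linarith
    have E1: "exits_left S i j c x2"
      using N0[OF _ ic jx nv nc] dc1 NR(2) Npos by simp
    have "drift \<alpha> (real_of_int (c - i)) (real_of_int (x2 - (j + K)))
        = drift \<alpha> (real_of_int (c - i)) (real_of_int (x2 - j)) + (1 - \<alpha>) * real_of_int K"
      by (simp add: drift_def algebra_simps)
    moreover have "(1 - \<alpha>) * (\<epsilon> * N) - 1 \<le> (1 - \<alpha>) * real_of_int K"
    proof -
      have "(1 - \<alpha>) * (\<epsilon> * N - 1) \<le> (1 - \<alpha>) * real_of_int K"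
        using K \<alpha> by (intro mult_left_mono) auto
      then show ?thesis using \<alpha> unfolding right_diff_distrib mult_1_right by linarith
    qed
    ultimately have "\<eta> * N \<le> drift \<alpha> (real_of_int (c - i)) (real_of_int (x2 - (j + K)))"
      using dc2 m2 bx(5) \<alpha> by linarith
    then have E2: "\<not> exits_left S i (j + K) c x2"
      using N0[OF _ ic Jx(1) nJ nc] NR(2) Npos by simp
    obtain l where l: "j \<le> l" "l \<le> j + K" "l \<le> x2" "T (i, l) (x1, x2) \<le> F (i, j) (x1, x2)"
      using F_attained_low[of i x1 j x2 "j + K"] ic cx jx K E1 E2 by auto
    have Ty: "F (i, j) (y1, y2) \<le> T (i, l) (y1, y2)"
      using l Jx iy by (intro F_le_T_above) auto
    have near: "norm1 ((i, l) - v) \<le> \<epsilon> * norm1 v"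
      using l K by (simp add: norm1_def ij N_def[symmetric]) (simp add: N_def ij norm1_def)
    have "in_cone t (\<rho> / 4) (2 * R) v"
      using v mm[OF \<eta>b(1)] NR by (auto simp: in_cone_def N_def)
    from in_cone_near[OF this R _ _ \<epsilon>(2,3) \<rho> near] have "in_cone t \<rho> R (i, l)" using t \<alpha> by simp
    then show ?thesis using l(4) Ty by (intro exI[of _ "(i, l)"]) (auto simp: x y ij)
  qed
  then show ?thesis using \<eta> by blast
qed

text \<open>Directions strictly between those of the two free fields. The path of \<open>B\<close>
  from \<open>x\<close> runs into column \<open>i\<close>: so \<open>F\<close> vanishes at
  \<open>x\<close>, and sites above the path are at least as far for \<open>T\<close> as
  \<open>x\<close>. The path of \<open>S\<close> from \<open>(p1, p2)\<close> runs into row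
  \<open>j\<close>: sites to its right are at least as far as \<open>(p1, p2)\<close>. With
  \<open>x\<close> and \<open>y\<close> exchanged, equality follows.\<close>

lemma zero_direction:
  assumes lawS: "exit_law \<alpha> S" and lawB: "exit_law \<beta> B" and B: "free_field B"
    and \<alpha>: "0 < \<alpha>" "\<alpha> < 1" and \<beta>: "0 < \<beta>" "\<beta> < 1" and t: "1 - \<alpha> < t" "t < 1 - \<beta>"
  shows "\<exists>\<rho>'>0. \<exists>R'. \<forall>v. in_cone t \<rho>' R' v \<longrightarrow> T v x \<le> T v y \<and> F v x = 0"
proof -
  obtain x1 x2 where x: "x = (x1, x2)" by fastforce
  obtain y1 y2 where y: "y = (y1, y2)" by fastforce
  \<comment> \<open>A site strictly north-west of \<open>x\<close> and \<open>y\<close>: it lies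
    above the path from \<open>x\<close>, and \<open>y\<close> lies to the right of the path from
    it.\<close>
  define p1 p2 where "p1 = min x1 y1 - 1" and "p2 = max x2 y2 + 1"
  define \<gamma> where "\<gamma> = t - (1 - \<alpha>)"
  define \<gamma>' where "\<gamma>' = (1 - \<beta>) - t"
  have \<gamma>: "0 < \<gamma>" "0 < \<gamma>'" using t by (auto simp: \<gamma>_def \<gamma>'_def)
  obtain \<eta> where \<eta>: "0 < \<eta>" and \<eta>b: "\<eta> \<le> \<gamma> / 8" "\<eta> \<le> \<gamma>' / 8" "\<eta> \<le> (1 - t) / 8" "\<eta> \<le> 1 / 8"
    using ex_pos_lower_bound[of "{\<gamma> / 8, \<gamma>' / 8, (1 - t) / 8, 1 / 8}"] \<gamma> t \<beta> by auto
  have \<eta>b: "8 * \<eta> \<le> \<gamma>" "8 * \<eta> \<le> \<gamma>'" "8 * \<eta> \<le> 1 - t" "\<eta> \<le> 1 / 8"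
    using \<eta>b(1) \<eta>b(2) \<eta>b(3) \<eta>b(4) by (auto simp: field_simps)
  have \<eta>t: "8 * \<eta> \<le> t" using \<eta>b \<alpha> by (auto simp: \<gamma>_def)
  obtain N0 where N0: "\<And>N i j a b. N0 \<le> N \<Longrightarrow> i \<le> a \<Longrightarrow> j \<le> b \<Longrightarrow> norm1 (i, j) \<le> N \<Longrightarrow> norm1 (a, b) \<le> N \<Longrightarrow>
      (\<eta> / 3 * N \<le> drift \<alpha> (real_of_int (a - i)) (real_of_int (b - j)) \<longrightarrow> \<not> exits_left S i j a b)"
    using lawS \<eta> unfolding exit_law_def by (metis divide_pos_pos zero_less_numeral)
  obtain N1 where N1: "\<And>N i j a b. N1 \<le> N \<Longrightarrow> i \<le> a \<Longrightarrow> j \<le> b \<Longrightarrow> norm1 (i, j) \<le> N \<Longrightarrow> norm1 (a, b) \<le> N \<Longrightarrow>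
      (drift \<beta> (real_of_int (a - i)) (real_of_int (b - j)) \<le> - (\<eta> / 3) * N \<longrightarrow> exits_left B i j a b)"
    using lawB \<eta> unfolding exit_law_def by (metis divide_pos_pos zero_less_numeral)
  define Cx where "Cx = \<bar>real_of_int x1\<bar> + \<bar>real_of_int x2\<bar> + \<bar>real_of_int y1\<bar> + \<bar>real_of_int y2\<bar> + 4"
  define R' where "R' = Max {1, N0, N1, Cx / \<eta>}"
  have "T v x \<le> T v y \<and> F v x = 0" if v: "in_cone t \<eta> R' v" for v
  proof -
    obtain i j where ij: "v = (i, j)" by fastforce
    define N where "N = norm1 v"
    have NR: "1 \<le> N" "N0 \<le> N" "N1 \<le> N" "Cx / \<eta> \<le> N" using v by (auto simp: in_cone_def R'_def N_def)
    have Npos: "0 < N" using NR by linarith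
    have Cx: "Cx \<le> \<eta> * N" using NR(4) \<eta> by (simp add: field_simps)
    have bx: "\<bar>real_of_int x1\<bar> \<le> \<eta> * N" "\<bar>real_of_int x2\<bar> \<le> \<eta> * N" "\<bar>real_of_int y1\<bar> \<le> \<eta> * N"
       "\<bar>real_of_int y2\<bar> \<le> \<eta> * N" "\<bar>real_of_int p1\<bar> \<le> \<eta> * N" "\<bar>real_of_int p2\<bar> \<le> \<eta> * N"
      using Cx by (auto simp: Cx_def p1_def p2_def min_def max_def)
    have bi: "\<bar>real_of_int i + t * N\<bar> \<le> \<eta> * N" "\<bar>real_of_int j + (1 - t) * N\<bar> \<le> \<eta> * N"
      using v by (auto simp: in_cone_def ij N_def)
    note mm = mult_right_mono[OF _ less_imp_le[OF Npos]]
    have m1: "8 * (\<eta> * N) \<le> \<gamma> * N" using mm[OF \<eta>b(1)] by simp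
    have m2: "8 * (\<eta> * N) \<le> \<gamma>' * N" using mm[OF \<eta>b(2)] by simp
    have m3: "8 * (\<eta> * N) \<le> (1 - t) * N" using mm[OF \<eta>b(3)] by simp
    have m4: "\<eta> * N \<le> 1 / 8 * N" using mm[OF \<eta>b(4)] by simp
    have m5: "8 * (\<eta> * N) \<le> t * N" using mm[OF \<eta>t] by simp
    have U: "real_of_int i \<le> \<eta> * N - t * N" "real_of_int j \<le> \<eta> * N - (1 - t) * N"
      using bi unfolding abs_le_iff by linarith+
    have L: "- (\<eta> * N) \<le> real_of_int x1" "- (\<eta> * N) \<le> real_of_int x2" "- (\<eta> * N) \<le> real_of_int y1"
      "- (\<eta> * N) \<le> real_of_int y2" "- (\<eta> * N) \<le> real_of_int p1" "- (\<eta> * N) \<le> real_of_int p2"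
      using bx unfolding abs_le_iff by linarith+
    have "0 < \<eta> * N" using \<eta> Npos by simp
    then have V: "real_of_int i \<le> - (\<eta> * N)" "real_of_int j \<le> - (\<eta> * N)" using U m3 m5 by linarith+
    have le: "i \<le> p1" "j \<le> x2" "j \<le> y2" "i \<le> y1" "i \<le> x1" "j \<le> p2"
      using order_trans[OF V(1) L(5)] order_trans[OF V(2) L(2)] order_trans[OF V(2) L(4)]
        order_trans[OF V(1) L(3)] order_trans[OF V(1) L(1)] order_trans[OF V(2) L(6)] by simp_all
    have lt: "p1 < y1" "p1 < x1" "x2 < p2" "y2 < p2" by (auto simp: p1_def p2_def)
    have nv: "norm1 (i, j) \<le> 3 * N" using Npos by (simp add: N_def ij)
    have nx: "norm1 (x1, x2) \<le> 3 * N" and np: "norm1 (p1, p2) \<le> 3 * N"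
      unfolding norm1_def fst_conv snd_conv using bx(1,2,5,6) m4 Npos by linarith+
    have "\<bar>drift \<alpha> (real_of_int (p1 - i)) (real_of_int (p2 - j)) - \<gamma> * N\<bar> \<le> 2 * (\<eta> * N)"
      using in_cone_drift[of \<alpha> t \<eta> R' i j N p1 p2] v bx \<alpha> by (simp add: ij N_def \<gamma>_def)
    then have "\<eta> * N \<le> drift \<alpha> (real_of_int (p1 - i)) (real_of_int (p2 - j))" using m1 Npos \<eta> by linarith
    then have "\<not> exits_left S i j p1 p2" using N0[OF _ le(1,6) nv np] NR Npos by simp
    then obtain n0 k where k: "back_path S (p1, p2) n0 = (k, j)" "i < k"
      using not_exits_left_path le by blast
    have "\<bar>drift \<beta> (real_of_int (x1 - i)) (real_of_int (x2 - j)) - (t - (1 - \<beta>)) * N\<bar> \<le> 2 * (\<eta> * N)"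
      using in_cone_drift[of \<beta> t \<eta> R' i j N x1 x2] v bx \<beta> by (simp add: ij N_def)
    moreover have "(t - (1 - \<beta>)) * N = - (\<gamma>' * N)" by (simp add: \<gamma>'_def algebra_simps)
    ultimately have "drift \<beta> (real_of_int (x1 - i)) (real_of_int (x2 - j)) \<le> - (\<eta> * N)"
      using m2 Npos \<eta> by linarith
    then have E: "exits_left B i j x1 x2" using N1[OF _ le(5,2) nv nx] NR Npos by simp
    then obtain n1 l where l: "back_path B (x1, x2) n1 = (i, l)" "j \<le> l"
      using exits_left_path le by blast
    have "F (i, j) (x1, x2) = 0"
      using F_zero_if_exits_left[OF E] B le by (auto simp: free_field_def)
    moreover have "T (i, j) (x1, x2) \<le> T (i, j) (p1, p2)"
    proof (rule T_le_of_above_of[OF B l(1,2) le(1,6)])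
      have "above_of (back_path B (x1, x2)) n1 x1 p2"
        using lt by (auto simp: above_of_def intro!: exI[of _ 0])
      then show "above_of (back_path B (x1, x2)) n1 p1 p2"
        by (rule above_of_left) (use l le lt in auto)
    qed
    moreover have "T (i, j) (p1, p2) \<le> T (i, j) (y1, y2)"
    proof (rule T_le_of_right_of[OF free_field_S k le(4,3)])
      have "right_of (back_path S (p1, p2)) n0 y1 p2"
        using lt by (auto simp: right_of_def intro!: exI[of _ 0])
      then show "right_of (back_path S (p1, p2)) n0 y1 y2"
        by (rule right_of_down) (use k le lt in auto)
    qed
    ultimately show ?thesis by (simp add: x y ij)
  qed
  then show ?thesis using \<eta> by blast
qed

end

text \<open>Along the squares \<open>k\<^sup>2\<close> the variance bound is summable, so that second moments suffice for an almost sure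
  statement.\<close>

definition gap_law :: "real \<Rightarrow> real \<Rightarrow> weights \<Rightarrow> bool" where
  "gap_law \<alpha> \<beta> W0 \<longleftrightarrow> (\<forall>P Q P' Q' :: nat. 0 < Q \<longrightarrow> 0 < Q' \<longrightarrow> 0 < drift \<alpha> P Q \<longrightarrow> P * Q' < P' * Q \<longrightarrow>
     0 < drift \<beta> P' Q' \<longrightarrow>
     (\<exists>s>0. \<exists>c>0. \<forall>\<eta>>0. \<forall>x1 x2. \<exists>k0. \<forall>k\<ge>k0.
        passage_time W0 (x1 - int (k\<^sup>2 * P), x2 - int (k\<^sup>2 * Q)) (x1, x2) \<le> (real k)\<^sup>2 * (s * drift \<alpha> P Q - c) \<and>
        (real k)\<^sup>2 * (s * drift \<alpha> P' Q' - \<eta>) \<le> passage_time W0 (x1 - int (k\<^sup>2 * P'), x2 - int (k\<^sup>2 * Q')) (x1, x2)))"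

lemma passage_time_row_sum:
  "passage_time W (i, j) (i + int m, j) = (\<Sum>l=1..m. W (i + int l, j) 1)"
proof (induction m)
  case (Suc m)
  have "passage_time W (i, j) (i + int (Suc m), j)
      = passage_time W (i, j) (i + int (Suc m) - 1, j) + W (i + int (Suc m), j) 1"
    by (rule passage_time_row) simp
  also have "i + int (Suc m) - 1 = i + int m" by simp
  finally show ?case using Suc by simp
qed simp

text \<open>Slopes are compared through the cone: \<open>(P, Q)\<close> points slightly below the direction \<open>t\<close>, and
  \<open>(P', Q')\<close> lies between \<open>(P, Q)\<close> and the direction of \<open>(t, 1 - t)\<close> moved back by
  \<open>\<epsilon>\<close> along \<open>(1 - \<alpha>, \<alpha>)\<close>, a direction without drift.\<close>

lemma ex_test_directions:
  fixes \<alpha> \<beta> t \<epsilon> :: real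
  assumes \<alpha>: "0 < \<alpha>" "\<alpha> < 1" and \<beta>: "0 < \<beta>" and t: "1 - \<alpha> < t" "t < 1" "1 - \<beta> \<le> t"
    and \<epsilon>: "0 < \<epsilon>" "\<epsilon> \<le> (1 - t) / 2"
  defines "\<gamma> \<equiv> t - (1 - \<alpha>)"
  obtains P Q P' Q' :: nat where "0 < Q" "0 < Q'" "0 < drift \<alpha> P Q" "P * Q' < P' * Q"
    "0 < drift \<beta> P' Q'" "0 < drift \<alpha> P' Q'"
    "\<gamma> * P < t * drift \<alpha> P Q" "\<gamma> * Q < (1 - t) * drift \<alpha> P Q"
    "(t - (1 - \<alpha>) * \<epsilon>) * drift \<alpha> P' Q' < \<gamma> * P'" "((1 - t) - \<alpha> * \<epsilon>) * drift \<alpha> P' Q' < \<gamma> * Q'"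
proof -
  have \<gamma>: "0 < \<gamma>" using t by (simp add: \<gamma>_def)
  have \<gamma>2: "\<gamma> = \<alpha> * t - (1 - \<alpha>) * (1 - t)" by (simp add: \<gamma>_def algebra_simps)
  \<comment> \<open>Moving back along (1 - \<alpha>, \<alpha>) keeps the drift \<gamma> but flattens
    the slope; rational slopes are then picked on both sides of an intermediate value m.\<close>
  define \<tau> \<upsilon> where "\<tau> = t - (1 - \<alpha>) * \<epsilon>" and "\<upsilon> = (1 - t) - \<alpha> * \<epsilon>"
  have "\<alpha> * \<epsilon> \<le> \<epsilon>" using \<alpha> \<epsilon> by simp
  moreover have "2 * \<epsilon> \<le> 1 - t" using \<epsilon> by simp
  ultimately have \<upsilon>: "0 < \<upsilon>" using t(2) unfolding \<upsilon>_def by linarith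
  have \<gamma>3: "\<gamma> = \<alpha> * \<tau> - (1 - \<alpha>) * \<upsilon>" by (simp add: \<gamma>_def \<tau>_def \<upsilon>_def algebra_simps)
  have "t * \<upsilon> < \<tau> * (1 - t)"
  proof -
    have "\<tau> * (1 - t) - t * \<upsilon> = \<epsilon> * \<gamma>" by (simp add: \<gamma>_def \<tau>_def \<upsilon>_def algebra_simps)
    then show ?thesis using \<epsilon> \<gamma> by (metis diff_gt_0_iff_gt mult_pos_pos)
  qed
  then have "t / (1 - t) < \<tau> / \<upsilon>" using t \<upsilon> by (simp add: field_simps)
  then obtain m where m: "t / (1 - t) < m" "m < \<tau> / \<upsilon>" using dense by blast
  have t0: "0 < t / (1 - t)" using t \<alpha> by simp
  obtain P Q :: nat where PQ: "0 < Q" "t / (1 - t) < P / Q" "P / Q < m"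
    using rational_between[OF t0 m(1)] by blast
  have m0: "0 < m" using t0 m by linarith
  obtain P' Q' :: nat where PQ': "0 < Q'" "m < P' / Q'" "P' / Q' < \<tau> / \<upsilon>"
    using rational_between[OF m0 m(2)] by blast
  have a: "t * Q < (1 - t) * P" using PQ t by (simp add: field_simps)
  have b: "\<upsilon> * P' < \<tau> * Q'" using PQ' \<upsilon> by (simp add: field_simps)
  have "t / (1 - t) < P' / Q'" using PQ' m by linarith
  then have a': "t * Q' < (1 - t) * P'" using PQ' t by (simp add: field_simps)
  have "real P / Q < P' / Q'" using PQ PQ' by linarith
  then have "real P * Q' < P' * Q" using PQ PQ' by (simp add: field_simps)
  then have 4: "P * Q' < P' * Q" by (metis of_nat_less_iff of_nat_mult)
  \<comment> \<open>Facts 7 to 10 compare vectors rescaled to drift \<gamma>: \<open>(P, Q)\<close>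
    becomes smaller than (t, 1 - t) in both coordinates, \<open>(P', Q')\<close> larger than
    (\<tau>, \<upsilon>). This will keep \<open>(u1, w1)\<close> above \<open>(i, j)\<close> and put
    \<open>(u2, w2)\<close> below \<open>(u, w)\<close>.\<close>
  have 7: "\<gamma> * P < t * drift \<alpha> P Q"
    using mult_strict_left_mono[OF a, of "1 - \<alpha>"] \<alpha> by (simp add: \<gamma>2 drift_def algebra_simps)
  have 8: "\<gamma> * Q < (1 - t) * drift \<alpha> P Q"
    using mult_strict_left_mono[OF a, of "\<alpha>"] \<alpha> by (simp add: \<gamma>2 drift_def algebra_simps)
  have 9: "\<tau> * drift \<alpha> P' Q' < \<gamma> * P'"
    using mult_strict_left_mono[OF b, of "1 - \<alpha>"] \<alpha> by (simp add: \<gamma>3 drift_def algebra_simps)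
  have 10: "\<upsilon> * drift \<alpha> P' Q' < \<gamma> * Q'"
    using mult_strict_left_mono[OF b, of "\<alpha>"] \<alpha> by (simp add: \<gamma>3 drift_def algebra_simps)
  have h8: "\<gamma> * Q' < (1 - t) * drift \<alpha> P' Q'"
    using mult_strict_left_mono[OF a', of "\<alpha>"] \<alpha> by (simp add: \<gamma>2 drift_def algebra_simps)
  have "0 < (1 - t) * drift \<alpha> P Q" using 8 \<gamma> PQ(1) by (meson less_trans mult_pos_pos of_nat_0_less_iff)
  then have 3: "0 < drift \<alpha> P Q" using t by (simp add: zero_less_mult_iff)
  have "0 < (1 - t) * drift \<alpha> P' Q'" using h8 \<gamma> PQ'(1) by (meson less_trans mult_pos_pos of_nat_0_less_iff)
  then have 6: "0 < drift \<alpha> P' Q'" using t by (simp add: zero_less_mult_iff)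
  have "(t - (1 - \<beta>)) * Q' < (1 - t) * drift \<beta> P' Q'"
    using mult_strict_left_mono[OF a', of "\<beta>"] \<beta> by (simp add: drift_def algebra_simps)
  moreover have "0 \<le> (t - (1 - \<beta>)) * Q'" using t by simp
  ultimately have "0 < (1 - t) * drift \<beta> P' Q'" by linarith
  then have 5: "0 < drift \<beta> P' Q'" using t by (simp add: zero_less_mult_iff)
  show thesis
    using that[OF PQ(1) PQ'(1) 3 4 5 6 7 8 9[unfolded \<tau>_def] 10[unfolded \<upsilon>_def]] .
qed

context switched_weights
begin

text \<open>A free path from row \<open>h\<close>, not below \<open>x\<close> and \<open>y\<close>,
  reaches row \<open>j\<close> just right of \<open>v\<close>, so a geodesic of \<open>T\<close>
  from \<open>v\<close> to \<open>x\<close> meets it at some \<open>(p, q)\<close>. This is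
  \<open>u\<close>: from there \<open>T\<close> equals \<open>F\<close> towards \<open>x\<close> and
  \<open>y\<close>, and the triangle inequality for \<open>y\<close> gives the claim. The work is to
  show that \<open>(p, q)\<close> is close to \<open>v\<close>.\<close>

lemma T_difference_dominates:
  assumes law: "exit_law \<alpha> S" and row: "row_law W" and gap: "gap_law \<alpha> \<beta> W0"
    and \<alpha>: "0 < \<alpha>" "\<alpha> < 1" and \<beta>: "0 < \<beta>" and t: "1 - \<alpha> < t" "t < 1" "1 - \<beta> \<le> t"
    and \<rho>: "0 < \<rho>" and R: "0 < R"
  shows "\<exists>\<rho>'>0. \<exists>R'. \<forall>v. in_cone t \<rho>' R' v \<longrightarrow>
           (\<exists>u. in_cone t \<rho> R u \<and> F u x - F u y \<le> T v x - T v y)"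
proof -
  obtain x1 x2 where x: "x = (x1, x2)" by fastforce
  obtain y1 y2 where y: "y = (y1, y2)" by fastforce
  define \<gamma> where "\<gamma> = t - (1 - \<alpha>)"
  have \<gamma>: "0 < \<gamma>" "\<gamma> \<le> 1" using t \<alpha> by (auto simp: \<gamma>_def)
  obtain \<epsilon> where \<epsilon>: "0 < \<epsilon>" "\<epsilon> \<le> \<rho> / 8" "\<epsilon> \<le> 1 / 2" "\<epsilon> \<le> (1 - t) / 2"
    using ex_pos_lower_bound[of "{\<rho> / 8, 1 / 2, (1 - t) / 2}"] \<rho> t by auto
  obtain P Q P' Q' :: nat where PQ: "0 < Q" "0 < Q'" "0 < drift \<alpha> P Q" "P * Q' < P' * Q"
    "0 < drift \<beta> P' Q'" "0 < drift \<alpha> P' Q'"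
    and dir: "\<gamma> * P < t * drift \<alpha> P Q" "\<gamma> * Q < (1 - t) * drift \<alpha> P Q"
    "(t - (1 - \<alpha>) * \<epsilon>) * drift \<alpha> P' Q' < \<gamma> * P'" "((1 - t) - \<alpha> * \<epsilon>) * drift \<alpha> P' Q' < \<gamma> * Q'"
    unfolding \<gamma>_def by (rule ex_test_directions[OF \<alpha> \<beta> t \<epsilon>(1,4)])
  define D1 D2 where "D1 = drift \<alpha> P Q" and "D2 = drift \<alpha> P' Q'"
  have D: "0 < D1" "0 < D2" using PQ by (auto simp: D1_def D2_def)
  obtain s c where s: "0 < s" and c: "0 < c" and sc: "\<And>\<eta> x1 x2. 0 < \<eta> \<Longrightarrow> \<exists>k0. \<forall>k\<ge>k0.
        F (x1 - int (k\<^sup>2 * P), x2 - int (k\<^sup>2 * Q)) (x1, x2) \<le> (real k)\<^sup>2 * (s * D1 - c) \<and>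
        (real k)\<^sup>2 * (s * D2 - \<eta>) \<le> F (x1 - int (k\<^sup>2 * P'), x2 - int (k\<^sup>2 * Q')) (x1, x2)"
    using gap[unfolded gap_law_def, rule_format, OF PQ(1-5)] unfolding D1_def D2_def by blast
  \<comment> \<open>In the end the gap \<open>c * (real k1)\<^sup>2\<close> is at least 4 g N,
    against three losses of at most g N each: the shift along row \<open>j\<close>, the error
    \<eta>' in the lower bound, and the rounding.\<close>
  define g where "g = c * \<gamma> / (8 * D1)"
  have g: "0 < g" using c \<gamma> D by (simp add: g_def)
  define \<eta>' where "\<eta>' = g * D2 / 2"
  have \<eta>': "0 < \<eta>'" using g D by (simp add: \<eta>'_def)
  obtain k0 where k0: "\<And>k. k0 \<le> k \<Longrightarrow>
        F (x1 - int (k\<^sup>2 * P), x2 - int (k\<^sup>2 * Q)) (x1, x2) \<le> (real k)\<^sup>2 * (s * D1 - c)"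
      "\<And>k. k0 \<le> k \<Longrightarrow> (real k)\<^sup>2 * (s * D2 - \<eta>') \<le> F (x1 - int (k\<^sup>2 * P'), x2 - int (k\<^sup>2 * Q')) (x1, x2)"
    using sc[OF \<eta>', of x1 x2] by blast
  obtain \<kappa> Nr where \<kappa>: "0 < \<kappa>" and Nr: "\<And>N i j m. Nr \<le> N \<Longrightarrow> norm1 (i, j) \<le> N \<Longrightarrow> real m \<le> \<kappa> * N \<Longrightarrow>
      (\<Sum>l=1..m. W (i + int l, j) 1) \<le> g * N"
    using row[unfolded row_law_def, rule_format, OF g] by blast
  define \<theta>1 where "\<theta>1 = t * D1 - \<gamma> * P"
  define \<theta>2 where "\<theta>2 = (1 - t) * D1 - \<gamma> * Q"
  define \<theta>3 where "\<theta>3 = \<gamma> * P' - (t - (1 - \<alpha>) * \<epsilon>) * D2"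
  define \<theta>4 where "\<theta>4 = \<gamma> * Q' - ((1 - t) - \<alpha> * \<epsilon>) * D2"
  have \<theta>: "0 < \<theta>1" "0 < \<theta>2" "0 < \<theta>3" "0 < \<theta>4"
    using dir by (auto simp: \<theta>1_def \<theta>2_def \<theta>3_def \<theta>4_def D1_def D2_def)
  obtain \<eta> where \<eta>: "0 < \<eta>" and \<eta>a: "\<eta> \<le> \<rho> / 4" "\<eta> \<le> \<gamma> / 16" "\<eta> \<le> 1 / 8" "\<eta> \<le> (1 - t) / 16"
      "\<eta> \<le> (1 - \<alpha>) * (1 - t) / 8" "\<eta> \<le> \<alpha> * \<kappa> / 3" "\<eta> \<le> \<alpha> * \<epsilon> / 6" "\<eta> \<le> g / (8 * s)"
      "\<eta> \<le> \<theta>1 / (4 * P + 2 * D1)" "\<eta> \<le> \<theta>2 / (4 * Q + 2 * D1)"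
      "\<eta> \<le> \<theta>3 / (8 * P' + 7 * D2)" "\<eta> \<le> \<theta>4 / (8 * Q' + 7 * D2)"
    using ex_pos_lower_bound[of "{\<rho> / 4, \<gamma> / 16, 1 / 8, (1 - t) / 16, (1 - \<alpha>) * (1 - t) / 8, \<alpha> * \<kappa> / 3,
       \<alpha> * \<epsilon> / 6, g / (8 * s), \<theta>1 / (4 * P + 2 * D1), \<theta>2 / (4 * Q + 2 * D1), \<theta>3 / (8 * P' + 7 * D2), \<theta>4 / (8 * Q' + 7 * D2)}"]
      \<rho> \<gamma> \<alpha> t \<kappa> \<epsilon> g s \<theta> D by (auto simp: add_nonneg_pos)
  have pos: "0 < 4 * P + 2 * D1" "0 < 4 * Q + 2 * D1" "0 < 8 * P' + 7 * D2" "0 < 8 * Q' + 7 * D2"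
    using D by (auto intro!: add_nonneg_pos)
  have \<eta>b: "16 * \<eta> \<le> \<gamma>" "16 * \<eta> \<le> 1 - t" "8 * \<eta> \<le> (1 - \<alpha>) * (1 - t)" "3 * \<eta> \<le> \<alpha> * \<kappa>" "6 * \<eta> \<le> \<alpha> * \<epsilon>"
    "8 * s * \<eta> \<le> g" "\<eta> * (4 * P + 2 * D1) \<le> \<theta>1" "\<eta> * (4 * Q + 2 * D1) \<le> \<theta>2"
    "\<eta> * (8 * P' + 7 * D2) \<le> \<theta>3" "\<eta> * (8 * Q' + 7 * D2) \<le> \<theta>4"
    using \<eta>a(2,4-8) \<eta>a(9)[unfolded pos_le_divide_eq[OF pos(1)]] \<eta>a(10)[unfolded pos_le_divide_eq[OF pos(2)]]
      \<eta>a(11)[unfolded pos_le_divide_eq[OF pos(3)]] \<eta>a(12)[unfolded pos_le_divide_eq[OF pos(4)]] s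
    by (auto simp: field_simps)
  have \<eta>t: "8 * \<eta> \<le> t" using \<eta>b \<alpha> \<eta> by (auto simp: \<gamma>_def)
  \<comment> \<open>\<open>C * N\<close> bounds the norms of all sites involved. The farthest may be
    \<open>(u2, w2)\<close>, displaced from \<open>x\<close> by
    \<open>(real k2)\<^sup>2 * (P' + Q')\<close>, where
    \<open>(real k2)\<^sup>2 * D2 \<le> 2 * N\<close>.\<close>
  define C where "C = 3 + 2 * (P' + Q') / D2"
  have C: "3 \<le> C" using D by (simp add: C_def)
  obtain Ne where Ne: "\<And>N i j a b. Ne \<le> N \<Longrightarrow> i \<le> a \<Longrightarrow> j \<le> b \<Longrightarrow> norm1 (i, j) \<le> N \<Longrightarrow> norm1 (a, b) \<le> N \<Longrightarrow>
      (drift \<alpha> (real_of_int (a - i)) (real_of_int (b - j)) \<le> - (\<eta> / C) * N \<longrightarrow> exits_left S i j a b) \<and>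
      (\<eta> / C * N \<le> drift \<alpha> (real_of_int (a - i)) (real_of_int (b - j)) \<longrightarrow> \<not> exits_left S i j a b)"
    using law divide_pos_pos[OF \<eta>, of C] C unfolding exit_law_def
    by (metis less_le_trans zero_less_numeral)
  obtain Nq where Nq: "\<And>N A. Nq \<le> N \<Longrightarrow> 0 \<le> A \<Longrightarrow> A \<le> 2 * N \<Longrightarrow> \<exists>k::nat. A \<le> (real k)\<^sup>2 * D1 \<and> (real k)\<^sup>2 * D1 \<le> A + \<eta> * N"
    using square_between[OF D(1) \<eta>, of 2] by blast
  obtain Nq' where Nq': "\<And>N A. Nq' \<le> N \<Longrightarrow> 0 \<le> A \<Longrightarrow> A \<le> 2 * N \<Longrightarrow> \<exists>k::nat. A \<le> (real k)\<^sup>2 * D2 \<and> (real k)\<^sup>2 * D2 \<le> A + \<eta> * N"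
    using square_between[OF D(2) \<eta>, of 2] by blast
  define Cx where "Cx = \<bar>real_of_int x1\<bar> + \<bar>real_of_int x2\<bar> + \<bar>real_of_int y1\<bar> + \<bar>real_of_int y2\<bar> + 4"
  define Rs where "Rs = {2 * R, Ne, Nr, Nq, Nq', Cx / \<eta>, 2 * (real k0)\<^sup>2 * D1 / \<gamma>, 2 * (real k0)\<^sup>2 * D2 / \<gamma>}"
  define R' where "R' = Max Rs"
  have R': "r \<le> R'" if "r \<in> Rs" for r
    unfolding R'_def using that by (intro Max_ge) (simp_all add: Rs_def)
  have "\<exists>u. in_cone t \<rho> R u \<and> F u x - F u y \<le> T v x - T v y" if v: "in_cone t \<eta> R' v" for v
  proof -
    obtain i j where ij: "v = (i, j)" by fastforce
    define N where "N = norm1 v"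
    have NR: "2 * R \<le> N" "Ne \<le> N" "Nr \<le> N" "Nq \<le> N" "Nq' \<le> N" "Cx / \<eta> \<le> N"
        "2 * (real k0)\<^sup>2 * D1 / \<gamma> \<le> N" "2 * (real k0)\<^sup>2 * D2 / \<gamma> \<le> N"
    proof -
      have "r \<le> N" if "r \<in> Rs" for r using R'[OF that] v by (simp add: in_cone_def N_def)
      then show "2 * R \<le> N" "Ne \<le> N" "Nr \<le> N" "Nq \<le> N" "Nq' \<le> N" "Cx / \<eta> \<le> N"
        "2 * (real k0)\<^sup>2 * D1 / \<gamma> \<le> N" "2 * (real k0)\<^sup>2 * D2 / \<gamma> \<le> N"
        unfolding Rs_def by blast+
    qed
    have Npos: "0 < N" using NR R by linarith
    define e where "e = \<eta> * N"
    have e: "0 < e" using \<eta> Npos by (simp add: e_def)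
    have Cx: "Cx \<le> e" using NR(6) \<eta> by (simp add: field_simps e_def)
    have bx: "\<bar>real_of_int x1\<bar> \<le> e" "\<bar>real_of_int x2\<bar> \<le> e" "\<bar>real_of_int y1\<bar> \<le> e"
       "\<bar>real_of_int y2\<bar> \<le> e" "4 \<le> e" using Cx by (auto simp: Cx_def)
    have bi: "\<bar>real_of_int i + t * N\<bar> \<le> e" "\<bar>real_of_int j + (1 - t) * N\<bar> \<le> e"
      using v by (auto simp: in_cone_def ij N_def e_def)
    have X: "- e \<le> real_of_int x1" "real_of_int x1 \<le> e" "- e \<le> real_of_int x2" "real_of_int x2 \<le> e"
      "- e \<le> real_of_int y1" "- e \<le> real_of_int y2" "real_of_int y2 \<le> e" "real_of_int y1 \<le> e"
      using bx unfolding abs_le_iff by linarith+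
    have I: "real_of_int i \<le> e - t * N" "- e - t * N \<le> real_of_int i"
      "real_of_int j \<le> e - (1 - t) * N" "- e - (1 - t) * N \<le> real_of_int j"
      using bi unfolding abs_le_iff by linarith+
    note mm = mult_right_mono[OF _ less_imp_le[OF Npos]]
    have m1: "16 * e \<le> \<gamma> * N" using mm[OF \<eta>b(1)] by (simp add: e_def)
    have m2: "16 * e \<le> (1 - t) * N" using mm[OF \<eta>b(2)] by (simp add: e_def)
    have m3: "8 * e \<le> (1 - \<alpha>) * ((1 - t) * N)" using mm[OF \<eta>b(3)] by (simp add: e_def)
    have m4: "3 * e \<le> \<alpha> * (\<kappa> * N)" using mm[OF \<eta>b(4)] by (simp add: e_def)
    have m5: "6 * e \<le> \<alpha> * (\<epsilon> * N)" using mm[OF \<eta>b(5)] by (simp add: e_def)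
    have m6: "e \<le> 1 / 8 * N" using mm[OF \<eta>a(3)] by (simp add: e_def)
    have m9: "\<gamma> * N \<le> N" using mm[OF \<gamma>(2)] by simp
    have m10: "8 * (s * e) \<le> g * N" using mm[OF \<eta>b(6)] by (simp add: e_def)
    have m11: "\<epsilon> * N \<le> (1 - t) * N / 2" using mm[OF \<epsilon>(4)] by simp
    have CN: "3 * N \<le> C * N" "\<eta> / C * (C * N) = e" "- (\<eta> / C) * (C * N) = - e" "Ne \<le> C * N"
    proof -
      show 1: "3 * N \<le> C * N" using mm[OF C] by simp
      show "\<eta> / C * (C * N) = e" "- (\<eta> / C) * (C * N) = - e" using C by (auto simp: e_def)
      show "Ne \<le> C * N" using 1 NR Npos by linarith
    qed
    have exL: "exits_left S i j a b" if "i \<le> a" "j \<le> b" "norm1 (i, j) \<le> C * N" "norm1 (a, b) \<le> C * N"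
        "drift \<alpha> (real_of_int (a - i)) (real_of_int (b - j)) \<le> - e" for i j a b
      using Ne[OF CN(4) that(1-4)] that(5) unfolding CN by blast
    have exR: "\<not> exits_left S i j a b" if "i \<le> a" "j \<le> b" "norm1 (i, j) \<le> C * N" "norm1 (a, b) \<le> C * N"
        "e \<le> drift \<alpha> (real_of_int (a - i)) (real_of_int (b - j))" for i j a b
      using Ne[OF CN(4) that(1-4)] that(5) unfolding CN by blast
    have absij: "\<bar>real_of_int i\<bar> + \<bar>real_of_int j\<bar> = N" by (simp add: N_def ij norm1_def)
    have nv: "norm1 (i, j) \<le> C * N" using CN(1) Npos by (simp add: N_def ij)
    have nbox: "norm1 (a, b) \<le> C * N" if "i \<le> a" "real_of_int a \<le> e" "j \<le> b" "real_of_int b \<le> e" for a b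
    proof -
      have "\<bar>real_of_int a\<bar> \<le> \<bar>real_of_int i\<bar> + e" "\<bar>real_of_int b\<bar> \<le> \<bar>real_of_int j\<bar> + e"
        using that e by linarith+
      then show ?thesis unfolding norm1_def fst_conv snd_conv using absij CN(1) m6 by linarith
    qed
    define A where "A = drift \<alpha> (real_of_int (x1 - i)) (real_of_int (x2 - j))"
    have "\<bar>A - \<gamma> * N\<bar> \<le> 2 * e"
      using in_cone_drift[of \<alpha> t \<eta> R' i j N x1 x2] v bx \<alpha> by (simp add: ij N_def \<gamma>_def A_def e_def)
    then have A: "\<gamma> * N - 2 * e \<le> A" "A \<le> \<gamma> * N + 2 * e" unfolding abs_le_iff by linarith+
    define h where "h = max x2 y2"
    have h: "- e \<le> real_of_int h" "real_of_int h \<le> e" "x2 \<le> h" "y2 \<le> h"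
      using X by (auto simp: h_def max_def)
    have hj: "(1 - t) * N - 2 * e \<le> real_of_int (h - j)" using I h by simp
    define z where "z = ((1 - \<alpha>) * real_of_int (h - j) + e) / \<alpha>"
    \<comment> \<open>Up to rounding, \<open>(a0, h)\<close> has drift e from \<open>(i, j)\<close>,
      just enough to exclude an exit through column \<open>i\<close>. Moving the base right by K
      columns brings the drift to at most -e, so row \<open>j\<close> is met at a column
      \<open>k\<close> with i < k \<le> i + K.\<close>
    define a0 where "a0 = i + \<lceil>z\<rceil>"
    have \<alpha>z: "\<alpha> * z = (1 - \<alpha>) * real_of_int (h - j) + e" using \<alpha> by (simp add: z_def)
    have "\<alpha> * z \<le> \<alpha> * real_of_int (a0 - i)" "\<alpha> * real_of_int (a0 - i) \<le> \<alpha> * (z + 1)"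
      using \<alpha> by (auto simp: a0_def intro!: mult_left_mono)
    then have a0: "e + (1 - \<alpha>) * real_of_int (h - j) \<le> \<alpha> * real_of_int (a0 - i)"
        "\<alpha> * real_of_int (a0 - i) \<le> e + \<alpha> + (1 - \<alpha>) * real_of_int (h - j)"
      using \<alpha>z by (simp_all add: distrib_left)
    have "(1 - \<alpha>) * ((1 - t) * N - 2 * e) \<le> (1 - \<alpha>) * real_of_int (h - j)"
      using hj \<alpha> by (intro mult_left_mono) auto
    moreover have "(1 - \<alpha>) * (2 * e) \<le> 2 * e"
      using \<alpha> e by (intro mult_left_le_one_le) auto
    ultimately have ahj: "6 * e \<le> (1 - \<alpha>) * real_of_int (h - j)"
      using m3 by (simp only: right_diff_distrib)
    define zK where "zK = (2 * e + 1) / \<alpha>"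
    have \<alpha>zK: "\<alpha> * zK = 2 * e + 1" using \<alpha> by (simp add: zK_def)
    define K where "K = \<lceil>zK\<rceil>"
    have "\<alpha> * zK \<le> \<alpha> * real_of_int K" "\<alpha> * real_of_int K \<le> \<alpha> * (zK + 1)"
      using \<alpha> by (auto simp: K_def intro!: mult_left_mono)
    then have aK: "2 * e + 1 \<le> \<alpha> * real_of_int K" "\<alpha> * real_of_int K \<le> 2 * e + 1 + \<alpha>"
      using \<alpha>zK by (simp_all add: distrib_left)
    have aK3: "\<alpha> * real_of_int K \<le> 3 * e" using aK(2) \<alpha> bx(5) by linarith
    have "\<alpha> * real_of_int K \<le> \<alpha> * (\<kappa> * N)" using aK3 m4 by linarith
    then have K\<kappa>: "real_of_int K \<le> \<kappa> * N" using \<alpha> by simp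
    have "\<alpha> * real_of_int K \<le> \<alpha> * (\<epsilon> * N / 2)" using aK3 m5 by simp
    then have K\<epsilon>: "real_of_int K \<le> \<epsilon> * N / 2" using \<alpha> by simp
    have K0: "0 < K" using \<alpha> e by (simp add: K_def zK_def add_pos_pos)
    have "\<alpha> * (4 * e) \<le> 4 * e" using \<alpha> e by (intro mult_left_le_one_le) auto
    then have "\<alpha> * (4 * e) \<le> \<alpha> * (\<epsilon> * N)" using m5 e by linarith
    then have \<epsilon>e: "4 * e \<le> \<epsilon> * N" using \<alpha> by simp
    have "\<alpha> * real_of_int (i + K) \<le> \<alpha> * real_of_int a0"
      using a0(1) ahj aK3 e unfolding of_int_diff of_int_add right_diff_distrib distrib_left by linarith
    then have iKa: "i + K \<le> a0" using \<alpha> by simp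
    then have ia: "i \<le> a0" using K0 by simp
    have ax: "a0 \<le> b" if "- e \<le> real_of_int b" for b
    proof -
      have "\<alpha> * real_of_int (b - i) - (1 - \<alpha>) * real_of_int (h - j) \<ge> \<gamma> * N - 4 * e"
      proof -
        have "\<alpha> * (t * N - 2 * e) \<le> \<alpha> * real_of_int (b - i)"
          using that I \<alpha> by (intro mult_left_mono) auto
        moreover have "(1 - \<alpha>) * real_of_int (h - j) \<le> (1 - \<alpha>) * ((1 - t) * N + 2 * e)"
          using h I \<alpha> by (intro mult_left_mono) auto
        ultimately show ?thesis using e by (simp add: algebra_simps \<gamma>_def)
      qed
      then have "\<alpha> * real_of_int a0 \<le> \<alpha> * real_of_int b"
        using a0(2) m1 e bx(5) \<alpha> unfolding of_int_diff right_diff_distrib by linarith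
      then show ?thesis using \<alpha> by simp
    qed
    have a0x: "a0 \<le> x1" "a0 \<le> y1" using ax X by auto
    have jh: "j \<le> h" using hj m2 e by linarith
    have jx: "j \<le> x2" "j \<le> y2" using I X m2 e by linarith+
    have na: "norm1 (a0, h) \<le> C * N" using nbox ia a0x X jh h by force
    have "e \<le> drift \<alpha> (real_of_int (a0 - i)) (real_of_int (h - j))"
      using a0(1) by (simp add: drift_def)
    then have "\<not> exits_left S i j a0 h" using exR ia jh nv na by blast
    then obtain n0 k where k: "back_path S (a0, h) n0 = (k, j)" "i < k"
      using not_exits_left_path jh by blast
    have niK: "norm1 (i + K, j) \<le> C * N"
      using nbox[of "i + K" j] iKa a0x X K0 I m2 e by linarith
    have "drift \<alpha> (real_of_int (a0 - (i + K))) (real_of_int (h - j)) \<le> - e"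
      using a0(2) aK(1) \<alpha> by (simp add: drift_def algebra_simps)
    then have exK: "exits_left S (i + K) j a0 h" using exL iKa jh niK na by blast
    have kK: "k \<le> i + K" using not_exits_leftI[OF k(1), of "i + K"] exK by force
    have rx0: "right_of (back_path S (a0, h)) m b h" if "a0 \<le> b" for b m
      using that by (auto simp: right_of_def intro!: exI[of _ 0])
    have rx: "right_of (back_path S (a0, h)) n0 x1 x2"
      by (rule right_of_down[OF rx0[OF a0x(1)]]) (use k jx h in auto)
    have ix: "i \<le> x1" "i \<le> y1" using ia a0x by auto
    obtain n p q where n: "n \<le> n0" "back_path S (a0, h) n = (p, q)" "i \<le> p" "p \<le> x1" "j \<le> q" "q \<le> x2"
        "T (i, j) (x1, x2) = T (i, j) (p, q) + T (p, q) (x1, x2)"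
      using T_split_at_back_path[OF k ix(1) jx(1) rx] by blast
    \<comment> \<open>Otherwise the path passes, after the meeting point, a site
      \<open>(u, w)\<close> close to v + \<epsilon> N (1 - \<alpha>, \<alpha>). From there
      \<open>F\<close> to \<open>x\<close> is at most \<open>F\<close> from \<open>v\<close> plus g
      N, although the drift to \<open>x\<close> is almost the same and the direction flatter: a
      contradiction to the strict slope.\<close>
    have near: "real_of_int (p - i + (q - j)) \<le> \<epsilon> * N"
    proof (rule ccontr)
      assume far: "\<not> real_of_int (p - i + (q - j)) \<le> \<epsilon> * N"
      define L where "L = \<lfloor>\<epsilon> * N\<rfloor>"
      have L: "real_of_int L \<le> \<epsilon> * N" "\<epsilon> * N - 1 \<le> real_of_int L" unfolding L_def by linarith+
      have "L < p - i + (q - j)" using far L by linarith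
      \<comment> \<open>Time at which the path crosses the antidiagonal at distance L from
        \<open>v\<close>: after the meeting time \<open>n\<close> and, since
        \<open>K \<le> L\<close>, not after the arrival in row \<open>j\<close>.\<close>
      define n' where "n' = n + nat (p - i + (q - j) - L)"
      have lev: "p + q = a0 + h - int n" "k + j = a0 + h - int n0"
        using back_path_level[of S "(a0, h)" n] back_path_level[of S "(a0, h)" n0] n k by auto
      have KL: "K \<le> L" using K\<epsilon> L \<epsilon>e bx(5) by linarith
      have n'n0: "n' \<le> n0" using lev KL kK \<open>L < p - i + (q - j)\<close> by (simp add: n'_def)
      obtain u w where uw: "back_path S (a0, h) n' = (u, w)" by fastforce
      have lev': "u + w = i + j + L"
        using back_path_level[of S "(a0, h)" n'] uw lev \<open>L < p - i + (q - j)\<close> by (simp add: n'_def)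
      have ku: "k \<le> u" "j \<le> w" using back_path_decreasing[OF n'n0, of S "(a0, h)"] k uw by auto
      have up: "u \<le> p" "w \<le> q" using back_path_decreasing[of n n' S "(a0, h)"] n uw by (auto simp: n'_def)
      have iu: "i \<le> u" using ku k by simp
      have ux: "u \<le> x1" "w \<le> x2" using up n by auto
      have tail: "back_path S (u, w) (n0 - n') = (k, j)"
        using back_path_add[of S "(a0, h)" n' "n0 - n'"] uw k n'n0 by simp
      have nu: "norm1 (u, w) \<le> C * N" using nbox[OF iu _ ku(2)] ux X by force
      \<comment> \<open>The tail from \<open>(u, w)\<close> reaches row \<open>j\<close> right of
        column \<open>i\<close> but not right of \<open>i + K\<close>, so the exit law puts d
        between -e and 4 e. As the antidiagonal is known, \<open>(u, w)\<close> is determined up to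
        O(e).\<close>
      define d where "d = drift \<alpha> (real_of_int (u - i)) (real_of_int (w - j))"
      have "\<not> d \<le> - e" using exL[OF iu ku(2) nv nu] not_exits_leftI[OF tail k(2)] by (auto simp: d_def)
      then have d1: "- e \<le> d" by simp
      have d2: "d \<le> 4 * e"
      proof (cases "i + K \<le> u")
        case True
        have "exits_left S (i + K) j u w"
        proof (rule ccontr)
          assume "\<not> exits_left S (i + K) j u w"
          then obtain n1 k1 where k1: "back_path S (u, w) n1 = (k1, j)" "i + K < k1"
            using not_exits_left_path ku by blast
          then have "back_path S (a0, h) (n' + n1) = (k1, j)"
            using back_path_add[of S "(a0, h)" n' n1] uw by simp
          then show False using not_exits_leftI k1 exK by blast
        qed
        then have "\<not> e \<le> drift \<alpha> (real_of_int (u - (i + K))) (real_of_int (w - j))"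
          using exR[OF True ku(2) niK nu] by blast
        moreover have "drift \<alpha> (real_of_int (u - (i + K))) (real_of_int (w - j)) = d - \<alpha> * real_of_int K"
          by (simp add: d_def drift_def algebra_simps)
        ultimately show ?thesis using aK3 by linarith
      next
        case False
        have "\<alpha> * real_of_int (u - i) \<le> \<alpha> * real_of_int K" using False \<alpha> by (intro mult_left_mono) auto
        moreover have "0 \<le> (1 - \<alpha>) * real_of_int (w - j)" using \<alpha> ku by simp
        ultimately show ?thesis using aK3 e by (simp add: d_def drift_def)
      qed
      have swj: "real_of_int (w - j) = real_of_int L - real_of_int (u - i)" using lev' by simp
      have "d = real_of_int (u - i) - (1 - \<alpha>) * real_of_int L"
        unfolding d_def drift_def swj by (simp add: algebra_simps)
      then have ui: "real_of_int (u - i) = (1 - \<alpha>) * real_of_int L + d" by simp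
      have wj: "real_of_int (w - j) = \<alpha> * real_of_int L - d"
        unfolding swj ui by (simp add: algebra_simps)
      have T0: "T (u, w) (x1, x2) \<le> T (p, q) (x1, x2)"
      proof -
        have "T (u, w) (x1, x2) \<le> T (u, w) (p, q) + T (p, q) (x1, x2)"
          using up n by (intro passage_time_triangle) auto
        then show ?thesis
          using T_back_path_zero[OF free_field_S, of n n' "(a0, h)"] n uw by (simp add: n'_def)
      qed
      \<comment> \<open>Towards \<open>x\<close>: \<open>F\<close> from \<open>(u, w)\<close> is at
        most \<open>T\<close> from \<open>(u, w)\<close>, at most \<open>T\<close> from
        \<open>(p, q)\<close>, at most \<open>T\<close> from \<open>v\<close>. The latter is bounded
        by walking along row \<open>j\<close> to \<open>(k, j)\<close>, from where \<open>T\<close>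
        equals \<open>F\<close>.\<close>
      have F1: "F (u, w) (x1, x2) \<le> F (i, j) (x1, x2) + g * N"
      proof -
        have kx: "k \<le> x1" using ku ux by simp
        have "T (k, j) (x1, x2) = F (k, j) (x1, x2)"
          using T_eq_F_from_back_path[OF k(1) kx jx(1) rx] .
        moreover have "F (k, j) (x1, x2) \<le> F (i, j) (x1, x2)"
          using F_start_right_le[of i k x1 j x2] k kx jx by simp
        moreover have "T (i, j) (k, j) \<le> g * N"
        proof -
          have "T (i, j) (k, j) = (\<Sum>l=1..nat (k - i). W (i + int l, j) 1)"
            using passage_time_row_sum[of W i j "nat (k - i)"] k by simp
          also have "\<dots> \<le> g * N"
          proof (rule Nr[OF NR(3)])
            show "norm1 (i, j) \<le> N" by (simp add: N_def ij)
            have "real (nat (k - i)) \<le> real_of_int K" using kK k by linarith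
            then show "real (nat (k - i)) \<le> \<kappa> * N" using K\<kappa> by linarith
          qed
          finally show ?thesis .
        qed
        moreover have "T (i, j) (x1, x2) \<le> T (i, j) (k, j) + T (k, j) (x1, x2)"
          using k kx jx by (intro passage_time_triangle) auto
        moreover have "F (u, w) (x1, x2) \<le> T (u, w) (x1, x2)" using F_le_T ux by simp
        moreover have "0 \<le> T (i, j) (p, q)" using T_nonneg n by simp
        ultimately show ?thesis using T0 n(7) by linarith
      qed
      \<comment> \<open>Rounding makes the drift from \<open>v\<close> to \<open>(u1, w1)\<close> at
        most -e, and likewise that from \<open>(u2, w2)\<close> to \<open>(u, w)\<close>; here 6 e
        covers the rounding e, d \<le> 4 e and the margin e. Hence \<open>F\<close> vanishes on both
        pieces.\<close>
      obtain k1 where k1: "A + e \<le> (real k1)\<^sup>2 * D1" "(real k1)\<^sup>2 * D1 \<le> A + e + \<eta> * N"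
        using Nq[OF NR(4), of "A + e"] A m1 m6 m9 e by fastforce
      obtain k2 where k2: "A - 6 * e \<le> (real k2)\<^sup>2 * D2" "(real k2)\<^sup>2 * D2 \<le> A - 6 * e + \<eta> * N"
        using Nq'[OF NR(5), of "A - 6 * e"] A m1 m6 m9 e by fastforce
      have kk: "\<gamma> * N / 2 \<le> (real k1)\<^sup>2 * D1" "\<gamma> * N / 2 \<le> (real k2)\<^sup>2 * D2" using k1 k2 A m1 e by linarith+
      have "(real k0)\<^sup>2 * D1 \<le> \<gamma> * N / 2" "(real k0)\<^sup>2 * D2 \<le> \<gamma> * N / 2"
        using NR(7,8) \<gamma> by (auto simp: field_simps)
      then have "(real k0)\<^sup>2 * D1 \<le> (real k1)\<^sup>2 * D1" "(real k0)\<^sup>2 * D2 \<le> (real k2)\<^sup>2 * D2" using kk by linarith+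
      then have k01: "k0 \<le> k1" "k0 \<le> k2" using D by (auto simp: power2_le_iff_abs_le)
      define u1 w1 u2 w2 where "u1 = x1 - int (k1\<^sup>2 * P)" and "w1 = x2 - int (k1\<^sup>2 * Q)"
        and "u2 = x1 - int (k2\<^sup>2 * P')" and "w2 = x2 - int (k2\<^sup>2 * Q')"
      have r1: "(real k1)\<^sup>2 * D1 \<le> \<gamma> * N + 4 * e" using k1(2)[folded e_def] A by linarith
      have "D1 * ((real k1)\<^sup>2 * P) \<le> D1 * (t * N - 2 * e)"
      proof -
        have "(real k1)\<^sup>2 * D1 * P \<le> (\<gamma> * N + 4 * e) * P" using r1 by (intro mult_right_mono) auto
        moreover have "\<eta> * (4 * P + 2 * D1) * N \<le> \<theta>1 * N" using mm[OF \<eta>b(7)] .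
        ultimately show ?thesis by (simp add: \<theta>1_def e_def algebra_simps)
      qed
      then have "(real k1)\<^sup>2 * P \<le> t * N - 2 * e" using D by simp
      then have "real_of_int (int (k1\<^sup>2 * P)) \<le> real_of_int (x1 - i)" using I X by simp
      then have iu1: "i \<le> u1" by (simp add: u1_def del: of_nat_mult of_nat_power)
      have "D1 * ((real k1)\<^sup>2 * Q) \<le> D1 * ((1 - t) * N - 2 * e)"
      proof -
        have "(real k1)\<^sup>2 * D1 * Q \<le> (\<gamma> * N + 4 * e) * Q" using r1 by (intro mult_right_mono) auto
        moreover have "\<eta> * (4 * Q + 2 * D1) * N \<le> \<theta>2 * N" using mm[OF \<eta>b(8)] .
        ultimately show ?thesis by (simp add: \<theta>2_def e_def algebra_simps)
      qed
      then have "(real k1)\<^sup>2 * Q \<le> (1 - t) * N - 2 * e" using D by simp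
      then have "real_of_int (int (k1\<^sup>2 * Q)) \<le> real_of_int (x2 - j)" using I X by simp
      then have jw1: "j \<le> w1" by (simp add: w1_def del: of_nat_mult of_nat_power)
      have u1x: "u1 \<le> x1" "w1 \<le> x2" by (auto simp: u1_def w1_def)
      have "drift \<alpha> (real_of_int (u1 - i)) (real_of_int (w1 - j)) = A - (real k1)\<^sup>2 * D1"
        by (simp add: u1_def w1_def A_def D1_def drift_def algebra_simps)
      then have "exits_left S i j u1 w1"
        using exL[OF iu1 jw1 nv] nbox[OF iu1 _ jw1] u1x X k1 by force
      then have "F (i, j) (u1, w1) = 0"
        using F_zero_if_exits_left W1_off iu1 jw1 by blast
      moreover have "F (i, j) (x1, x2) \<le> F (i, j) (u1, w1) + F (u1, w1) (x1, x2)"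
        using iu1 jw1 u1x by (intro passage_time_triangle) auto
      ultimately have F2: "F (i, j) (x1, x2) \<le> (real k1)\<^sup>2 * (s * D1 - c)"
        using k0(1)[OF k01(1)] by (simp add: u1_def w1_def)
      have r2: "\<gamma> * N - 8 * e \<le> (real k2)\<^sup>2 * D2" "(real k2)\<^sup>2 * D2 \<le> A - 5 * e" using k2(1) k2(2)[folded e_def] A by linarith+
      have aL: "(1 - \<alpha>) * (\<epsilon> * N - 1) \<le> (1 - \<alpha>) * real_of_int L" "\<alpha> * (\<epsilon> * N - 1) \<le> \<alpha> * real_of_int L"
        using L \<alpha> by (auto intro!: mult_left_mono)
      have "D2 * ((t - (1 - \<alpha>) * \<epsilon>) * N + 7 * e) \<le> D2 * ((real k2)\<^sup>2 * P')"
      proof -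
        have "(\<gamma> * N - 8 * e) * P' \<le> (real k2)\<^sup>2 * D2 * P'" using r2 by (intro mult_right_mono) auto
        moreover have "\<eta> * (8 * P' + 7 * D2) * N \<le> \<theta>3 * N" using mm[OF \<eta>b(9)] .
        ultimately show ?thesis by (simp add: \<theta>3_def e_def algebra_simps)
      qed
      then have "(t - (1 - \<alpha>) * \<epsilon>) * N + 7 * e \<le> (real k2)\<^sup>2 * P'" using D by simp
      moreover have "real_of_int (x1 - u) \<le> (t - (1 - \<alpha>) * \<epsilon>) * N + 7 * e"
        using ui I(2) X(2) aL(1) d1 e bx(5) \<alpha> by (simp add: algebra_simps)
      ultimately have "real_of_int (x1 - u) \<le> real_of_int (int (k2\<^sup>2 * P'))" by simp
      then have u2u: "u2 \<le> u" by (simp add: u2_def del: of_nat_mult of_nat_power)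
      have "D2 * (((1 - t) - \<alpha> * \<epsilon>) * N + 7 * e) \<le> D2 * ((real k2)\<^sup>2 * Q')"
      proof -
        have "(\<gamma> * N - 8 * e) * Q' \<le> (real k2)\<^sup>2 * D2 * Q'" using r2 by (intro mult_right_mono) auto
        moreover have "\<eta> * (8 * Q' + 7 * D2) * N \<le> \<theta>4 * N" using mm[OF \<eta>b(10)] .
        ultimately show ?thesis by (simp add: \<theta>4_def e_def algebra_simps)
      qed
      then have "((1 - t) - \<alpha> * \<epsilon>) * N + 7 * e \<le> (real k2)\<^sup>2 * Q'" using D by simp
      moreover have "real_of_int (x2 - w) \<le> ((1 - t) - \<alpha> * \<epsilon>) * N + 7 * e"
        using wj I(4) X(4) aL(2) d2 e bx(5) \<alpha> by (simp add: algebra_simps)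
      ultimately have "real_of_int (x2 - w) \<le> real_of_int (int (k2\<^sup>2 * Q'))" by simp
      then have w2w: "w2 \<le> w" by (simp add: w2_def del: of_nat_mult of_nat_power)
      have k2N: "(real k2)\<^sup>2 * D2 \<le> 2 * N" using r2 A m9 e Npos by linarith
      have nu2: "norm1 (u2, w2) \<le> C * N"
      proof -
        have "(real k2)\<^sup>2 * (P' + Q') \<le> 2 * N / D2 * (P' + Q')"
          using k2N D by (intro mult_right_mono) (auto simp: field_simps)
        moreover have "\<bar>real_of_int u2\<bar> + \<bar>real_of_int w2\<bar> \<le> \<bar>real_of_int x1\<bar> + \<bar>real_of_int x2\<bar> + (real k2)\<^sup>2 * (P' + Q')"
        proof -
          have "\<bar>real_of_int u2\<bar> \<le> \<bar>real_of_int x1\<bar> + (real k2)\<^sup>2 * P'" 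
            using abs_triangle_ineq4[of "real_of_int x1" "(real k2)\<^sup>2 * P'"] by (simp add: u2_def)
          moreover have "\<bar>real_of_int w2\<bar> \<le> \<bar>real_of_int x2\<bar> + (real k2)\<^sup>2 * Q'" 
            using abs_triangle_ineq4[of "real_of_int x2" "(real k2)\<^sup>2 * Q'"] by (simp add: w2_def)
          ultimately show ?thesis by (simp add: algebra_simps)
        qed
        moreover have "C * N = 3 * N + 2 * N / D2 * (P' + Q')" by (simp add: C_def algebra_simps)
        ultimately show ?thesis unfolding norm1_def fst_conv snd_conv using bx(1,2) m6 Npos by linarith
      qed
      have "drift \<alpha> (real_of_int (u - u2)) (real_of_int (w - w2)) = (real k2)\<^sup>2 * D2 - A + d"
        by (simp add: u2_def w2_def A_def D2_def d_def drift_def algebra_simps)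
      then have "exits_left S u2 w2 u w"
        using exL[OF u2u w2w nu2 nu] r2 d2 by linarith
      then have "F (u2, w2) (u, w) = 0"
        using F_zero_if_exits_left W1_off u2u w2w by blast
      moreover have "F (u2, w2) (x1, x2) \<le> F (u2, w2) (u, w) + F (u, w) (x1, x2)"
        using u2u w2w ux by (intro passage_time_triangle) auto
      ultimately have F3: "(real k2)\<^sup>2 * (s * D2 - \<eta>') \<le> F (u, w) (x1, x2)"
        using k0(2)[OF k01(2)] by (simp add: u2_def w2_def)
      \<comment> \<open>The terms s A cancel; what remains is 4 g N \<le> 2 g N + 8 s e, although 8
        s e \<le> g N.\<close>
      have "s * ((real k2)\<^sup>2 * D2) - \<eta>' * (real k2)\<^sup>2 \<le> s * ((real k1)\<^sup>2 * D1) - c * (real k1)\<^sup>2 + g * N"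
        using F1 F2 F3 by (simp add: algebra_simps)
      moreover have "s * (A - 6 * e) \<le> s * ((real k2)\<^sup>2 * D2)" using k2 s by (intro mult_left_mono) auto
      moreover have "s * ((real k1)\<^sup>2 * D1) \<le> s * (A + 2 * e)"
        using k1(2)[folded e_def] s by (intro mult_left_mono) auto
      moreover have "\<eta>' * (real k2)\<^sup>2 \<le> g * N"
      proof -
        have "\<eta>' * (real k2)\<^sup>2 = g / 2 * ((real k2)\<^sup>2 * D2)" by (simp add: \<eta>'_def)
        also have "\<dots> \<le> g / 2 * (2 * N)" using k2N g by (intro mult_left_mono) auto
        finally show ?thesis by simp
      qed
      moreover have "4 * (g * N) \<le> c * (real k1)\<^sup>2"
      proof -
        have "c / D1 * (\<gamma> * N / 2) \<le> c / D1 * ((real k1)\<^sup>2 * D1)" using kk c D by (intro mult_left_mono) auto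
        then show ?thesis using D by (simp add: g_def ac_simps)
      qed
      moreover have "0 < g * N" using g Npos by simp
      ultimately show False using m10 by (simp add: algebra_simps)
    qed
    have "norm1 ((p, q) - v) \<le> \<epsilon> * norm1 v"
      using near n by (simp add: norm1_def ij flip: N_def) (simp add: N_def ij norm1_def)
    moreover have "in_cone t (\<rho> / 4) (2 * R) v"
      using v mm[OF \<eta>a(1)] NR by (auto simp: in_cone_def N_def)
    ultimately have cone: "in_cone t \<rho> R (p, q)" using in_cone_near R \<epsilon> \<rho> t \<alpha> by simp
    have "real_of_int q \<le> real_of_int j + \<epsilon> * N" "real_of_int p \<le> real_of_int i + \<epsilon> * N"
      using near n(3,5) by auto
    then have qy: "q \<le> y2" using I X m11 m2 e by linarith
    have py: "p \<le> y1" using back_path_decreasing(1)[of 0 n S "(a0, h)"] n a0x by simp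
    have rx': "right_of (back_path S (a0, h)) n x1 x2"
      by (rule right_of_down[OF rx0[OF a0x(1)]]) (use n h in auto)
    have ry': "right_of (back_path S (a0, h)) n y1 y2"
      by (rule right_of_down[OF rx0[OF a0x(2)]]) (use n h qy in auto)
    have "T (p, q) (x1, x2) = F (p, q) (x1, x2)"
      using T_eq_F_from_back_path[OF n(2,4,6) rx'] .
    moreover have "T (p, q) (y1, y2) = F (p, q) (y1, y2)"
      using T_eq_F_from_back_path[OF n(2) py qy ry'] .
    moreover have "T (i, j) (y1, y2) \<le> T (i, j) (p, q) + T (p, q) (y1, y2)"
      using n py qy by (intro passage_time_triangle) auto
    ultimately have "F (p, q) x - F (p, q) y \<le> T v x - T v y"
      using n(7) by (simp add: x y ij)
    then show ?thesis using cone by blast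
  qed
  then show ?thesis using \<eta> by blast
qed

text \<open>The predicates inside the two definite descriptions are equivalent, so the descriptions
  agree. Going from \<open>F\<close> to \<open>T\<close> splits at t = 1 - \<beta>: below it,
  \<open>zero_direction\<close> makes both differences zero in a cone; from it on,
  \<open>T_difference_dominates\<close> applies.\<close>

lemma busemann_eq:
  assumes law: "exit_law \<alpha> S" "row_law W" "gap_law \<alpha> \<beta> W0"
    and B: "exit_law \<beta> B" "free_field B"
    and \<alpha>: "0 < \<alpha>" "\<alpha> < 1" and \<beta>: "0 < \<beta>" "\<beta> < 1" and t: "1 - \<alpha> < t" "t < 1"
  shows "busemann W t x y = busemann W0 t x y"
proof -
  let ?lim = "\<lambda>L c. \<forall>v. sw_admissible t v \<longrightarrow> (\<lambda>n. L (v n) x - L (v n) y) \<longlonglongrightarrow> c"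
  have TF: "?lim F c" if "?lim T c" for c
    using sw_limit_transfer[of t T F x y c] F_difference_dominates[OF law(1) \<alpha> t] that by blast
  have FT: "?lim T c" if lim: "?lim F c" for c
  proof (cases "t < 1 - \<beta>")
    case True
    obtain \<rho>1 R1 where 1: "\<rho>1 > 0" "\<And>v. in_cone t \<rho>1 R1 v \<Longrightarrow> T v x \<le> T v y \<and> F v x = 0"
      using zero_direction[OF law(1) B \<alpha> \<beta> t(1) True, of x y] by blast
    obtain \<rho>2 R2 where 2: "\<rho>2 > 0" "\<And>v. in_cone t \<rho>2 R2 v \<Longrightarrow> T v y \<le> T v x \<and> F v y = 0"
      using zero_direction[OF law(1) B \<alpha> \<beta> t(1) True, of y x] by blast
    have same: "T v x - T v y = F v x - F v y" if v: "in_cone t (min \<rho>1 \<rho>2) (max R1 R2) v" for v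
    proof -
      have "min \<rho>1 \<rho>2 * norm1 v \<le> \<rho>1 * norm1 v" "min \<rho>1 \<rho>2 * norm1 v \<le> \<rho>2 * norm1 v"
        by (auto intro!: mult_right_mono)
      then have "in_cone t \<rho>1 R1 v" "in_cone t \<rho>2 R2 v" using v by (auto simp: in_cone_def)
      then show ?thesis using 1(2)[of v] 2(2)[of v] by auto
    qed
    show ?thesis
      unfolding sw_admissible_limit_iff[of t "\<lambda>v. T v x - T v y" c]
    proof (intro allI impI)
      fix \<delta> :: real assume "\<delta> > 0"
      then obtain \<rho>3 R3 where 3: "\<rho>3 > 0" "\<And>v. in_cone t \<rho>3 R3 v \<Longrightarrow> \<bar>F v x - F v y - c\<bar> < \<delta>"
        using lim unfolding sw_admissible_limit_iff[of t "\<lambda>v. F v x - F v y" c] by blast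
      have "\<bar>T v x - T v y - c\<bar> < \<delta>"
        if v: "in_cone t (min (min \<rho>1 \<rho>2) \<rho>3) (max (max R1 R2) R3) v" for v
      proof -
        have "min (min \<rho>1 \<rho>2) \<rho>3 * norm1 v \<le> min \<rho>1 \<rho>2 * norm1 v" "min (min \<rho>1 \<rho>2) \<rho>3 * norm1 v \<le> \<rho>3 * norm1 v"
          by (auto intro!: mult_right_mono)
        then have "in_cone t (min \<rho>1 \<rho>2) (max R1 R2) v" "in_cone t \<rho>3 R3 v"
          using v unfolding in_cone_def by linarith+
        then show ?thesis using same[of v] 3(2)[of v] by simp
      qed
      then show "\<exists>\<rho>>0. \<exists>R. \<forall>v. in_cone t \<rho> R v \<longrightarrow> \<bar>T v x - T v y - c\<bar> < \<delta>"
        using 1(1) 2(1) 3(1) by (intro exI[of _ "min (min \<rho>1 \<rho>2) \<rho>3"]) auto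
    qed
  next
    case False
    then show ?thesis
      using sw_limit_transfer[of t F T x y c] T_difference_dominates[OF law \<alpha> \<beta>(1) t] lim by fastforce
  qed
  have "?lim T c \<longleftrightarrow> ?lim F c" for c using TF FT by blast
  then show ?thesis unfolding busemann_def by presburger
qed

end

section \<open>Almost sure estimates for independent sites\<close>

text \<open>Only sites weakly below and left of \<open>(a, b)\<close> are inspected, so resampling
  \<open>(a, b)\<close> does not affect the predicate at its two predecessors.\<close>

lemma exits_left_cong:
  assumes "\<And>c d. c \<le> a \<Longrightarrow> d \<le> b \<Longrightarrow> B (c, d) = B' (c, d)"
  shows "exits_left B i j a b = exits_left B' i j a b"
  using assms
proof (induction B i j a b rule: exits_left.induct)
  case (1 B i j a b)
  have eq: "B (a, b) = B' (a, b)" using 1(3) by simp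
  show ?case
    using 1 eq by (subst (1 2) exits_left.simps) auto
qed

lemma exp_le_quadratic:
  fixes x :: real
  assumes "\<bar>x\<bar> \<le> 1"
  shows "exp x \<le> 1 + x + x\<^sup>2"
proof (cases "0 \<le> x")
  case True
  then show ?thesis using exp_bound assms by simp
next
  case False
  define y where "y = - x"
  have y: "0 \<le> y" "y \<le> 1" using False assms by (auto simp: y_def)
  have "1 \<le> (1 - y + y\<^sup>2) * (1 + y + y\<^sup>2 / 2)"
  proof -
    have "(1 - y + y\<^sup>2) * (1 + y + y\<^sup>2 / 2) = 1 + (y ^ 2 / 2 + y ^ 3 / 2 + y ^ 4 / 2)"
      by (simp add: field_simps power2_eq_square power3_eq_cube power4_eq_xxxx)
    then show ?thesis using y by simp
  qed
  also have "\<dots> \<le> (1 - y + y\<^sup>2) * exp y"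
    using exp_lower_Taylor_quadratic[OF y(1)] y by (intro mult_left_mono) (auto simp: power2_eq_square)
  finally have "exp (- y) \<le> 1 - y + y\<^sup>2" by (simp add: exp_minus field_simps)
  then show ?thesis by (simp add: y_def)
qed

text \<open>Moment generating function of a centred Bernoulli variable: the linear terms of
  \<open>exp_le_quadratic\<close> cancel, and the variance is at most 1.\<close>

lemma bernoulli_mgf_le:
  fixes \<theta> \<beta> :: real
  assumes "\<bar>\<theta>\<bar> \<le> 1" "0 \<le> \<beta>" "\<beta> \<le> 1"
  shows "\<beta> * exp (\<theta> * (1 - \<beta>)) + (1 - \<beta>) * exp (- \<theta> * \<beta>) \<le> exp (\<theta>\<^sup>2)"
proof -
  have l1: "\<bar>\<theta> * (1 - \<beta>)\<bar> \<le> 1" "\<bar>- \<theta> * \<beta>\<bar> \<le> 1"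
    using assms by (auto simp: abs_mult intro!: mult_le_one)
  have "\<beta> * exp (\<theta> * (1 - \<beta>)) + (1 - \<beta>) * exp (- \<theta> * \<beta>)
      \<le> \<beta> * (1 + \<theta> * (1 - \<beta>) + (\<theta> * (1 - \<beta>))\<^sup>2) + (1 - \<beta>) * (1 + - \<theta> * \<beta> + (- \<theta> * \<beta>)\<^sup>2)"
    using assms l1 by (intro add_mono mult_left_mono exp_le_quadratic) auto
  also have "\<dots> = 1 + \<theta>\<^sup>2 * (\<beta> * (1 - \<beta>))"
    by (simp add: power2_eq_square algebra_simps)
  also have "\<dots> \<le> 1 + \<theta>\<^sup>2 * 1"
    using assms by (intro add_left_mono mult_left_mono mult_le_one) auto
  also have "\<dots> \<le> exp (\<theta>\<^sup>2)" by simp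
  finally show ?thesis .
qed

text \<open>A site carries its switch and its horizontal weight; \<open>exit_law\<close>,
  \<open>row_law\<close> and \<open>gap_law\<close> are properties of the field of these
  pairs.\<close>

locale site_law =
  fixes D :: "(bool \<times> real) measure"
  assumes prob_space_D: "prob_space D"
    and sets_D [measurable_cong]: "sets D = sets (count_space UNIV \<Otimes>\<^sub>M borel)"
begin

definition P :: "(site \<Rightarrow> bool \<times> real) measure" where
  "P = PiM UNIV (\<lambda>_. D)"

sublocale D: prob_space D
  by (rule prob_space_D)

sublocale P: prob_space P
  unfolding P_def by (intro prob_space_PiM prob_space_D)

lemma space_D [simp]: "space D = UNIV"
  using sets_eq_imp_space_eq[OF sets_D] by (simp add: space_pair_measure)

lemma space_P [simp]: "space P = UNIV"
  by (simp add: P_def space_PiM PiE_def extensional_def)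

lemma measurable_site [measurable]: "(\<lambda>w. w z) \<in> measurable P D"
  unfolding P_def by measurable

lemma measurable_update [measurable]:
  "(\<lambda>(d, w). w(z := d)) \<in> measurable (D \<Otimes>\<^sub>M P) P"
  proof -
  have "(\<lambda>x. (snd x)(z := fst x)) \<in> measurable (D \<Otimes>\<^sub>M PiM UNIV (\<lambda>_. D)) (PiM UNIV (\<lambda>_. D))"
    by (rule measurable_fun_upd[where J = UNIV]) auto
  then show ?thesis by (simp add: P_def case_prod_beta)
qed

text \<open>The form in which independence is mostly used: overwriting one coordinate by a fresh
  sample preserves the law, so one may condition on all other sites.\<close>

lemma distr_resample: "distr (D \<Otimes>\<^sub>M P) P (\<lambda>(d, w). w(z := d)) = P"
  using distr_pair_PiM_eq_PiM[of UNIV "\<lambda>_. D" z] prob_space_D by (simp add: P_def)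

lemma nn_integral_resample:
  assumes f [measurable]: "f \<in> borel_measurable P"
  shows "(\<integral>\<^sup>+w. f w \<partial>P) = (\<integral>\<^sup>+w. \<integral>\<^sup>+d. f (w(z := d)) \<partial>D \<partial>P)"
proof -
  interpret pair_sigma_finite D P ..
  have "(\<integral>\<^sup>+w. f w \<partial>P) = (\<integral>\<^sup>+w. f w \<partial>distr (D \<Otimes>\<^sub>M P) P (\<lambda>(d, w). w(z := d)))"
    by (simp add: distr_resample)
  also have "\<dots> = (\<integral>\<^sup>+x. f (case x of (d, w) \<Rightarrow> w(z := d)) \<partial>(D \<Otimes>\<^sub>M P))"
    by (rule nn_integral_distr) measurable
  also have "\<dots> = (\<integral>\<^sup>+w. \<integral>\<^sup>+d. f (w(z := d)) \<partial>D \<partial>P)"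
    by (subst nn_integral_snd[symmetric]) (auto simp: case_prod_beta)
  finally show ?thesis .
qed

lemma measurable_exits_left:
  assumes [measurable]: "Measurable.pred D q"
  shows "Measurable.pred P (\<lambda>w. exits_left (\<lambda>z. q (w z)) i j a b)"
proof (induction "nat (a - i) + nat (b - j)" arbitrary: a b rule: less_induct)
  case less
  show ?case
  proof (cases "a \<le> i \<or> b \<le> j")
    case True
    then show ?thesis by (subst exits_left.simps) auto
  next
    case False
    then have [measurable]: "Measurable.pred P (\<lambda>w. exits_left (\<lambda>z. q (w z)) i j a (b - 1))"
      "Measurable.pred P (\<lambda>w. exits_left (\<lambda>z. q (w z)) i j (a - 1) b)"
      using less[of a "b - 1"] less[of "a - 1" b] by auto
    have "exits_left (\<lambda>z. q (w z)) i j a b \<longleftrightarrow>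
       (q (w (a, b)) \<and> exits_left (\<lambda>z. q (w z)) i j a (b - 1)) \<or>
       (\<not> q (w (a, b)) \<and> exits_left (\<lambda>z. q (w z)) i j (a - 1) b)" for w
      using False by (subst exits_left.simps) auto
    then show ?thesis by simp
  qed
qed

text \<open>Condition on the site \<open>(a, b)\<close>, which decides the next step; the events at
  the predecessors do not depend on it. The parameter \<open>h\<close> treats the event and its
  complement together.\<close>

lemma prob_exits_left_step:
  fixes h :: bool
  assumes q [measurable]: "Measurable.pred D q" and "i < a" "j < b"
  defines "u \<equiv> \<lambda>a b. P.prob {w. exits_left (\<lambda>z. q (w z)) i j a b = h}"
  shows "u a b = measure D {d. q d} * u a (b - 1) + (1 - measure D {d. q d}) * u (a - 1) b"
proof -
  let ?X = "\<lambda>a b w. exits_left (\<lambda>z. q (w z)) i j a b = h"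
  have X [measurable]: "Measurable.pred P (?X a b)" for a b
    using measurable_exits_left[OF q, of i j a b] by measurable
  have step: "?X a b (w((a, b) := d)) \<longleftrightarrow> (q d \<and> ?X a (b - 1) w) \<or> (\<not> q d \<and> ?X (a - 1) b w)" for w d
  proof -
    have "exits_left (\<lambda>z. q ((w((a, b) := d)) z)) i j a (b - 1) = exits_left (\<lambda>z. q (w z)) i j a (b - 1)"
      "exits_left (\<lambda>z. q ((w((a, b) := d)) z)) i j (a - 1) b = exits_left (\<lambda>z. q (w z)) i j (a - 1) b"
      by (auto intro!: exits_left_cong)
    then show ?thesis using assms(2,3) by (subst exits_left.simps) auto
  qed
  have [measurable]: "{w. ?X a b w} \<in> sets P" for a b
    using X[of a b] by (simp add: pred_def)
  have q1 [measurable]: "Collect q \<in> sets D" using q by (simp add: pred_def)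
  then have [measurable]: "{d. \<not> q d} \<in> sets D"
    using sets.compl_sets[OF q1] by (simp add: Collect_neg_eq Compl_eq_Diff_UNIV)
  have em: "ennreal (u a b) = (\<integral>\<^sup>+w. indicator {w. ?X a b w} w \<partial>P)" for a b
    by (simp add: u_def P.emeasure_eq_measure[symmetric])
  have "ennreal (u a b) = (\<integral>\<^sup>+w. \<integral>\<^sup>+d. indicator {w. ?X a b w} (w((a, b) := d)) \<partial>D \<partial>P)"
    unfolding em by (rule nn_integral_resample) measurable
  also have "\<dots> = (\<integral>\<^sup>+w. \<integral>\<^sup>+d. indicator {d. q d} d * indicator {w. ?X a (b - 1) w} w
       + indicator {d. \<not> q d} d * indicator {w. ?X (a - 1) b w} w \<partial>D \<partial>P)"
    by (intro nn_integral_cong) (simp only: indicator_def mem_Collect_eq step, auto)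
  also have "\<dots> = (\<integral>\<^sup>+w. emeasure D {d. q d} * indicator {w. ?X a (b - 1) w} w
       + emeasure D {d. \<not> q d} * indicator {w. ?X (a - 1) b w} w \<partial>P)"
    by (intro nn_integral_cong) (simp add: nn_integral_add nn_integral_multc)
  also have "\<dots> = emeasure D {d. q d} * ennreal (u a (b - 1)) + emeasure D {d. \<not> q d} * ennreal (u (a - 1) b)"
    unfolding em by (simp add: nn_integral_add nn_integral_cmult)
  also have "\<dots> = ennreal (measure D {d. q d} * u a (b - 1) + measure D {d. \<not> q d} * u (a - 1) b)"
    by (simp add: D.emeasure_eq_measure u_def ennreal_mult)
  finally have "u a b = measure D {d. q d} * u a (b - 1) + measure D {d. \<not> q d} * u (a - 1) b"
    by (subst (asm) ennreal_inj) (auto simp: u_def)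
  moreover have "measure D {d. \<not> q d} = 1 - measure D {d. q d}"
    using D.prob_neg[of q] by simp
  ultimately show ?thesis by simp
qed

text \<open>A Chernoff bound in recursive form: by \<open>bernoulli_mgf_le\<close> the exponential
  is a supersolution of \<open>prob_exits_left_step\<close>. The sign of \<theta> is tied to
  \<open>h\<close> so that the exponent is non-negative on the side of the boundary where the
  probability is 1.\<close>

lemma prob_exits_left_le:
  assumes q [measurable]: "Measurable.pred D q" and "i \<le> a" "j \<le> b"
    and \<theta>: "\<bar>\<theta>\<bar> \<le> 1" and h: "if h then \<theta> \<le> 0 else 0 \<le> \<theta>"
  defines "\<beta> \<equiv> measure D {d. q d}"
  shows "P.prob {w. exits_left (\<lambda>z. q (w z)) i j a b = h}
     \<le> exp (\<theta> * drift \<beta> (real_of_int (a - i)) (real_of_int (b - j)) + \<theta>\<^sup>2 * real_of_int (a - i + (b - j)))"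
  using assms(2,3)
proof (induction rule: quadrant_induct)
  case corner
  then show ?case by (simp add: drift_def)
next
  case (row a)
  have \<beta>: "0 \<le> \<beta>" by (simp add: \<beta>_def)
  show ?case
  proof (cases h)
    case True
    then show ?thesis using row by (simp add: exits_left.simps[of _ i j a j])
  next
    case False
    then have "0 \<le> \<theta> * drift \<beta> (real_of_int (a - i)) (real_of_int (j - j)) + \<theta>\<^sup>2 * real_of_int (a - i + (j - j))"
      using h row \<beta> by (auto simp: drift_def intro!: add_nonneg_nonneg mult_nonneg_nonneg)
    then show ?thesis using P.prob_le_1 by (meson one_le_exp_iff order_trans)
  qed
next
  case (col b)
  have \<beta>: "\<beta> \<le> 1" by (simp add: \<beta>_def)
  show ?case
  proof (cases h)
    case False
    then show ?thesis using col by (simp add: exits_left.simps[of _ i j i b])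
  next
    case True
    have "\<theta> * drift \<beta> (real_of_int (i - i)) (real_of_int (b - j)) = (- \<theta>) * ((1 - \<beta>) * real_of_int (b - j))"
      by (simp add: drift_def)
    moreover have "0 \<le> (- \<theta>) * ((1 - \<beta>) * real_of_int (b - j))"
      using h True col \<beta> by (intro mult_nonneg_nonneg) auto
    ultimately have "0 \<le> \<theta> * drift \<beta> (real_of_int (i - i)) (real_of_int (b - j)) + \<theta>\<^sup>2 * real_of_int (i - i + (b - j))"
      using mult_nonneg_nonneg[OF zero_le_power2[of \<theta>], of "real_of_int (i - i + (b - j))"] col.hyps by linarith
    then show ?thesis using P.prob_le_1 by (meson one_le_exp_iff order_trans)
  qed
next
  case (inner a b)
  have \<beta>: "0 \<le> \<beta>" "\<beta> \<le> 1" by (auto simp: \<beta>_def)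
  let ?E = "\<lambda>a b. exp (\<theta> * drift \<beta> (real_of_int (a - i)) (real_of_int (b - j)) + \<theta>\<^sup>2 * real_of_int (a - i + (b - j)))"
  have E1: "?E a (b - 1) = ?E a b * exp (- \<theta>\<^sup>2) * exp (\<theta> * (1 - \<beta>))"
    by (simp add: drift_def algebra_simps flip: exp_add)
  have E2: "?E (a - 1) b = ?E a b * exp (- \<theta>\<^sup>2) * exp (- \<theta> * \<beta>)"
    by (simp add: drift_def algebra_simps flip: exp_add)
  have "P.prob {w. exits_left (\<lambda>z. q (w z)) i j a b = h} \<le> \<beta> * ?E a (b - 1) + (1 - \<beta>) * ?E (a - 1) b"
    unfolding prob_exits_left_step[OF q inner.hyps, folded \<beta>_def]
    using inner.IH \<beta> by (intro add_mono mult_left_mono) auto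
  also have "\<dots> = ?E a b * exp (- \<theta>\<^sup>2) * (\<beta> * exp (\<theta> * (1 - \<beta>)) + (1 - \<beta>) * exp (- \<theta> * \<beta>))"
    unfolding E1 E2 by (simp add: algebra_simps)
  also have "\<dots> \<le> ?E a b * exp (- \<theta>\<^sup>2) * exp (\<theta>\<^sup>2)"
    using bernoulli_mgf_le[OF \<theta> \<beta>] by (intro mult_left_mono) auto
  also have "\<dots> = ?E a b" by (simp flip: exp_add)
  finally show ?case .
qed

lemma AE_eventually_not:
  assumes meas: "\<And>n. A n \<in> sets P" and sum: "summable (\<lambda>n. c n)" and le: "\<And>n. P.prob (A n) \<le> c n"
  shows "AE w in P. \<forall>\<^sub>F n in sequentially. w \<notin> A n"
proof -
  have "summable (\<lambda>n. P.prob (A n))"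
    by (rule summable_comparison_test'[OF sum, of 0]) (use le in auto)
  then have "AE w in P. \<forall>\<^sub>F n in sequentially. w \<in> space P - A n"
    by (intro borel_cantelli_AE1) (use meas in \<open>auto simp: P.emeasure_eq_measure\<close>)
  then show ?thesis by simp
qed

definition box :: "nat \<Rightarrow> int set" where
  "box n = {- int n..int n}"

lemma norm1_le_box: "norm1 (a, b) \<le> real n \<Longrightarrow> a \<in> box n \<and> b \<in> box n"
  by (auto simp: norm1_def box_def)

lemma finite_box [simp]: "finite (box n)"
  by (simp add: box_def)

lemma card_box: "card (box n) = 2 * n + 1"
  by (simp add: box_def)

theorem AE_exit_law:
  assumes q [measurable]: "Measurable.pred D q"
  shows "AE w in P. exit_law (measure D {d. q d}) (\<lambda>z. q (w z))"
proof -
  define \<beta> where "\<beta> = measure D {d. q d}"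
  define viol where "viol = (\<lambda>\<delta> (n::nat) w ((i, j), (a, b)). i \<le> a \<and> j \<le> b \<and>
     ((drift \<beta> (real_of_int (a - i)) (real_of_int (b - j)) \<le> - \<delta> * n \<and> exits_left (\<lambda>z. q (w z)) i j a b = False) \<or>
      (\<delta> * n \<le> drift \<beta> (real_of_int (a - i)) (real_of_int (b - j)) \<and> exits_left (\<lambda>z. q (w z)) i j a b = True)))"
  have viol_meas [measurable]: "Measurable.pred P (\<lambda>w. viol \<delta> n w x)" for \<delta> n x
  proof -
    obtain i j a b where x: "x = ((i, j), (a, b))" by (metis surj_pair)
    have [measurable]: "Measurable.pred P (\<lambda>w. exits_left (\<lambda>z. q (w z)) i j a b)"
      by (rule measurable_exits_left[OF q])
    show ?thesis unfolding viol_def x by simp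
  qed
  have viol_sets [measurable]: "{w. viol \<delta> n w x} \<in> sets P" for \<delta> n x
    using viol_meas[of \<delta> n x] by (simp add: pred_def)
  define idx where "idx = (\<lambda>n. (box n \<times> box n) \<times> (box n \<times> box n))"
  define A where "A = (\<lambda>\<delta> n. {w. \<exists>x\<in>idx n. viol \<delta> n w x})"
  have A_sets: "A \<delta> n \<in> sets P" for \<delta> n
  proof -
    have "A \<delta> n = (\<Union>x\<in>idx n. {w. viol \<delta> n w x})" by (auto simp: A_def)
    also have "\<dots> \<in> sets P" using viol_sets by (intro sets.finite_UN) (auto simp: idx_def)
    finally show ?thesis .
  qed
  have ev: "AE w in P. \<forall>\<^sub>F n in sequentially. w \<notin> A \<delta> n" if \<delta>: "0 < \<delta>" for \<delta>
  proof -
    \<comment> \<open>Paths in the box have length at most 4 n, so \<theta> \<le> \<delta> / 8 keeps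
      the quadratic term below half of the gain \<theta> \<delta> n; the other half is c n.\<close>
    define \<theta> where "\<theta> = min 1 (\<delta> / 8)"
    have \<theta>: "0 < \<theta>" "\<theta> \<le> 1" "\<theta> \<le> \<delta> / 8" using \<delta> by (auto simp: \<theta>_def)
    define c where "c = \<theta> * \<delta> / 2"
    have c: "0 < c" using \<theta> \<delta> by (simp add: c_def)
    have single: "P.prob {w. viol \<delta> n w x} \<le> exp (- c * n)" if "x \<in> idx n" for n x
    proof -
      obtain i j a b where x: "x = ((i, j), (a, b))" by (metis surj_pair)
      have abs: "\<bar>i\<bar> \<le> int n" "\<bar>j\<bar> \<le> int n" "\<bar>a\<bar> \<le> int n" "\<bar>b\<bar> \<le> int n"
        using that by (auto simp: x idx_def box_def)
      then have "a - i + (b - j) \<le> 4 * int n" by linarith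
      then have len: "real_of_int (a - i + (b - j)) \<le> 4 * real n" by linarith
      have cn: "\<theta> * (\<delta> * n) = 2 * (c * n)" "- \<theta> * (\<delta> * n) = - (2 * (c * n))" by (auto simp: c_def)
      have bound: "\<theta>\<^sup>2 * real_of_int (a - i + (b - j)) \<le> c * n"
      proof -
        have "\<theta>\<^sup>2 * real_of_int (a - i + (b - j)) \<le> \<theta>\<^sup>2 * (4 * real n)" using len by (intro mult_left_mono) auto
        also have "\<dots> = \<theta> * n * (4 * \<theta>)" by (simp add: power2_eq_square)
        also have "\<dots> \<le> \<theta> * n * (\<delta> / 2)" using \<theta> by (intro mult_left_mono) auto
        finally show ?thesis by (simp add: c_def mult.commute mult.left_commute)
      qed
      let ?d = "drift \<beta> (real_of_int (a - i)) (real_of_int (b - j))"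
      let ?G = "\<lambda>h. P.prob {w. exits_left (\<lambda>z. q (w z)) i j a b = h}"
      show ?thesis
      proof (cases "i \<le> a \<and> j \<le> b")
        case True
        consider "?d \<le> - \<delta> * n" "\<not> \<delta> * n \<le> ?d" | "\<delta> * n \<le> ?d" "\<not> ?d \<le> - \<delta> * n"
          | "\<not> \<delta> * n \<le> ?d" "\<not> ?d \<le> - \<delta> * n" | "\<delta> * n \<le> ?d" "?d \<le> - \<delta> * n" by blast
        then show ?thesis
        proof cases
          case 1
          then have "P.prob {w. viol \<delta> n w x} = ?G False" using True by (simp add: viol_def x)
          also have "\<dots> \<le> exp (\<theta> * ?d + \<theta>\<^sup>2 * real_of_int (a - i + (b - j)))"
            unfolding \<beta>_def using True \<theta> by (intro prob_exits_left_le q) auto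
          also have "\<dots> \<le> exp (- c * n)"
            using mult_left_mono[OF 1(1), of \<theta>] \<theta>(1) bound cn
            unfolding exp_le_cancel_iff mult_minus_left mult_minus_right by linarith
          finally show ?thesis .
        next
          case 2
          then have "P.prob {w. viol \<delta> n w x} = ?G True" using True by (simp add: viol_def x)
          also have "\<dots> \<le> exp (- \<theta> * ?d + (- \<theta>)\<^sup>2 * real_of_int (a - i + (b - j)))"
            unfolding \<beta>_def using True \<theta> by (intro prob_exits_left_le q) auto
          also have "\<dots> \<le> exp (- c * n)"
            using mult_left_mono[OF 2(1), of \<theta>] \<theta>(1) bound cn
            unfolding exp_le_cancel_iff mult_minus_left mult_minus_right power2_minus by linarith
          finally show ?thesis .
        next
          case 3
          then show ?thesis by (simp add: viol_def x)
        next
          case 4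
          then have "2 * \<delta> * n \<le> 0" by linarith
          then have "n = 0" using \<delta> by (simp add: mult_le_0_iff)
          then show ?thesis by simp
        qed
      next
        case False
        then have "{w. viol \<delta> n w x} = {}" by (auto simp: viol_def x)
        then show ?thesis by simp
      qed
    qed
    have "P.prob (A \<delta> n) \<le> (2 * real n + 1) ^ 4 * exp (- c * n)" for n
    proof -
      have fin: "finite (idx n)" by (simp add: idx_def)
      have "A \<delta> n = (\<Union>x\<in>idx n. {w. viol \<delta> n w x})" by (auto simp: A_def)
      moreover have "(\<lambda>x. {w. viol \<delta> n w x}) ` idx n \<subseteq> sets P" using viol_sets by blast
      ultimately have "P.prob (A \<delta> n) \<le> (\<Sum>x\<in>idx n. P.prob {w. viol \<delta> n w x})"
        using P.finite_measure_subadditive_finite[of "idx n" "\<lambda>x. {w. viol \<delta> n w x}"] fin by auto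
      also have "\<dots> \<le> (\<Sum>x\<in>idx n. exp (- c * n))" by (intro sum_mono single)
      also have "\<dots> = real (card (idx n)) * exp (- c * n)" by simp
      also have "real (card (idx n)) = (2 * real n + 1) ^ 4"
        by (simp add: idx_def card_cartesian_product card_box power4_eq_xxxx algebra_simps)
      finally show ?thesis .
    qed
    moreover have "summable (\<lambda>n. (2 * real n + 1) ^ 4 * exp (- c * n))"
    proof (rule summable_comparison_test_bigo)
      show "(\<lambda>n. (2 * real n + 1) ^ 4 * exp (- c * n)) \<in> O(\<lambda>n. 1 / real n ^ 2)" using c by real_asymp
      show "summable (\<lambda>n. norm (1 / real n ^ 2))"
        using inverse_power_summable[of 2, where ?'a = real] by (simp add: inverse_eq_divide)
    qed
    ultimately show ?thesis
      by (intro AE_eventually_not[where c = "\<lambda>n. (2 * real n + 1) ^ 4 * exp (- c * n)"] A_sets) auto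
  qed
  \<comment> \<open>Countably many tolerances suffice. A real scale N is rounded up to an integer of
    size at most 2 N, which accounts for the factor 2 in the choice of k.\<close>
  have "AE w in P. \<forall>k::nat. \<forall>\<^sub>F n in sequentially. w \<notin> A (1 / real (Suc k)) n"
    unfolding AE_all_countable using ev by simp
  then show ?thesis
  proof (eventually_elim)
    case (elim w)
    show ?case
      unfolding exit_law_def \<beta>_def[symmetric]
    proof (intro allI impI)
      fix \<delta> :: real assume "\<delta> > 0"
      then obtain k where "inverse (real (Suc k)) < \<delta> / 2" using reals_Archimedean[of "\<delta> / 2"] by auto
      then have k: "2 * (1 / real (Suc k)) \<le> \<delta>" by (simp add: inverse_eq_divide)
      obtain n0 where n0: "\<And>n. n0 \<le> n \<Longrightarrow> w \<notin> A (1 / real (Suc k)) n"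
        using elim unfolding eventually_sequentially by blast
      show "\<exists>N0. \<forall>N\<ge>N0. \<forall>i j a b. i \<le> a \<longrightarrow> j \<le> b \<longrightarrow> norm1 (i, j) \<le> N \<longrightarrow> norm1 (a, b) \<le> N \<longrightarrow>
        (drift \<beta> (real_of_int (a - i)) (real_of_int (b - j)) \<le> - \<delta> * N \<longrightarrow> exits_left (\<lambda>z. q (w z)) i j a b) \<and>
        (\<delta> * N \<le> drift \<beta> (real_of_int (a - i)) (real_of_int (b - j)) \<longrightarrow> \<not> exits_left (\<lambda>z. q (w z)) i j a b)"
      proof (rule exI[of _ "real n0 + 1"], intro allI impI)
        fix N i j a b
        assume N: "real n0 + 1 \<le> N" and le: "i \<le> a" "j \<le> b" and nrm: "norm1 (i, j) \<le> N" "norm1 (a, b) \<le> N"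
        define n where "n = nat \<lceil>N\<rceil>"
        have n: "n0 \<le> n" "N \<le> real n" "real n \<le> 2 * N" using N by (auto simp: n_def) linarith+
        have "((i, j), (a, b)) \<in> idx n"
          using norm1_le_box[of i j n] norm1_le_box[of a b n] nrm n by (auto simp: idx_def)
        then have nv: "\<not> viol (1 / real (Suc k)) n w ((i, j), (a, b))"
          using n0[OF n(1)] by (auto simp: A_def)
        have "1 / real (Suc k) * real n \<le> 1 / real (Suc k) * (2 * N)" using n by (intro mult_left_mono) auto
        also have "\<dots> \<le> \<delta> * N" using mult_right_mono[OF k, of N] N by simp
        finally have le\<delta>: "1 / real (Suc k) * real n \<le> \<delta> * N" .
        have neg: "- \<delta> * N = - (\<delta> * N)" "- (1 / real (Suc k)) * real n = - (1 / real (Suc k) * real n)" by simp_all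
        show "(drift \<beta> (real_of_int (a - i)) (real_of_int (b - j)) \<le> - \<delta> * N \<longrightarrow> exits_left (\<lambda>z. q (w z)) i j a b) \<and>
          (\<delta> * N \<le> drift \<beta> (real_of_int (a - i)) (real_of_int (b - j)) \<longrightarrow> \<not> exits_left (\<lambda>z. q (w z)) i j a b)"
          using nv le le\<delta> unfolding viol_def prod.case neg by (meson neg_le_iff_le order_trans)
      qed
    qed
  qed
qed

end

text \<open>The absolute value makes the weights non-negative at every configuration of the product
  space, so that the deterministic results apply to all of them; it agrees with the model's weight
  when that is non-negative.\<close>

definition hweight :: "bool \<times> real \<Rightarrow> real" where
  "hweight d = (if fst d then \<bar>snd d\<bar> else 0)"

lemma hweight_nonneg [simp]: "0 \<le> hweight d"
  by (simp add: hweight_def)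

lemma hweight_le: "hweight d \<le> \<bar>snd d\<bar>"
  by (simp add: hweight_def)

definition hweights :: "(site \<Rightarrow> bool \<times> real) \<Rightarrow> weights" where
  "hweights w z k = (if k = 1 then hweight (w z) else 0)"

locale site_moment = site_law +
  fixes p :: real
  assumes p: "2 < p" and moment: "integrable D (\<lambda>d. \<bar>snd d\<bar> powr p)"
begin

lemma hweight_measurable [measurable]: "hweight \<in> borel_measurable D"
proof -
  have "hweight \<in> borel_measurable (count_space UNIV \<Otimes>\<^sub>M borel)"
    unfolding hweight_def by measurable
  then show ?thesis by (simp cong: measurable_cong_sets add: sets_D)
qed

lemma snd_measurable [measurable]: "snd \<in> borel_measurable D"
proof -
  have "snd \<in> borel_measurable (count_space UNIV \<Otimes>\<^sub>M (borel :: real measure) :: (bool \<times> real) measure)"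
    by measurable
  then show ?thesis by (simp cong: measurable_cong_sets add: sets_D)
qed

lemma prob_UN_le:
  assumes "finite I" "\<And>i. A i \<in> sets P"
  shows "P.prob (\<Union>i\<in>I. A i) \<le> (\<Sum>i\<in>I. P.prob (A i))"
  using assms by (intro P.finite_measure_subadditive_finite) auto

lemma square_le_powr:
  fixes r :: real
  assumes "0 \<le> r"
  shows "r\<^sup>2 \<le> 1 + r powr p"
proof (cases "r \<le> 1")
  case True
  then have "r\<^sup>2 \<le> 1" using assms by (simp add: power_le_one)
  then show ?thesis by (simp add: add_increasing2)
next
  case False
  then have "r\<^sup>2 = r powr 2" by (simp add: powr_numeral)
  also have "\<dots> \<le> r powr p" using False p by (intro powr_mono) auto
  finally show ?thesis by simp
qed

lemma integrable_hweight_sq: "integrable D (\<lambda>d. (hweight d)\<^sup>2)"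
proof (rule Bochner_Integration.integrable_bound)
  show "integrable D (\<lambda>d. 1 + \<bar>snd d\<bar> powr p)" using moment by simp
  have "(hweight d)\<^sup>2 \<le> 1 + \<bar>snd d\<bar> powr p" for d
    using order_trans[OF power_mono[OF hweight_le hweight_nonneg] square_le_powr[of "\<bar>snd d\<bar>"]] by simp
  then show "AE d in D. norm ((hweight d)\<^sup>2) \<le> norm (1 + \<bar>snd d\<bar> powr p)"
    by (auto intro: order_trans)
qed measurable

lemma integrable_hweight: "integrable D hweight"
  using D.square_integrable_imp_integrable[OF hweight_measurable integrable_hweight_sq] .

definition \<mu> :: real where "\<mu> = (\<integral>d. hweight d \<partial>D)"

lemma \<mu>_nonneg: "0 \<le> \<mu>"
  by (simp add: \<mu>_def)

lemma distr_site: "distr P D (\<lambda>w. w z) = D"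
  unfolding P_def by (rule distr_PiM_component) (auto simp: prob_space_D)

lemma prob_site:
  assumes "A \<in> sets D"
  shows "P.prob {w. w z \<in> A} = D.prob A"
proof -
  have "D.prob A = measure (distr P D (\<lambda>w. w z)) A" by (simp add: distr_site)
  also have "\<dots> = P.prob {w. w z \<in> A}"
    using assms by (subst measure_distr) (auto simp: vimage_def)
  finally show ?thesis by simp
qed

lemma prob_hweight_gt:
  assumes "0 < y"
  shows "P.prob {w. y < hweight (w z)} \<le> (\<integral>d. \<bar>snd d\<bar> powr p \<partial>D) / y powr p"
proof -
  have "P.prob {w. y < hweight (w z)} = D.prob {d. y < hweight d}"
  proof -
    have "{d \<in> space D. y < hweight d} \<in> sets D" by measurable
    then show ?thesis using prob_site[of "{d. y < hweight d}" z] by simp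
  qed
  also have "\<dots> \<le> D.prob {d \<in> space D. y powr p \<le> \<bar>snd d\<bar> powr p}"
  proof (rule D.finite_measure_mono)
    show "{d. y < hweight d} \<subseteq> {d \<in> space D. y powr p \<le> \<bar>snd d\<bar> powr p}"
    proof safe
      fix a b assume "y < hweight (a, b)"
      then have "y \<le> \<bar>b\<bar>" using hweight_le[of "(a, b)"] by simp
      then show "y powr p \<le> \<bar>snd (a, b)\<bar> powr p" using assms p by (simp add: powr_mono2)
    qed simp
  qed measurable
  also have "\<dots> \<le> (\<integral>d. \<bar>snd d\<bar> powr p \<partial>D) / y powr p"
    using assms by (intro integral_Markov_inequality_measure[OF moment, where A = "{}"]) auto
  finally show ?thesis .
qed

definition shell :: "nat \<Rightarrow> site set" where
  "shell n = {z. \<bar>fst z\<bar> + \<bar>snd z\<bar> = int n}"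

lemma shell_subset: "shell n \<subseteq> (\<lambda>(a, s). (a, s * (int n - \<bar>a\<bar>))) ` (box n \<times> {-1, 1})"
proof
  fix z assume z: "z \<in> shell n"
  obtain a b where ab: "z = (a, b)" by fastforce
  have "b = sgn b * \<bar>b\<bar>" by (simp add: sgn_mult_abs)
  then have "b = (if b < 0 then -1 else 1) * (int n - \<bar>a\<bar>)" using z by (auto simp: shell_def ab)
  then show "z \<in> (\<lambda>(a, s). (a, s * (int n - \<bar>a\<bar>))) ` (box n \<times> {-1, 1})"
    using z by (intro image_eqI[of _ _ "(a, if b < 0 then -1 else 1)"]) (auto simp: shell_def ab box_def)
qed

lemma finite_shell: "finite (shell n)"
  by (rule finite_subset[OF shell_subset]) simp

lemma card_shell: "card (shell n) \<le> 2 * (2 * n + 1)"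
proof -
  have "card (shell n) \<le> card (box n \<times> {-1, 1 :: int})"
    by (rule order_trans[OF card_mono[OF _ shell_subset] card_image_le]) auto
  then show ?thesis by (simp add: card_cartesian_product card_box)
qed

text \<open>A shell has O(n) sites, so Markov's inequality bounds the probability of a violation on
  it by a multiple of \<open>real n powr (1 - \<theta> * p)\<close>, which is summable. As p > 2,
  some \<theta> < 1 qualifies, and then all weights in a box of size n are o(n).\<close>

lemma AE_hweight_growth:
  assumes \<theta>: "2 < \<theta> * p"
  shows "AE w in P. \<exists>C\<ge>0. \<forall>z. hweight (w z) \<le> C + norm1 z powr \<theta>"
proof -
  define Mp where "Mp = (\<integral>d. \<bar>snd d\<bar> powr p \<partial>D)"
  have Mp: "0 \<le> Mp" by (simp add: Mp_def)
  define A where "A = (\<lambda>n::nat. {w. 0 < n \<and> (\<exists>z\<in>shell n. real n powr \<theta> < hweight (w z))})"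
  have single: "{w. y < hweight (w z)} \<in> sets P" for y z
  proof -
    have "{w \<in> space P. y < hweight (w z)} \<in> sets P" by measurable
    then show ?thesis by simp
  qed
  have Aeq: "A n = (if 0 < n then (\<Union>z\<in>shell n. {w. real n powr \<theta> < hweight (w z)}) else {})" for n
    by (auto simp: A_def)
  have A_sets: "A n \<in> sets P" for n
    unfolding Aeq using single finite_shell by auto
  have "P.prob (A n) \<le> 6 * Mp * real n powr (1 - \<theta> * p)" for n
  proof (cases "0 < n")
    case True
    have "P.prob (A n) \<le> (\<Sum>z\<in>shell n. P.prob {w. real n powr \<theta> < hweight (w z)})"
      using prob_UN_le[OF finite_shell, of "\<lambda>z. {w. real n powr \<theta> < hweight (w z)}"] single True
      by (simp add: Aeq)
    also have "\<dots> \<le> (\<Sum>z\<in>shell n. Mp / (real n powr \<theta>) powr p)"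
      unfolding Mp_def using True by (intro sum_mono prob_hweight_gt) auto
    also have "\<dots> = real (card (shell n)) * (Mp / (real n powr \<theta>) powr p)" by simp
    also have "\<dots> \<le> (6 * real n) * (Mp / (real n powr \<theta>) powr p)"
    proof (rule mult_right_mono)
      have "card (shell n) \<le> 6 * n" using le_trans[OF card_shell[of n], of "6 * n"] True by simp
      then show "real (card (shell n)) \<le> 6 * real n" by (metis of_nat_le_iff of_nat_mult of_nat_numeral)
    qed (use Mp in auto)
    also have "\<dots> = 6 * Mp * real n powr (1 - \<theta> * p)"
      using True by (simp add: powr_powr powr_diff)
    finally show ?thesis .
  next
    case False
    then show ?thesis using Mp by (simp add: Aeq)
  qed
  moreover have "summable (\<lambda>n. 6 * Mp * real n powr (1 - \<theta> * p))"
    using \<theta> by (intro summable_mult) (simp add: summable_real_powr_iff)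
  ultimately have "AE w in P. \<forall>\<^sub>F n in sequentially. w \<notin> A n"
    by (intro AE_eventually_not[where c = "\<lambda>n. 6 * Mp * real n powr (1 - \<theta> * p)"] A_sets)
  then show ?thesis
  proof eventually_elim
    case (elim w)
    then obtain n0 where n0: "\<And>n. n0 \<le> n \<Longrightarrow> w \<notin> A n" unfolding eventually_sequentially by blast
    define n1 where "n1 = max n0 1"
    \<comment> \<open>Absorbs the finitely many shells on which the bound may fail.\<close>
    define C where "C = (\<Sum>n<n1. \<Sum>z\<in>shell n. hweight (w z))"
    have C: "0 \<le> C" unfolding C_def by (intro sum_nonneg) auto
    have "hweight (w z) \<le> C + norm1 z powr \<theta>" for z
    proof -
      define n where "n = nat (\<bar>fst z\<bar> + \<bar>snd z\<bar>)"
      have zn: "z \<in> shell n" by (simp add: shell_def n_def)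
      have nz: "norm1 z = real n" by (simp add: norm1_def n_def)
      show ?thesis
      proof (cases "n < n1")
        case True
        have "hweight (w z) \<le> (\<Sum>z\<in>shell n. hweight (w z))"
          using zn finite_shell by (intro member_le_sum) auto
        also have "\<dots> \<le> C" unfolding C_def using True by (intro member_le_sum) (auto intro: sum_nonneg)
        finally show ?thesis by (simp add: add_increasing2)
      next
        case False
        then have "w \<notin> A n" "0 < n" using n0 by (auto simp: n1_def)
        then have "hweight (w z) \<le> real n powr \<theta>" using zn by (auto simp: A_def not_less)
        then show ?thesis using C nz by simp
      qed
    qed
    then show ?case using C by blast
  qed
qed

text \<open>After division by the truncation level the summands lie in [0, 1], where exp x \<le> 1 +
  2 x; resampling one site after another, each contributes a factor of at most exp(2 \<mu> /
  B).\<close>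

lemma truncated_row_mgf:
  assumes B: "0 < B"
  shows "(\<integral>\<^sup>+w. ennreal (exp (\<Sum>l=1..m. min (hweight (w (i + int l, j))) B / B)) \<partial>P)
           \<le> ennreal (exp (2 * \<mu> / B * m))"
proof (induction m)
  case 0
  show ?case using P.emeasure_space_1 by simp
next
  case (Suc m)
  let ?z = "(i + int (Suc m), j)"
  let ?G = "\<lambda>m w. ennreal (exp (\<Sum>l=1..m. min (hweight (w (i + int l, j))) B / B))"
  have meas [measurable]: "?G m \<in> borel_measurable P" for m by measurable
  have "(\<integral>\<^sup>+w. ?G (Suc m) w \<partial>P) = (\<integral>\<^sup>+w. \<integral>\<^sup>+d. ?G (Suc m) (w(?z := d)) \<partial>D \<partial>P)"
    by (rule nn_integral_resample) measurable
  also have "\<dots> = (\<integral>\<^sup>+w. \<integral>\<^sup>+d. ?G m w * ennreal (exp (min (hweight d) B / B)) \<partial>D \<partial>P)"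
  proof (intro nn_integral_cong)
    fix w :: "site \<Rightarrow> bool \<times> real" and d
    have "(\<Sum>l=1..m. min (hweight ((w(?z := d)) (i + int l, j))) B / B)
        = (\<Sum>l=1..m. min (hweight (w (i + int l, j))) B / B)"
      by (intro sum.cong) auto
    then show "?G (Suc m) (w(?z := d)) = ?G m w * ennreal (exp (min (hweight d) B / B))"
      by (simp add: exp_add flip: ennreal_mult)
  qed
  also have "\<dots> = (\<integral>\<^sup>+w. ?G m w * (\<integral>\<^sup>+d. ennreal (exp (min (hweight d) B / B)) \<partial>D) \<partial>P)"
    by (intro nn_integral_cong nn_integral_cmult) measurable
  also have "\<dots> = (\<integral>\<^sup>+w. ?G m w \<partial>P) * (\<integral>\<^sup>+d. ennreal (exp (min (hweight d) B / B)) \<partial>D)"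
    by (rule nn_integral_multc) measurable
  also have "\<dots> \<le> ennreal (exp (2 * \<mu> / B * m)) * ennreal (exp (2 * \<mu> / B))"
  proof (intro mult_mono Suc.IH)
    have "(\<integral>\<^sup>+d. ennreal (exp (min (hweight d) B / B)) \<partial>D) \<le> (\<integral>\<^sup>+d. ennreal (1 + 2 / B * hweight d) \<partial>D)"
    proof (intro nn_integral_mono ennreal_leI)
      fix d
      define x where "x = min (hweight d) B / B"
      have x: "0 \<le> x" "x \<le> 1" using B by (auto simp: x_def field_simps)
      then have "x\<^sup>2 \<le> x" by (simp add: power2_eq_square mult_left_le)
      then have "exp x \<le> 1 + 2 * x" using exp_le_quadratic[of x] x by simp
      also have "\<dots> \<le> 1 + 2 / B * hweight d" using B by (simp add: x_def divide_right_mono)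
      finally show "exp (min (hweight d) B / B) \<le> 1 + 2 / B * hweight d" by (simp add: x_def)
    qed
    also have "\<dots> = ennreal (\<integral>d. 1 + 2 / B * hweight d \<partial>D)"
      using integrable_hweight B by (intro nn_integral_eq_integral) auto
    also have "(\<integral>d. 1 + 2 / B * hweight d \<partial>D) = 1 + 2 / B * \<mu>"
      using integrable_hweight D.prob_space by (simp add: \<mu>_def)
    also have "\<dots> \<le> exp (2 * \<mu> / B)" using exp_ge_add_one_self[of "2 * \<mu> / B"] by simp
    finally show "(\<integral>\<^sup>+d. ennreal (exp (min (hweight d) B / B)) \<partial>D) \<le> ennreal (exp (2 * \<mu> / B))"
      by (simp add: ennreal_leI)
  qed auto
  also have "\<dots> = ennreal (exp (2 * \<mu> / B * Suc m))"
    by (simp add: algebra_simps add_divide_distrib flip: ennreal_mult exp_add)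
  finally show ?case .
qed

lemma prob_truncated_row_gt:
  assumes B: "0 < B"
  shows "P.prob {w. y < (\<Sum>l=1..m. min (hweight (w (i + int l, j))) B)} \<le> exp ((2 * \<mu> * m - y) / B)"
proof -
  let ?Z = "\<lambda>w. (\<Sum>l=1..m. min (hweight (w (i + int l, j))) B)"
  have [measurable]: "?Z \<in> borel_measurable P" by measurable
  have "{w \<in> space P. y < ?Z w} \<in> sets P" by measurable
  then have set: "{w. y < ?Z w} \<in> sets P" by simp
  have "ennreal (P.prob {w. y < ?Z w}) = (\<integral>\<^sup>+w. indicator {w. y < ?Z w} w \<partial>P)"
    using set by (simp add: P.emeasure_eq_measure[symmetric])
  also have "\<dots> \<le> (\<integral>\<^sup>+w. ennreal (exp (- y / B)) * ennreal (exp (\<Sum>l=1..m. min (hweight (w (i + int l, j))) B / B)) \<partial>P)"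
  proof (intro nn_integral_mono)
    fix w
    have "1 \<le> exp (- y / B) * exp (?Z w / B)" if "y < ?Z w"
      using that B by (simp add: divide_right_mono flip: exp_add diff_divide_distrib)
    then show "indicator {w. y < ?Z w} w
       \<le> ennreal (exp (- y / B)) * ennreal (exp (\<Sum>l=1..m. min (hweight (w (i + int l, j))) B / B))"
      by (auto simp: indicator_def sum_divide_distrib simp flip: ennreal_mult)
  qed
  also have "\<dots> \<le> ennreal (exp (- y / B)) * ennreal (exp (2 * \<mu> / B * m))"
    using truncated_row_mgf[OF B, where m = m and i = i and j = j]
    by (subst nn_integral_cmult) (auto intro!: mult_left_mono)
  also have "\<dots> = ennreal (exp ((2 * \<mu> * m - y) / B))"
    by (simp add: diff_divide_distrib flip: ennreal_mult exp_add)
  finally show ?thesis by (simp add: ennreal_le_iff)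
qed

text \<open>By \<open>AE_hweight_growth\<close>, truncation at n^\<theta>' eventually changes
  nothing in the box. The truncated sums have tails exp(-(\<delta> / 2) n^(1 - \<theta>')), small
  enough for a union over all starting points.\<close>

theorem AE_row_law: "AE w in P. row_law (hweights w)"
proof -
  define \<theta> where "\<theta> = (2 / p + 1) / 2"
  have \<theta>: "2 < \<theta> * p" "0 < \<theta>" "\<theta> < 1" using p by (auto simp: \<theta>_def field_simps)
  define \<theta>' where "\<theta>' = (\<theta> + 1) / 2"
  have \<theta>': "\<theta> < \<theta>'" "\<theta>' < 1" "0 < \<theta>'" using \<theta> by (auto simp: \<theta>'_def)
  \<comment> \<open>Twice the mean of a stretch of \<kappa> n weights is then at most \<delta> n /
    2.\<close>
  define \<kappa> where "\<kappa> = (\<lambda>\<delta>::real. min 1 (\<delta> / (4 * (\<mu> + 1))))"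
  have \<kappa>: "0 < \<kappa> \<delta>" "\<kappa> \<delta> \<le> 1" "2 * \<mu> * \<kappa> \<delta> \<le> \<delta> / 2" if "0 < \<delta>" for \<delta>
  proof -
    show "0 < \<kappa> \<delta>" "\<kappa> \<delta> \<le> 1" using that \<mu>_nonneg by (auto simp: \<kappa>_def)
    have "2 * \<mu> * \<kappa> \<delta> \<le> 2 * \<mu> * (\<delta> / (4 * (\<mu> + 1)))"
      using \<mu>_nonneg by (intro mult_left_mono) (auto simp: \<kappa>_def)
    also have "\<dots> \<le> \<delta> / 2" using \<mu>_nonneg that by (simp add: field_simps)
    finally show "2 * \<mu> * \<kappa> \<delta> \<le> \<delta> / 2" .
  qed
  define Z where "Z = (\<lambda>\<delta> (n::nat) (i, j :: int) w. \<Sum>l=1..nat \<lfloor>\<kappa> \<delta> * n\<rfloor>. min (hweight (w (i + int l, j))) (real n powr \<theta>'))"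
  define A where "A = (\<lambda>\<delta> n. {w. 0 < n \<and> (\<exists>z\<in>box n \<times> box n. \<delta> * real n < Z \<delta> n z w)})"
  have single: "{w. y < Z \<delta> n z w} \<in> sets P" for y \<delta> n z
  proof -
    obtain i j where z: "z = (i, j)" by fastforce
    have "{w \<in> space P. y < (\<Sum>l=1..nat \<lfloor>\<kappa> \<delta> * n\<rfloor>. min (hweight (w (i + int l, j))) (real n powr \<theta>'))} \<in> sets P"
      by measurable
    then have "{w \<in> space P. y < Z \<delta> n z w} \<in> sets P" unfolding Z_def z prod.case .
    then show ?thesis by simp
  qed
  have Aeq: "A \<delta> n = (if 0 < n then (\<Union>z\<in>box n \<times> box n. {w. \<delta> * real n < Z \<delta> n z w}) else {})" for \<delta> n
    by (auto simp: A_def)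
  have A_sets: "A \<delta> n \<in> sets P" for \<delta> n
    unfolding Aeq using single by (auto intro!: sets.finite_UN)
  have ev: "AE w in P. \<forall>\<^sub>F n in sequentially. w \<notin> A \<delta> n" if \<delta>: "0 < \<delta>" for \<delta>
  proof -
    have "P.prob (A \<delta> n) \<le> (2 * real n + 1) ^ 2 * exp (- (\<delta> / 2) * real n powr (1 - \<theta>'))" for n
    proof (cases "0 < n")
      case True
      have one: "P.prob {w. \<delta> * real n < Z \<delta> n z w} \<le> exp (- (\<delta> / 2) * real n powr (1 - \<theta>'))" for z
      proof -
        obtain i j where z: "z = (i, j)" by fastforce
        let ?m = "nat \<lfloor>\<kappa> \<delta> * n\<rfloor>"
        have "P.prob {w. \<delta> * real n < Z \<delta> n z w} \<le> exp ((2 * \<mu> * ?m - \<delta> * real n) / real n powr \<theta>')"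
          unfolding z Z_def prod.case using True by (intro prob_truncated_row_gt) auto
        also have "\<dots> \<le> exp (- (\<delta> / 2) * (real n / real n powr \<theta>'))"
        proof -
          have "real ?m \<le> \<kappa> \<delta> * n" using \<kappa>(1)[OF \<delta>] by simp
          then have "2 * \<mu> * ?m \<le> 2 * \<mu> * (\<kappa> \<delta> * n)" using \<mu>_nonneg by (intro mult_left_mono) auto
          also have "\<dots> \<le> \<delta> / 2 * n" using mult_right_mono[OF \<kappa>(3)[OF \<delta>], of "real n"] by simp
          finally have "2 * \<mu> * ?m - \<delta> * real n \<le> - (\<delta> / 2) * n" by (simp add: field_simps)
          then have "(2 * \<mu> * ?m - \<delta> * real n) / real n powr \<theta>' \<le> - (\<delta> / 2) * n / real n powr \<theta>'"
            by (intro divide_right_mono) auto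
          then show ?thesis by simp
        qed
        also have "real n / real n powr \<theta>' = real n powr (1 - \<theta>')"
          using True by (simp add: powr_diff)
        finally show ?thesis .
      qed
      have "P.prob (A \<delta> n) \<le> (\<Sum>z\<in>box n \<times> box n. P.prob {w. \<delta> * real n < Z \<delta> n z w})"
        using prob_UN_le[of "box n \<times> box n" "\<lambda>z. {w. \<delta> * real n < Z \<delta> n z w}"] single True
        by (simp add: Aeq)
      also have "\<dots> \<le> (\<Sum>z\<in>box n \<times> box n. exp (- (\<delta> / 2) * real n powr (1 - \<theta>')))"
        by (intro sum_mono one)
      also have "\<dots> = (2 * real n + 1) ^ 2 * exp (- (\<delta> / 2) * real n powr (1 - \<theta>'))"
        by (simp add: card_cartesian_product card_box power2_eq_square algebra_simps)
      finally show ?thesis .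
    next
      case False
      then show ?thesis by (simp add: Aeq)
    qed
    moreover have "summable (\<lambda>n. (2 * real n + 1) ^ 2 * exp (- (\<delta> / 2) * real n powr (1 - \<theta>')))"
    proof (rule summable_comparison_test_bigo)
      have "0 < \<delta> / 2" "0 < 1 - \<theta>'" using \<delta> \<theta>' by auto
      then show "(\<lambda>n. (2 * real n + 1) ^ 2 * exp (- (\<delta> / 2) * real n powr (1 - \<theta>'))) \<in> O(\<lambda>n. 1 / real n ^ 2)"
        by real_asymp
      show "summable (\<lambda>n. norm (1 / real n ^ 2))"
        using inverse_power_summable[of 2, where ?'a = real] by (simp add: inverse_eq_divide)
    qed
    ultimately show ?thesis
      by (intro AE_eventually_not[where c = "\<lambda>n. (2 * real n + 1) ^ 2 * exp (- (\<delta> / 2) * real n powr (1 - \<theta>'))"] A_sets)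
  qed
  have "AE w in P. \<forall>k::nat. \<forall>\<^sub>F n in sequentially. w \<notin> A (1 / real (Suc k)) n"
    unfolding AE_all_countable using ev by simp
  then show ?thesis using AE_hweight_growth[OF \<theta>(1)]
  proof eventually_elim
    case (elim w)
    obtain C where C: "0 \<le> C" "\<And>z. hweight (w z) \<le> C + norm1 z powr \<theta>" using elim by blast
    show ?case
      unfolding row_law_def
    proof (intro allI impI)
      fix \<delta> :: real assume "\<delta> > 0"
      then obtain k where "inverse (real (Suc k)) < \<delta> / 2" using reals_Archimedean[of "\<delta> / 2"] by auto
      define \<epsilon> where "\<epsilon> = 1 / real (Suc k)"
      have \<epsilon>: "0 < \<epsilon>" "2 * \<epsilon> \<le> \<delta>" using \<open>inverse (real (Suc k)) < \<delta> / 2\<close> by (auto simp: \<epsilon>_def inverse_eq_divide)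
      obtain n0 where n0: "\<And>n. n0 \<le> n \<Longrightarrow> w \<notin> A \<epsilon> n"
        using elim unfolding eventually_sequentially \<epsilon>_def by blast
      have "eventually (\<lambda>N::real. C + (2 * N) powr \<theta> \<le> N powr \<theta>') at_top"
        using \<theta> \<theta>' by real_asymp
      then obtain N1 where N1: "\<And>N. N1 \<le> N \<Longrightarrow> C + (2 * N) powr \<theta> \<le> N powr \<theta>'"
        unfolding eventually_at_top_linorder by blast
      show "\<exists>\<kappa>>0. \<exists>N0. \<forall>N\<ge>N0. \<forall>i j. \<forall>m::nat. norm1 (i, j) \<le> N \<longrightarrow> real m \<le> \<kappa> * N \<longrightarrow>
         (\<Sum>l=1..m. hweights w (i + int l, j) 1) \<le> \<delta> * N"
      proof (rule exI[of _ "\<kappa> \<epsilon>"], intro conjI exI[of _ "max (real n0 + 1) N1"] allI impI)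
        show "0 < \<kappa> \<epsilon>" using \<kappa>(1)[OF \<epsilon>(1)] .
        fix N i j and m :: nat
        assume N: "max (real n0 + 1) N1 \<le> N" and nrm: "norm1 (i, j) \<le> N" and m: "real m \<le> \<kappa> \<epsilon> * N"
        define n where "n = nat \<lceil>N\<rceil>"
        have n: "n0 \<le> n" "N \<le> real n" "real n \<le> 2 * N" "0 < n" using N by (auto simp: n_def) linarith+
        have "\<kappa> \<epsilon> * N \<le> 1 * N" using \<kappa>(2)[OF \<epsilon>(1)] N by (intro mult_right_mono) auto
        then have mN: "real m \<le> N" using m by simp
        have small: "hweight (w (i + int l, j)) \<le> real n powr \<theta>'" if "l \<in> {1..m}" for l
        proof -
          have "norm1 (i + int l, j) \<le> norm1 (i, j) + real l" by (simp add: norm1_def)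
          then have "norm1 (i + int l, j) \<le> 2 * N" using that nrm mN by simp
          then have "norm1 (i + int l, j) powr \<theta> \<le> (2 * N) powr \<theta>" using \<theta> by (intro powr_mono2) auto
          then have "hweight (w (i + int l, j)) \<le> C + (2 * N) powr \<theta>"
            using C(2)[of "(i + int l, j)"] by linarith
          also have "\<dots> \<le> N powr \<theta>'" using N1 N by simp
          also have "\<dots> \<le> real n powr \<theta>'" using n N \<theta>' by (intro powr_mono2) auto
          finally show ?thesis .
        qed
        have "(i, j) \<in> box n \<times> box n" using norm1_le_box[of i j n] nrm n by auto
        then have "Z \<epsilon> n (i, j) w \<le> \<epsilon> * real n" using n0[OF n(1)] n(4) unfolding A_def by force
        moreover have "(\<Sum>l=1..m. hweights w (i + int l, j) 1) \<le> Z \<epsilon> n (i, j) w"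
        proof -
          have "(\<Sum>l=1..m. hweights w (i + int l, j) 1) = (\<Sum>l=1..m. min (hweight (w (i + int l, j))) (real n powr \<theta>'))"
            using small by (intro sum.cong) (auto simp: hweights_def)
          also have "\<dots> \<le> Z \<epsilon> n (i, j) w"
          proof -
            have "real m \<le> \<kappa> \<epsilon> * n" using m mult_left_mono[OF n(2), of "\<kappa> \<epsilon>"] \<kappa>(1)[OF \<epsilon>(1)] by linarith
            then have "m \<le> nat \<lfloor>\<kappa> \<epsilon> * n\<rfloor>" by (simp add: le_nat_floor)
            then show ?thesis unfolding Z_def prod.case by (intro sum_mono2) auto
          qed
          finally show ?thesis .
        qed
        moreover have "\<epsilon> * real n \<le> \<delta> * N"
        proof -
          have "\<epsilon> * real n \<le> \<epsilon> * (2 * N)" using \<epsilon> n by (intro mult_left_mono) auto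
          also have "\<dots> \<le> \<delta> * N" using mult_right_mono[OF \<epsilon>(2), of N] N by simp
          finally show ?thesis .
        qed
        ultimately show "(\<Sum>l=1..m. hweights w (i + int l, j) 1) \<le> \<delta> * N" by linarith
      qed
    qed
  qed
qed

end

section \<open>Strict monotonicity of the slope\<close>

text \<open>Models the mean of \<open>F\<close> as a function of the displacement. In
  \<open>m_jump\<close> the cost C is fixed before k: long jumps may be rare, but they are never
  expensive.\<close>

locale mean_profile =
  fixes m :: "nat \<Rightarrow> nat \<Rightarrow> real" and \<alpha> \<mu> :: real
  assumes \<alpha>: "0 < \<alpha>" "\<alpha> < 1" and \<mu>: "0 \<le> \<mu>"
    and m_nonneg: "0 \<le> m a b"
    and m_subadd: "m (a + c) (b + d) \<le> m a b + m c d"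
    and m_col: "m 0 b = 0" and m_row: "m a 0 \<le> \<mu> * a"
    and m_step: "m (Suc a) (Suc b) \<le> (1 - \<alpha>) * m a (Suc b) + \<alpha> * m (Suc a) b"
    and m_jump: "\<exists>C. \<forall>k. \<exists>\<kappa>>0. \<kappa> \<le> \<alpha> \<and> (\<forall>a b. Suc k \<le> a \<longrightarrow>
        m a (Suc b) \<le> (1 - \<alpha>) * m (a - 1) (Suc b) + (\<alpha> - \<kappa>) * m a b + \<kappa> * (m (a - Suc k) b + C))"
begin

text \<open>The exponential is again a supersolution. The prefactor comes from the bottom row, where
  x \<le> exp x with x = \<alpha> \<theta> a.\<close>

lemma m_le_exp:
  assumes \<theta>: "0 < \<theta>" "\<theta> \<le> 1"
  shows "m a b \<le> \<mu> / (\<alpha> * \<theta>) * exp (\<theta> * drift \<alpha> a b + \<theta>\<^sup>2 * (a + b))"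
proof (induction "a + b" arbitrary: a b)
  case 0
  then show ?case using m_col[of 0] \<mu> \<alpha> \<theta> by simp
next
  case (Suc n)
  let ?K = "\<mu> / (\<alpha> * \<theta>)"
  have K: "0 \<le> ?K" using \<mu> \<alpha> \<theta> by simp
  let ?E = "\<lambda>a b. exp (\<theta> * drift \<alpha> (real a) (real b) + \<theta>\<^sup>2 * real (a + b))"
  consider "a = 0" | "b = 0" | a' b' where "a = Suc a'" "b = Suc b'" by (cases a; cases b) auto
  then show ?case
  proof cases
    case 1
    have "0 \<le> ?K * exp (\<theta> * drift \<alpha> (real a) (real b) + \<theta>\<^sup>2 * real (a + b))"
      using K by (intro mult_nonneg_nonneg) auto
    then show ?thesis unfolding 1 m_col .
  next
    case 2
    have "m a 0 \<le> ?K * (\<alpha> * \<theta> * a)" using m_row[of a] \<alpha> \<theta> by simp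
    also have "\<dots> \<le> ?K * ?E a 0"
    proof (rule mult_left_mono[OF _ K])
      have "\<alpha> * \<theta> * a \<le> exp (\<alpha> * \<theta> * a)" using exp_ge_add_one_self[of "\<alpha> * \<theta> * a"] by linarith
      also have "\<dots> = exp (\<theta> * drift \<alpha> (real a) (real 0))" by (simp add: drift_def ac_simps)
      also have "\<dots> \<le> ?E a 0" by simp
      finally show "\<alpha> * \<theta> * a \<le> ?E a 0" .
    qed
    finally show ?thesis using 2 by simp
  next
    case 3
    have IH: "m a' (Suc b') \<le> ?K * ?E a' (Suc b')" "m (Suc a') b' \<le> ?K * ?E (Suc a') b'"
      using Suc(1)[of a' "Suc b'"] Suc(1)[of "Suc a'" b'] Suc(2) 3 by auto
    have E1: "?E (Suc a') b' = ?E a b * exp (- \<theta>\<^sup>2) * exp (\<theta> * (1 - \<alpha>))"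
      by (simp add: 3 drift_def algebra_simps flip: exp_add)
    have E2: "?E a' (Suc b') = ?E a b * exp (- \<theta>\<^sup>2) * exp (- \<theta> * \<alpha>)"
      by (simp add: 3 drift_def algebra_simps flip: exp_add)
    have "m a b \<le> (1 - \<alpha>) * m a' (Suc b') + \<alpha> * m (Suc a') b'"
      using m_step 3 by simp
    also have "\<dots> \<le> (1 - \<alpha>) * (?K * ?E a' (Suc b')) + \<alpha> * (?K * ?E (Suc a') b')"
      using IH \<alpha> by (intro add_mono mult_left_mono) auto
    also have "\<dots> = ?K * (?E a b * exp (- \<theta>\<^sup>2) * (\<alpha> * exp (\<theta> * (1 - \<alpha>)) + (1 - \<alpha>) * exp (- \<theta> * \<alpha>)))"
      unfolding E1 E2 by (simp only: algebra_simps)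
    also have "\<dots> \<le> ?K * (?E a b * exp (- \<theta>\<^sup>2) * exp (\<theta>\<^sup>2))"
      using bernoulli_mgf_le[of \<theta> \<alpha>] \<theta> \<alpha> by (intro mult_left_mono[OF _ K] mult_left_mono) auto
    also have "\<dots> = ?K * ?E a b" by (simp flip: exp_add)
    finally show ?thesis by simp
  qed
qed

text \<open>Where the drift is not positive, \<theta> = 1 / sqrt (a + b + 1) yields order sqrt (a +
  b); the form with \<delta> suits comparison with linear terms.\<close>

lemma m_sublinear:
  assumes "drift \<alpha> a b \<le> 0" "0 < \<delta>"
  shows "m a b \<le> \<delta> * (a + b + 1) + (\<mu> * exp 1 / \<alpha>)\<^sup>2 / \<delta>"
proof -
  define x where "x = sqrt (a + b + 1)"
  have x: "1 \<le> x" "x\<^sup>2 = a + b + 1" by (auto simp: x_def)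
  define K where "K = \<mu> * exp 1 / \<alpha>"
  have K: "0 \<le> K" using \<mu> \<alpha> by (simp add: K_def)
  have "m a b \<le> \<mu> / (\<alpha> * (1 / x)) * exp (1 / x * drift \<alpha> a b + (1 / x)\<^sup>2 * (a + b))"
    using x by (intro m_le_exp) auto
  also have "\<dots> \<le> \<mu> / (\<alpha> * (1 / x)) * exp 1"
  proof (intro mult_left_mono)
    have "(1 / x)\<^sup>2 * (a + b) \<le> 1" using x by (simp add: power_divide field_simps)
    moreover have "1 / x * drift \<alpha> a b \<le> 0" using assms x by (intro mult_nonneg_nonpos) auto
    ultimately show "exp (1 / x * drift \<alpha> a b + (1 / x)\<^sup>2 * (a + b)) \<le> exp 1" by simp
  qed (use \<mu> \<alpha> x in auto)
  also have "\<dots> = K * x" by (simp add: K_def)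
  also have "\<dots> \<le> \<delta> * x\<^sup>2 + K\<^sup>2 / \<delta>"
  proof -
    have "0 \<le> (\<delta> * x - K)\<^sup>2 + \<delta> * K * x" using assms K x by simp
    then have "\<delta> * (K * x) \<le> \<delta> * (\<delta> * x\<^sup>2 + K\<^sup>2 / \<delta>)"
      using assms by (simp add: power2_eq_square algebra_simps)
    then show ?thesis using assms by simp
  qed
  finally show ?thesis using x by (simp add: K_def add_ac)
qed

lemma m_mult: "m (u * a) (u * b) \<le> u * m a b"
proof (induction u)
  case 0
  show ?case using m_col by simp
next
  case (Suc u)
  then show ?case using m_subadd[of a "u * a" b "u * b"] by (simp add: algebra_simps)
qed

text \<open>Fekete's argument: j is u blocks of a length n whose mean is near the infimum, plus a
  remainder absorbed by C.\<close>

lemma m_ray_upper: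
  fixes g \<delta> :: real
  assumes g: "\<And>g'. g < g' \<Longrightarrow> \<exists>n>0. m (n * a) (n * b) \<le> n * g'" and \<delta>: "0 < \<delta>"
  shows "\<exists>C. \<forall>j. m (j * a) (j * b) \<le> j * (g + \<delta>) + C"
proof -
  obtain n where n: "0 < n" "m (n * a) (n * b) \<le> n * (g + \<delta>)" using g[of "g + \<delta>"] \<delta> by auto
  define C where "C = (\<Sum>r<n. m (r * a) (r * b) + \<bar>r * (g + \<delta>)\<bar>)"
  have "m (j * a) (j * b) \<le> j * (g + \<delta>) + C" for j
  proof -
    define u r where "u = j div n" and "r = j mod n"
    have j: "j = u * n + r" by (simp add: u_def r_def)
    have r: "r < n" using n by (simp add: r_def)
    have "m (j * a) (j * b) \<le> m (u * (n * a)) (u * (n * b)) + m (r * a) (r * b)"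
      using m_subadd[of "u * (n * a)" "r * a" "u * (n * b)" "r * b"] by (simp add: j algebra_simps)
    also have "\<dots> \<le> u * (n * (g + \<delta>)) + m (r * a) (r * b)"
      using m_mult[of u "n * a" "n * b"] mult_left_mono[OF n(2), of "real u"] by simp
    also have "\<dots> = j * (g + \<delta>) - r * (g + \<delta>) + m (r * a) (r * b)"
      by (simp add: j algebra_simps)
    also have "\<dots> \<le> j * (g + \<delta>) + (m (r * a) (r * b) + \<bar>r * (g + \<delta>)\<bar>)"
      by linarith
    also have "\<dots> \<le> j * (g + \<delta>) + C"
      unfolding C_def using r m_nonneg by (intro add_left_mono member_le_sum) auto
    finally show ?thesis .
  qed
  then show ?thesis by blast
qed

text \<open>The recursion averages earlier values with total weight 1 and subtracts c. One round
  moves at most k to the left and 1 down, so n rounds stay in a box of sides k n and n, and each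
  lowers the bound by c.\<close>

lemma descent:
  fixes e :: "nat \<Rightarrow> nat \<Rightarrow> real"
  assumes rec: "\<And>a b. k \<le> a \<Longrightarrow> e a (Suc b) \<le> (1 - \<alpha>) * e (a - 1) (Suc b) + (\<alpha> - \<kappa>) * e a b + \<kappa> * e (a - k) b - c"
    and \<kappa>: "0 \<le> \<kappa>" "\<kappa> \<le> \<alpha>" and k: "0 < k"
    and le: "k * n \<le> a" "n \<le> b"
    and bd: "\<And>a' b'. a - k * n \<le> a' \<Longrightarrow> a' \<le> a \<Longrightarrow> b - n \<le> b' \<Longrightarrow> b' \<le> b \<Longrightarrow> e a' b' \<le> B"
  shows "e a b \<le> B - c * n"
  using le bd
proof (induction n arbitrary: a b)
  case 0
  then show ?case by simp
next
  case (Suc n)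
  obtain b' where b: "b = Suc b'" using Suc.prems(2) by (cases b) auto
  have ka: "k \<le> a" using Suc.prems(1) by simp
  have 1: "e (a - 1) b \<le> B - c * n"
    using Suc.prems k by (intro Suc.IH) auto
  have 2: "e a b' \<le> B - c * n"
    using Suc.prems k b by (intro Suc.IH) auto
  have 3: "e (a - k) b' \<le> B - c * n"
    using Suc.prems k b by (intro Suc.IH) auto
  have "e a b \<le> (1 - \<alpha>) * e (a - 1) b + (\<alpha> - \<kappa>) * e a b' + \<kappa> * e (a - k) b' - c"
    using rec[OF ka, of b'] b by simp
  also have "\<dots> \<le> (1 - \<alpha>) * (B - c * n) + (\<alpha> - \<kappa>) * (B - c * n) + \<kappa> * (B - c * n) - c"
    using 1 2 3 \<kappa> \<alpha> by (intro diff_right_mono add_mono mult_left_mono) auto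
  also have "\<dots> = B - c * Suc n" by (simp add: algebra_simps)
  finally show ?case .
qed

text \<open>If the slope \<open>g / drift\<close> were the same in both directions, the profile would be affine on the
  cone between \<open>(1 - \<alpha>, \<alpha>)\<close> and \<open>(P', Q')\<close>, but the jumps of \<open>m_jump\<close> make it strictly smaller.\<close>

theorem strict_slope:
  assumes PQ: "0 < Q" "P * Q' < P' * Q" and D1: "0 < drift \<alpha> P Q"
    and c0: "0 < c0" "\<And>n. n * c0 \<le> m (n * P') (n * Q')"
  shows "\<exists>s>0. \<exists>c>0. (\<exists>n0. \<forall>n\<ge>n0. m (n * P) (n * Q) \<le> n * (s * drift \<alpha> P Q - c)) \<and>
           (\<forall>n. n * (s * drift \<alpha> P' Q') \<le> m (n * P') (n * Q'))"
proof -
  define d1 d2 where "d1 = drift \<alpha> P Q" and "d2 = drift \<alpha> P' Q'"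
  have d1: "0 < d1" using D1 by (simp add: d1_def)
  have PQ': "real P * Q' < real P' * Q" using PQ(2) by (metis of_nat_less_iff of_nat_mult)
  have "0 < d2"
  proof -
    have "(1 - \<alpha>) * Q < \<alpha> * P" using d1 by (simp add: d1_def drift_def)
    then have "(1 - \<alpha>) * Q * Q' \<le> \<alpha> * P * Q'" by (intro mult_right_mono) auto
    also have "\<dots> < \<alpha> * (P' * Q)" using mult_strict_left_mono[OF PQ' \<alpha>(1)] by simp
    finally have "((1 - \<alpha>) * Q') * Q < (\<alpha> * P') * Q" by (simp add: mult.commute mult.left_commute)
    then have "(1 - \<alpha>) * Q' < \<alpha> * P'" using PQ(1) by simp
    then show ?thesis by (simp add: d2_def drift_def)
  qed
  then have d2: "0 < d2" .
  \<comment> \<open>The time constant in direction \<open>(P', Q')\<close>, written as an infimum by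
    subadditivity; s is its value per unit of drift.\<close>
  define g where "g = Inf ((\<lambda>n. m (n * P') (n * Q') / n) ` {1..})"
  have bdd: "bdd_below ((\<lambda>n::nat. m (n * P') (n * Q') / n) ` {1..})"
    using m_nonneg by (intro bdd_belowI2[of _ 0]) auto
  have g_le: "n * g \<le> m (n * P') (n * Q')" for n
  proof (cases "n = 0")
    case False
    then have "g \<le> m (n * P') (n * Q') / n" unfolding g_def using bdd by (intro cInf_lower) auto
    then show ?thesis using False by (simp add: field_simps)
  qed (use m_nonneg in auto)
  have "c0 \<le> g" unfolding g_def
  proof (rule cInf_greatest)
    fix x assume "x \<in> (\<lambda>n::nat. m (n * P') (n * Q') / n) ` {1..}"
    then obtain n :: nat where "1 \<le> n" "x = m (n * P') (n * Q') / n" by auto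
    then show "c0 \<le> x" using c0(2)[of n] by (simp add: pos_le_divide_eq mult.commute)
  qed simp
  then have g: "0 < g" using c0 by simp
  have g_inf: "\<exists>n>0. m (n * P') (n * Q') \<le> n * g'" if "g < g'" for g'
  proof -
    have "\<exists>x\<in>(\<lambda>n::nat. m (n * P') (n * Q') / n) ` {1..}. x < g'"
      using that unfolding g_def by (intro cInf_lessD) auto
    then obtain n :: nat where "n \<in> {1..}" "m (n * P') (n * Q') / n < g'" by blast
    then show ?thesis by (intro exI[of _ n]) (auto simp: field_simps)
  qed
  define s where "s = g / d2"
  have s: "0 < s" "s * d2 = g" using g d2 by (auto simp: s_def)
  obtain C where C: "\<And>k. \<exists>\<kappa>>0. \<kappa> \<le> \<alpha> \<and> (\<forall>a b. Suc k \<le> a \<longrightarrow>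
        m a (Suc b) \<le> (1 - \<alpha>) * m (a - 1) (Suc b) + (\<alpha> - \<kappa>) * m a b + \<kappa> * (m (a - Suc k) b + C))"
    using m_jump by blast
  \<comment> \<open>A jump over k columns lowers the linear profile by s \<alpha> k and costs at
    most C, so k is taken large enough to pay off.\<close>
  obtain k0 :: nat where k0: "C / (s * \<alpha>) < k0" using reals_Archimedean2 by blast
  define k where "k = Suc k0"
  have k: "0 < k" "C < s * (k * \<alpha>)"
  proof -
    have "C < real k0 * (s * \<alpha>)" using k0 s \<alpha> by (simp add: field_simps)
    also have "\<dots> \<le> s * (k * \<alpha>)" using s \<alpha> by (simp add: k_def algebra_simps)
    finally show "C < s * (k * \<alpha>)" .
  qed (simp add: k_def)
  obtain \<kappa> where \<kappa>: "0 < \<kappa>" "\<kappa> \<le> \<alpha>" "\<And>a b. k \<le> a \<Longrightarrow>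
        m a (Suc b) \<le> (1 - \<alpha>) * m (a - 1) (Suc b) + (\<alpha> - \<kappa>) * m a b + \<kappa> * (m (a - k) b + C)"
    using C[of k0] unfolding k_def by blast
  \<comment> \<open>Excess over the linear profile of slope s. The plain average in
    \<open>m_step\<close> preserves that profile, so in \<open>rec\<close> only the jumps
    contribute, with a net loss c1.\<close>
  define e where "e = (\<lambda>a b. m a b - s * drift \<alpha> (real a) (real b))"
  define c1 where "c1 = \<kappa> * (s * (k * \<alpha>) - C)"
  have c1: "0 < c1" using \<kappa> k by (simp add: c1_def)
  have rec: "e a (Suc b) \<le> (1 - \<alpha>) * e (a - 1) (Suc b) + (\<alpha> - \<kappa>) * e a b + \<kappa> * e (a - k) b - c1" if "k \<le> a" for a b
  proof -
    have ra: "real (a - 1) = real a - 1" "real (a - k) = real a - real k" using that k by (auto simp: of_nat_diff)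
    have "(1 - \<alpha>) * e (a - 1) (Suc b) + (\<alpha> - \<kappa>) * e a b + \<kappa> * e (a - k) b - c1 - e a (Suc b)
        = (1 - \<alpha>) * m (a - 1) (Suc b) + (\<alpha> - \<kappa>) * m a b + \<kappa> * (m (a - k) b + C) - m a (Suc b)"
      unfolding e_def drift_def c1_def ra by (simp add: algebra_simps)
    then show ?thesis using \<kappa>(3)[OF that, of b] by linarith
  qed
  \<comment> \<open>Arbitrarily small linear growth of the excess on the cone between (1 - \<alpha>,
    \<alpha>) and \<open>(P', Q')\<close>: subtract enough copies of \<open>(P', Q')\<close> to
    exhaust the drift, each costing about g; the remainder has no positive drift and
    \<open>m_sublinear\<close> applies.\<close>
  have upper: "\<exists>K. \<forall>a b. 0 \<le> drift \<alpha> a b \<longrightarrow> (drift \<alpha> a b / d2 + 1) * P' \<le> a \<longrightarrow> (drift \<alpha> a b / d2 + 1) * Q' \<le> b \<longrightarrow>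
         e a b \<le> \<delta> * real (a + b) + K" if \<delta>: "0 < \<delta>" for \<delta>
  proof -
    define \<delta>1 where "\<delta>1 = \<delta> * d2 / 2"
    have \<delta>1: "0 < \<delta>1" using \<delta> d2 by (simp add: \<delta>1_def)
    obtain C1 where C1: "\<And>j. m (j * P') (j * Q') \<le> j * (g + \<delta>1) + C1"
      using m_ray_upper[OF g_inf \<delta>1] by blast
    define K where "K = g + \<delta>1 + C1 + \<delta> / 2 + (\<mu> * exp 1 / \<alpha>)\<^sup>2 / (\<delta> / 2)"
    have "e a b \<le> \<delta> * real (a + b) + K"
      if ab: "0 \<le> drift \<alpha> a b" "(drift \<alpha> a b / d2 + 1) * P' \<le> a" "(drift \<alpha> a b / d2 + 1) * Q' \<le> b" for a b :: nat
    proof -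
      define j where "j = nat \<lceil>drift \<alpha> a b / d2\<rceil>"
      have q: "0 \<le> drift \<alpha> a b / d2" using ab d2 by simp
      have j1: "drift \<alpha> a b / d2 \<le> j" by (simp add: j_def real_nat_ceiling_ge)
      have "real j = of_int \<lceil>drift \<alpha> a b / d2\<rceil>" unfolding j_def using q by (simp add: order_trans[OF _ ceiling_mono[OF q]])
      then have j2: "j \<le> drift \<alpha> a b / d2 + 1" by linarith
      have "real (j * P') \<le> a" using mult_right_mono[OF j2, of "real P'"] ab by simp
      then have jP: "j * P' \<le> a" by (simp del: of_nat_mult)
      have "real (j * Q') \<le> b" using mult_right_mono[OF j2, of "real Q'"] ab by simp
      then have jQ: "j * Q' \<le> b" by (simp del: of_nat_mult)
      define a' b' where "a' = a - j * P'" and "b' = b - j * Q'"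
      have a': "a = j * P' + a'" "b = j * Q' + b'" using jP jQ by (auto simp: a'_def b'_def)
      have "drift \<alpha> a' b' = drift \<alpha> a b - j * d2" by (simp add: a' d2_def drift_def algebra_simps)
      moreover have "drift \<alpha> a b \<le> j * d2" using j1 d2 by (simp add: field_simps)
      ultimately have neg: "drift \<alpha> a' b' \<le> 0" by simp
      have "m a' b' \<le> \<delta> / 2 * (a' + b' + 1) + (\<mu> * exp 1 / \<alpha>)\<^sup>2 / (\<delta> / 2)"
        using m_sublinear[OF neg, of "\<delta> / 2"] \<delta> by (simp add: add_ac)
      also have "\<dots> \<le> \<delta> / 2 * (a + b + 1) + (\<mu> * exp 1 / \<alpha>)\<^sup>2 / (\<delta> / 2)"
        using \<delta> by (intro add_right_mono mult_left_mono) (auto simp: a'_def b'_def)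
      finally have 1: "m a' b' \<le> \<delta> / 2 * real (a + b) + \<delta> / 2 + (\<mu> * exp 1 / \<alpha>)\<^sup>2 / (\<delta> / 2)"
        by (simp add: algebra_simps)
      have "m (j * P') (j * Q') \<le> j * (g + \<delta>1) + C1" by (rule C1)
      also have "\<dots> \<le> (drift \<alpha> a b / d2 + 1) * (g + \<delta>1) + C1"
        using j2 g \<delta>1 by (intro add_right_mono mult_right_mono) auto
      also have "\<dots> = s * drift \<alpha> a b + \<delta> / 2 * drift \<alpha> a b + g + \<delta>1 + C1"
        using d2 by (simp add: s_def \<delta>1_def field_simps)
      also have "\<delta> / 2 * drift \<alpha> a b \<le> \<delta> / 2 * real (a + b)"
      proof (rule mult_left_mono)
        have "\<alpha> * a \<le> 1 * real a" using \<alpha> by (intro mult_right_mono) auto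
        moreover have "0 \<le> (1 - \<alpha>) * b" using \<alpha> by simp
        ultimately show "drift \<alpha> a b \<le> a + b" unfolding drift_def by simp
      qed (use \<delta> in auto)
      finally have 2: "m (j * P') (j * Q') \<le> s * drift \<alpha> a b + \<delta> / 2 * real (a + b) + g + \<delta>1 + C1" by simp
      have "m a b \<le> m (j * P') (j * Q') + m a' b'"
        using m_subadd[of "j * P'" a' "j * Q'" b'] a' by simp
      moreover have "\<delta> * real (a + b) = \<delta> / 2 * real (a + b) + \<delta> / 2 * real (a + b)" by (simp add: field_simps)
      ultimately show ?thesis using 1 2 unfolding e_def K_def by linarith
    qed
    then show ?thesis by blast
  qed
  \<comment> \<open>Margins by which \<open>(P, Q)\<close> lies inside that cone; both are positive
    multiples of P' Q - P Q'.\<close>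
  define \<theta>1 where "\<theta>1 = P * d2 - d1 * P'"
  define \<theta>2 where "\<theta>2 = Q * d2 - d1 * Q'"
  have \<theta>1: "0 < \<theta>1"
  proof -
    have "\<theta>1 = (1 - \<alpha>) * (real P' * Q - real P * Q')" by (simp add: \<theta>1_def d1_def d2_def drift_def algebra_simps)
    then show ?thesis using \<alpha> PQ' by simp
  qed
  have \<theta>2: "0 < \<theta>2"
  proof -
    have "\<theta>2 = \<alpha> * (real P' * Q - real P * Q')" by (simp add: \<theta>2_def d1_def d2_def drift_def algebra_simps)
    then show ?thesis using \<alpha> PQ' by simp
  qed
  \<comment> \<open>Makes the box of sides k \<epsilon> n and \<epsilon> n below n (P, Q) fit into
    the cone and the quadrant, with non-negative drift.\<close>
  obtain \<epsilon> where \<epsilon>: "0 < \<epsilon>" "\<epsilon> \<le> d1 / (real k + 1)" "\<epsilon> \<le> \<theta>1 / (2 * (P' + k * d2 + 1))" "\<epsilon> \<le> \<theta>2 / (2 * (Q' + d2 + 1))" "\<epsilon> \<le> P / (real k + 1)" "\<epsilon> \<le> 1"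
  proof -
    have "0 < P" using PQ'[unfolded] d1 PQ \<alpha> by (cases P) (auto simp: d1_def drift_def mult_less_0_iff)
    then show ?thesis
      using ex_pos_lower_bound[of "{d1 / (real k + 1), \<theta>1 / (2 * (P' + k * d2 + 1)), \<theta>2 / (2 * (Q' + d2 + 1)), P / (real k + 1), 1}"]
        d1 d2 \<theta>1 \<theta>2 that by (auto simp: add_nonneg_pos)
  qed
  \<comment> \<open>About \<epsilon> n rounds of descent gain 4 c n, where c = c1 \<epsilon> / 4.
    This \<delta> makes the linear error exactly 2 c n; one more c n covers the constants, and c n
    is left.\<close>
  define \<delta> where "\<delta> = c1 * \<epsilon> / (2 * (P + Q))"
  have \<delta>: "0 < \<delta>" using c1 \<epsilon> PQ by (simp add: \<delta>_def)
  obtain K where K: "\<And>a b. 0 \<le> drift \<alpha> (real a) (real b) \<Longrightarrow> (drift \<alpha> a b / d2 + 1) * P' \<le> a \<Longrightarrow>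
       (drift \<alpha> a b / d2 + 1) * Q' \<le> b \<Longrightarrow> e a b \<le> \<delta> * real (a + b) + K"
    using upper[OF \<delta>] by blast
  define c where "c = c1 * \<epsilon> / 4"
  have c: "0 < c" using c1 \<epsilon> by (simp add: c_def)
  define n0 where "n0 = nat \<lceil>Max {2 * d2 * P' / \<theta>1, 2 * d2 * Q' / \<theta>2, (\<bar>K\<bar> + c1) / c}\<rceil>"
  have "m (n * P) (n * Q) \<le> n * (s * d1 - c)" if "n0 \<le> n" for n
  proof -
    have "Max {2 * d2 * P' / \<theta>1, 2 * d2 * Q' / \<theta>2, (\<bar>K\<bar> + c1) / c} \<le> real n"
      using that by (simp add: n0_def del: Max_insert)
    then have big: "2 * d2 * P' / \<theta>1 \<le> n" "2 * d2 * Q' / \<theta>2 \<le> n" "(\<bar>K\<bar> + c1) / c \<le> n" by simp_all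
    then have big: "2 * (d2 * P') \<le> n * \<theta>1" "2 * (d2 * Q') \<le> n * \<theta>2" "\<bar>K\<bar> + c1 \<le> c * n"
      using \<theta>1 \<theta>2 c by (simp_all add: field_simps)
    define u where "u = nat \<lfloor>\<epsilon> * n\<rfloor>"
    have u: "real u \<le> \<epsilon> * n" "\<epsilon> * n - 1 \<le> real u" using \<epsilon> by (simp_all add: u_def) linarith?
    have \<epsilon>n: "\<epsilon> * n * (real k + 1) \<le> n * d1" "\<epsilon> * n * (real k + 1) \<le> n * P"
      "2 * (\<epsilon> * n * (P' + k * d2 + 1)) \<le> n * \<theta>1" "2 * (\<epsilon> * n * (Q' + d2 + 1)) \<le> n * \<theta>2"
    proof -
      have pos: "0 < real k + 1" "0 < 2 * (P' + k * d2 + 1)" "0 < 2 * (Q' + d2 + 1)" using d2 by (auto intro!: add_nonneg_pos)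
      have a: "\<epsilon> * (real k + 1) \<le> d1" "\<epsilon> * (real k + 1) \<le> P" "\<epsilon> * (2 * (P' + k * d2 + 1)) \<le> \<theta>1" "\<epsilon> * (2 * (Q' + d2 + 1)) \<le> \<theta>2"
        using \<epsilon>(2,5)[unfolded pos_le_divide_eq[OF pos(1)]]
          \<epsilon>(3)[unfolded pos_le_divide_eq[OF pos(2)]] \<epsilon>(4)[unfolded pos_le_divide_eq[OF pos(3)]] by auto
      note b = mult_right_mono[OF a(1), of "real n"] mult_right_mono[OF a(2), of "real n"]
        mult_right_mono[OF a(3), of "real n"] mult_right_mono[OF a(4), of "real n"]
      show "\<epsilon> * n * (real k + 1) \<le> n * d1" "\<epsilon> * n * (real k + 1) \<le> n * P"
        "2 * (\<epsilon> * n * (P' + k * d2 + 1)) \<le> n * \<theta>1" "2 * (\<epsilon> * n * (Q' + d2 + 1)) \<le> n * \<theta>2"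
        using b by (simp_all add: algebra_simps)
    qed
    have un: "u \<le> n"
    proof -
      have "real u \<le> 1 * real n" using u(1) mult_right_mono[OF \<epsilon>(6), of "real n"] by linarith
      then show ?thesis by simp
    qed
    have ku: "real k * u \<le> \<epsilon> * n * k" using mult_left_mono[OF u(1), of "real k"] by (simp add: mult.commute mult.left_commute)
    have "0 \<le> \<epsilon> * n" using \<epsilon> by simp
    then have "real (k * u) \<le> n * P" using ku \<epsilon>n(2) by (simp add: algebra_simps)
    then have le1: "k * u \<le> n * P" by (metis of_nat_le_iff of_nat_mult)
    have le2: "u \<le> n * Q" using un PQ(1) by (metis le_trans mult.right_neutral mult_le_mono2 Suc_leI One_nat_def)
    have bd: "e a b \<le> \<delta> * (n * P + n * Q) + \<bar>K\<bar>"
      if "n * P - k * u \<le> a" "a \<le> n * P" "n * Q - u \<le> b" "b \<le> n * Q" for a b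
    proof -
      have ra: "real n * P - k * u \<le> a" "real a \<le> n * P" "real n * Q - u \<le> b" "real b \<le> n * Q"
        using that le1 le2 by (auto simp flip: of_nat_mult of_nat_diff)
      have dr: "drift \<alpha> a b = n * d1 - \<alpha> * (real n * P - a) + (1 - \<alpha>) * (real n * Q - b)"
        by (simp add: drift_def d1_def algebra_simps)
      have "\<alpha> * (real n * P - a) \<le> 1 * (real k * real u)" using ra \<alpha> by (intro mult_mono) auto
      moreover have "0 \<le> (1 - \<alpha>) * (real n * Q - b)" using ra \<alpha> by simp
      ultimately have "0 \<le> n * d1 - k * u + 0 \<longrightarrow> 0 \<le> drift \<alpha> a b" unfolding dr by simp
      moreover have "real k * u \<le> n * d1" using ku \<epsilon>n(1) \<open>0 \<le> \<epsilon> * n\<close> by (simp add: algebra_simps)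
      ultimately have dr0: "0 \<le> drift \<alpha> a b" by simp
      have "0 \<le> \<alpha> * (real n * P - a)" using ra \<alpha> by simp
      moreover have "(1 - \<alpha>) * (real n * Q - b) \<le> 1 * real u" using ra \<alpha> by (intro mult_mono) auto
      ultimately have "drift \<alpha> a b \<le> n * d1 + u" unfolding dr by simp
      then have dru: "drift \<alpha> a b \<le> n * d1 + \<epsilon> * n" using u by simp
      have "(drift \<alpha> a b / d2 + 1) * P' \<le> a"
      proof -
        have "drift \<alpha> a b * P' \<le> (n * d1 + \<epsilon> * n) * P'" using dru by (intro mult_right_mono) auto
        moreover have "(real n * P - \<epsilon> * n * k) * d2 \<le> a * d2" using ra ku d2 by (intro mult_right_mono) auto
        moreover have "0 \<le> \<epsilon> * n" by fact
        ultimately have "drift \<alpha> a b * P' + d2 * P' \<le> a * d2"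
          using \<epsilon>n(3) big(1) unfolding \<theta>1_def by (simp add: algebra_simps)
        then show ?thesis using d2 by (simp add: field_simps)
      qed
      moreover have "(drift \<alpha> a b / d2 + 1) * Q' \<le> b"
      proof -
        have "drift \<alpha> a b * Q' \<le> (n * d1 + \<epsilon> * n) * Q'" using dru by (intro mult_right_mono) auto
        moreover have "(real n * Q - \<epsilon> * n) * d2 \<le> b * d2" using ra u d2 by (intro mult_right_mono) auto
        moreover have "0 \<le> \<epsilon> * n" by fact
        ultimately have "drift \<alpha> a b * Q' + d2 * Q' \<le> b * d2"
          using \<epsilon>n(4) big(2) unfolding \<theta>2_def by (simp add: algebra_simps)
        then show ?thesis using d2 by (simp add: field_simps)
      qed
      ultimately have "e a b \<le> \<delta> * real (a + b) + K" using K[OF dr0] by simp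
      also have "\<dots> \<le> \<delta> * (n * P + n * Q) + \<bar>K\<bar>"
        using ra \<delta> by (intro add_mono mult_left_mono) auto
      finally show ?thesis .
    qed
    have "e (n * P) (n * Q) \<le> \<delta> * (n * P + n * Q) + \<bar>K\<bar> - c1 * u"
      by (rule descent[where e = e and k = k and \<kappa> = \<kappa> and c = c1 and n = u, OF rec less_imp_le[OF \<kappa>(1)] \<kappa>(2) k(1) le1 le2 bd])
    also have "\<delta> * (n * P + n * Q) = 2 * (c * n)"
      using PQ(1) by (simp add: \<delta>_def c_def field_simps)
    finally have "e (n * P) (n * Q) \<le> 2 * (c * n) + \<bar>K\<bar> - c1 * u" .
    moreover have "- (c1 * u) \<le> c1 - 4 * (c * n)"
      using mult_left_mono[OF u(2), of c1] c1 by (simp add: c_def algebra_simps)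
    ultimately have "e (n * P) (n * Q) \<le> - (c * n)" using big(3) by linarith
    then show ?thesis by (simp add: e_def d1_def drift_def algebra_simps)
  qed
  moreover have "n * (s * d2) \<le> m (n * P') (n * Q')" for n using g_le[of n] s by simp
  ultimately show ?thesis using s(1) c unfolding d1_def d2_def by blast
qed

end

section \<open>Means and fluctuations of the passage time\<close>

text \<open>With all switches on, the field is its own companion, so the results on \<open>F\<close>
  become available for \<open>FP\<close>.\<close>

lemma switched_weights_hweights: "switched_weights (\<lambda>_. True) (hweights w) (hweights w)"
  by unfold_locales (auto simp: hweights_def)

abbreviation FP :: "(site \<Rightarrow> bool \<times> real) \<Rightarrow> site \<Rightarrow> site \<Rightarrow> real" where
  "FP w \<equiv> passage_time (hweights w)"

lemmas FP_step = switched_weights.F_step[OF switched_weights_hweights]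
  and FP_row = switched_weights.F_row[OF switched_weights_hweights]
  and FP_col0 = switched_weights.F_col0[OF switched_weights_hweights]
  and FP_nonneg = switched_weights.F_nonneg[OF switched_weights_hweights]
  and FP_mono_up = switched_weights.F_mono_up[OF switched_weights_hweights]
  and FP_mono_right = switched_weights.F_mono_right[OF switched_weights_hweights]

lemma hweights_1: "hweights w z 1 = hweight (w z)"
  by (simp add: hweights_def)

lemma FP_mono:
  assumes "i \<le> a" "j \<le> b"
    and "\<And>c d. i < c \<Longrightarrow> c \<le> a \<Longrightarrow> j \<le> d \<Longrightarrow> d \<le> b \<Longrightarrow> hweight (w (c, d)) \<le> hweight (w' (c, d))"
  shows "FP w (i, j) (a, b) \<le> FP w' (i, j) (a, b)"
  using assms
proof (induction rule: quadrant_induct)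
  case (row a)
  then show ?case using row.prems[of a j] by (simp only: FP_row hweights_1) force
next
  case (col b)
  then show ?case by (simp add: FP_col0)
next
  case (inner a b)
  have "FP w (i, j) (a - 1, b) \<le> FP w' (i, j) (a - 1, b)" "FP w (i, j) (a, b - 1) \<le> FP w' (i, j) (a, b - 1)"
    using inner by auto
  then show ?case using inner.hyps inner.prems[of a b] by (simp only: FP_step hweights_1) force
qed simp

lemma FP_cong:
  assumes "i \<le> a" "j \<le> b"
    and "\<And>c d. i < c \<Longrightarrow> c \<le> a \<Longrightarrow> j \<le> d \<Longrightarrow> d \<le> b \<Longrightarrow> hweight (w (c, d)) = hweight (w' (c, d))"
  shows "FP w (i, j) (a, b) = FP w' (i, j) (a, b)"
  using assms by (intro order_antisym FP_mono) auto

lemma FP_update_outside: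
  assumes "i \<le> a" "j \<le> b" "\<not> (i < fst z \<and> fst z \<le> a \<and> j \<le> snd z \<and> snd z \<le> b)"
  shows "FP (w(z := d)) (i, j) (a, b) = FP w (i, j) (a, b)"
  using assms by (intro FP_cong) auto

text \<open>A path uses the horizontal edge into \<open>z\<close> at most once.\<close>

lemma FP_lipschitz:
  assumes "i \<le> a" "j \<le> b" and h: "0 \<le> h" "hweight d' \<le> hweight d + h"
  shows "FP (w(z := d')) (i, j) (a, b) \<le> FP (w(z := d)) (i, j) (a, b) + h"
  using assms(1,2)
proof (induction rule: quadrant_induct)
  case corner
  then show ?case using h by simp
next
  case (row a)
  show ?case
  proof (cases "z = (a, j)")
    case True
    have "FP (w(z := d)) (i, j) (a, j) = FP w (i, j) (a - 1, j) + hweight d" for d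
      using row.hyps True FP_update_outside[of i "a - 1" j j z w d] FP_row[of i a "w(z := d)" j]
      by (simp add: hweights_1[unfolded One_nat_def])
    from this[of d] this[of d'] show ?thesis using h by linarith
  next
    case False
    then have "hweights (w(z := d)) (a, j) 1 = hweights (w(z := d')) (a, j) 1"
      by (auto simp only: hweights_1 fun_upd_other)
    then show ?thesis
      using row FP_row[of i a "w(z := d)" j] FP_row[of i a "w(z := d')" j] by linarith
  qed
next
  case (col b)
  then show ?case using h by (simp add: FP_col0)
next
  case (inner a b)
  show ?case
  proof (cases "z = (a, b)")
    case True
    have "FP (w(z := d)) (i, j) (a - 1, b) = FP (w(z := d')) (i, j) (a - 1, b)"
      "FP (w(z := d)) (i, j) (a, b - 1) = FP (w(z := d')) (i, j) (a, b - 1)"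
      using inner.hyps True by (simp_all add: FP_update_outside)
    moreover have "hweights (w(z := d)) (a, b) 1 = hweight d" "hweights (w(z := d')) (a, b) 1 = hweight d'"
      using True by (simp_all only: hweights_1 fun_upd_same)
    ultimately show ?thesis
      using h FP_step[of i a j b "w(z := d)"] FP_step[of i a j b "w(z := d')"] inner.hyps by linarith
  next
    case False
    then have "hweights (w(z := d)) (a, b) 1 = hweights (w(z := d')) (a, b) 1"
      by (auto simp only: hweights_1 fun_upd_other)
    then show ?thesis
      using inner.IH FP_step[of i a j b "w(z := d)"] FP_step[of i a j b "w(z := d')"] inner.hyps h by linarith
  qed
qed

text \<open>\<open>H\<close> consists of the horizontal edges of an optimal path.\<close>

lemma FP_support:
  assumes "i \<le> a" "j \<le> b"
  shows "\<exists>H. finite H \<and> card H \<le> nat (a - i) \<and>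
     (\<forall>w'. (\<forall>z\<in>H. hweight (w' z) = hweight (w z)) \<longrightarrow> FP w' (i, j) (a, b) \<le> FP w (i, j) (a, b))"
  using assms
proof (induction rule: quadrant_induct)
  case corner
  then show ?case by (intro exI[of _ "{}"]) auto
next
  case (row a)
  then obtain H where H: "finite H" "card H \<le> nat (a - 1 - i)"
     "\<And>w'. (\<forall>z\<in>H. hweight (w' z) = hweight (w z)) \<Longrightarrow> FP w' (i, j) (a - 1, j) \<le> FP w (i, j) (a - 1, j)" by blast
  have "card (insert (a, j) H) \<le> nat (a - i)" using H row.hyps card_insert_le_m1[of "nat (a - i)" H "(a, j)"] by auto
  moreover have "FP w' (i, j) (a, j) \<le> FP w (i, j) (a, j)"
    if "\<forall>z\<in>insert (a, j) H. hweight (w' z) = hweight (w z)" for w'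
    using that H(3)[of w'] FP_row[of i a w j] FP_row[of i a w' j] row.hyps by (simp only: hweights_1) simp
  ultimately show ?case using H(1) by (intro exI[of _ "insert (a, j) H"]) blast
next
  case (col b)
  then show ?case by (intro exI[of _ "{}"]) (auto simp: FP_col0)
next
  case (inner a b)
  then obtain H where H: "finite H" "card H \<le> nat (a - 1 - i)"
     "\<And>w'. (\<forall>z\<in>H. hweight (w' z) = hweight (w z)) \<Longrightarrow> FP w' (i, j) (a - 1, b) \<le> FP w (i, j) (a - 1, b)" by blast
  obtain H' where H': "finite H'" "card H' \<le> nat (a - i)"
     "\<And>w'. (\<forall>z\<in>H'. hweight (w' z) = hweight (w z)) \<Longrightarrow> FP w' (i, j) (a, b - 1) \<le> FP w (i, j) (a, b - 1)" using inner by blast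
  show ?case
  proof (cases "FP w (i, j) (a - 1, b) + hweight (w (a, b)) \<le> FP w (i, j) (a, b - 1)")
    case True
    have "card (insert (a, b) H) \<le> nat (a - i)" using H inner.hyps card_insert_le_m1[of "nat (a - i)" H "(a, b)"] by auto
    moreover have "FP w' (i, j) (a, b) \<le> FP w (i, j) (a, b)"
      if "\<forall>z\<in>insert (a, b) H. hweight (w' z) = hweight (w z)" for w'
      using that H(3)[of w'] True FP_step[of i a j b w] FP_step[of i a j b w'] inner.hyps
      by (simp only: hweights_1) (simp add: min_def split: if_splits)
    ultimately show ?thesis using H(1) by (intro exI[of _ "insert (a, b) H"]) blast
  next
    case False
    have "FP w' (i, j) (a, b) \<le> FP w (i, j) (a, b)"
      if "\<forall>z\<in>H'. hweight (w' z) = hweight (w z)" for w'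
      using that H'(3)[of w'] False FP_step[of i a j b w] FP_step[of i a j b w'] inner.hyps
      by (simp only: hweights_1) (simp add: min_def split: if_splits)
    then show ?thesis using H' by (intro exI[of _ H']) blast
  qed
qed

lemma FP_le_row_sum:
  assumes "i \<le> a" "j \<le> b"
  shows "FP w (i, j) (a, b) \<le> (\<Sum>l=1..nat (a - i). hweight (w (i + int l, j)))"
proof -
  have "FP w (i, j) (a, b) \<le> FP w (i, j) (a, j)"
    using assms(2)
  proof (induction b rule: int_ge_induct)
    case (step b)
    then show ?case using FP_mono_up[of i a j "b + 1" w] assms by simp
  qed simp
  then show ?thesis using passage_time_row_sum[of "hweights w" i j "nat (a - i)"] assms by (simp add: hweights_1[unfolded One_nat_def])
qed

lemma FP_shift:
  assumes "0 \<le> a" "0 \<le> b"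
  shows "FP (\<lambda>z. w (fst z + i, snd z + j)) (0, 0) (a, b) = FP w (i, j) (i + a, j + b)"
  using assms
proof (induction rule: quadrant_induct)
  case (row a)
  then show ?case using FP_row[of 0 a "\<lambda>z. w (fst z + i, snd z + j)" 0] FP_row[of i "i + a" w j]
    by (simp add: hweights_1[unfolded One_nat_def] add.commute add_diff_eq)
next
  case (col b)
  then show ?case by (simp add: FP_col0)
next
  case (inner a b)
  then show ?case using FP_step[of 0 a 0 b "\<lambda>z. w (fst z + i, snd z + j)"] FP_step[of i "i + a" j "j + b" w]
    by (simp add: hweights_1[unfolded One_nat_def] add.commute add_diff_eq)
qed simp

section \<open>Integration over single sites and the Efron-Stein inequality\<close>

context site_moment
begin

lemma measurable_FP [measurable]:
  assumes "i \<le> a" "j \<le> b"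
  shows "(\<lambda>w. FP w (i, j) (a, b)) \<in> borel_measurable P"
  using assms
proof (induction rule: quadrant_induct)
  case (row a)
  have [measurable]: "(\<lambda>w. FP w (i, j) (a - 1, j)) \<in> borel_measurable P" by fact
  have "(\<lambda>w. FP w (i, j) (a - 1, j) + hweight (w (a, j))) \<in> borel_measurable P" by measurable
  then show ?case using row.hyps by (simp only: FP_row hweights_1)
next
  case (col b)
  then show ?case by (simp add: FP_col0)
next
  case (inner a b)
  have [measurable]: "(\<lambda>w. FP w (i, j) (a - 1, b)) \<in> borel_measurable P" "(\<lambda>w. FP w (i, j) (a, b - 1)) \<in> borel_measurable P" by fact+
  have "(\<lambda>w. min (FP w (i, j) (a - 1, b) + hweight (w (a, b))) (FP w (i, j) (a, b - 1))) \<in> borel_measurable P" by measurable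
  then show ?case using inner.hyps by (simp only: FP_step hweights_1)
qed simp

lemma integral_site:
  fixes f :: "bool \<times> real \<Rightarrow> real"
  assumes [measurable]: "f \<in> borel_measurable D"
  shows "(\<integral>w. f (w z) \<partial>P) = (\<integral>d. f d \<partial>D)" "integrable P (\<lambda>w. f (w z)) \<longleftrightarrow> integrable D f"
proof -
  have "(\<integral>d. f d \<partial>D) = (\<integral>d. f d \<partial>distr P D (\<lambda>w. w z))" by (simp add: distr_site)
  also have "\<dots> = (\<integral>w. f (w z) \<partial>P)" by (rule integral_distr) measurable
  finally show "(\<integral>w. f (w z) \<partial>P) = (\<integral>d. f d \<partial>D)" by simp
  have "integrable D f \<longleftrightarrow> integrable (distr P D (\<lambda>w. w z)) f" by (simp add: distr_site)
  also have "\<dots> \<longleftrightarrow> integrable P (\<lambda>w. f (w z))" by (rule integrable_distr_eq) measurable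
  finally show "integrable P (\<lambda>w. f (w z)) \<longleftrightarrow> integrable D f" by simp
qed

lemma integral_resample:
  fixes f :: "(site \<Rightarrow> bool \<times> real) \<Rightarrow> real"
  assumes f: "integrable P f"
  shows "(\<integral>w. f w \<partial>P) = (\<integral>w. (\<integral>d. f (w(z := d)) \<partial>D) \<partial>P)"
    and "integrable P (\<lambda>w. \<integral>d. f (w(z := d)) \<partial>D)"
proof -
  interpret pair_sigma_finite D P ..
  have [measurable]: "f \<in> borel_measurable P" using f by simp
  have "integrable (distr (D \<Otimes>\<^sub>M P) P (\<lambda>(d, w). w(z := d))) f" using f by (simp add: distr_resample)
  then have "integrable (D \<Otimes>\<^sub>M P) (\<lambda>x. f (case x of (d, w) \<Rightarrow> w(z := d)))"
    by (subst (asm) integrable_distr_eq) measurable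
  then have int: "integrable (D \<Otimes>\<^sub>M P) (\<lambda>(d, w). f (w(z := d)))" by (simp add: case_prod_beta')
  have "(\<integral>w. f w \<partial>P) = (\<integral>w. f w \<partial>distr (D \<Otimes>\<^sub>M P) P (\<lambda>(d, w). w(z := d)))"
    by (simp add: distr_resample)
  also have "\<dots> = (\<integral>x. f (case x of (d, w) \<Rightarrow> w(z := d)) \<partial>(D \<Otimes>\<^sub>M P))"
    by (rule integral_distr) measurable
  also have "\<dots> = (\<integral>x. (case x of (d, w) \<Rightarrow> f (w(z := d))) \<partial>(D \<Otimes>\<^sub>M P))"
    by (simp add: case_prod_beta)
  also have "\<dots> = (\<integral>w. (\<integral>d. f (w(z := d)) \<partial>D) \<partial>P)"
    by (rule integral_snd[symmetric, OF int])
  finally show "(\<integral>w. f w \<partial>P) = (\<integral>w. (\<integral>d. f (w(z := d)) \<partial>D) \<partial>P)" .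
  show "integrable P (\<lambda>w. \<integral>d. f (w(z := d)) \<partial>D)"
    using integrable_snd[OF int] by simp
qed

lemma measurable_update_const [measurable]:
  assumes [measurable]: "f \<in> borel_measurable P"
  shows "(\<lambda>w. f (w(z := d))) \<in> borel_measurable P" "(\<lambda>d. f (w(z := d))) \<in> borel_measurable D"
proof -
  have 1: "(\<lambda>(d, w). f (w(z := d))) \<in> borel_measurable (D \<Otimes>\<^sub>M P)" by measurable
  show "(\<lambda>w. f (w(z := d))) \<in> borel_measurable P" using measurable_Pair2[OF 1, of d] by simp
  show "(\<lambda>d. f (w(z := d))) \<in> borel_measurable D" using measurable_Pair1[OF 1, of w] by simp
qed

text \<open>Functionals of the sites in \<open>J\<close> with growth linear in the weights: for
  finite \<open>J\<close> square integrable, and stable under integrating out or fixing a site, as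
  the induction in \<open>efron_stein\<close> requires.\<close>

definition tame :: "site set \<Rightarrow> ((site \<Rightarrow> bool \<times> real) \<Rightarrow> real) \<Rightarrow> bool" where
  "tame J f \<longleftrightarrow> f \<in> borel_measurable P \<and> (\<exists>c. \<forall>w. 0 \<le> f w \<and> f w \<le> c + (\<Sum>y\<in>J. hweight (w y)))
     \<and> (\<forall>w w'. (\<forall>y\<in>J. w y = w' y) \<longrightarrow> f w = f w')"

lemma integrable_square_le:
  assumes "integrable M (\<lambda>x. (g x)\<^sup>2)" "f \<in> borel_measurable M" "\<And>x. \<bar>f x\<bar> \<le> g x"
  shows "integrable M (\<lambda>x. (f x)\<^sup>2 :: real)"
proof (rule Bochner_Integration.integrable_bound[OF assms(1)])
  show "(\<lambda>x. (f x)\<^sup>2) \<in> borel_measurable M" using assms(2) by simp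
  have "(f x)\<^sup>2 \<le> (g x)\<^sup>2" for x using power_mono[OF assms(3)[of x] abs_ge_zero, of 2] by simp
  then show "AE x in M. norm ((f x)\<^sup>2) \<le> norm ((g x)\<^sup>2)" by simp
qed

lemma integrable_square_add:
  fixes f g :: "'c \<Rightarrow> real"
  assumes "integrable M (\<lambda>x. (f x)\<^sup>2)" "integrable M (\<lambda>x. (g x)\<^sup>2)" "f \<in> borel_measurable M" "g \<in> borel_measurable M"
  shows "integrable M (\<lambda>x. (f x + g x)\<^sup>2)"
proof (rule Bochner_Integration.integrable_bound[where f = "\<lambda>x. 2 * (f x)\<^sup>2 + 2 * (g x)\<^sup>2"])
  show "integrable M (\<lambda>x. 2 * (f x)\<^sup>2 + 2 * (g x)\<^sup>2)" using assms by simp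
  show "(\<lambda>x. (f x + g x)\<^sup>2) \<in> borel_measurable M" using assms by simp
  have "(f x + g x)\<^sup>2 \<le> 2 * (f x)\<^sup>2 + 2 * (g x)\<^sup>2" for x
    using zero_le_power2[of "f x - g x"] by (simp add: power2_eq_square algebra_simps)
  then show "AE x in M. norm ((f x + g x)\<^sup>2) \<le> norm (2 * (f x)\<^sup>2 + 2 * (g x)\<^sup>2)" by simp
qed

text \<open>The bound in \<open>tame\<close> holds pointwise, so the sections over one site are
  square integrable for every \<open>w\<close>, not just almost every one.\<close>

lemma tame_square_integrable:
  assumes "finite J" "tame J f"
  shows "integrable P (\<lambda>w. (f w)\<^sup>2)" "integrable P f" "integrable D (\<lambda>d. (f (w(z := d)))\<^sup>2)" "integrable D (\<lambda>d. f (w(z := d)))"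
proof -
  have [measurable]: "f \<in> borel_measurable P" using assms(2) by (simp add: tame_def)
  obtain c where c: "\<And>w. 0 \<le> f w" "\<And>w. f w \<le> c + (\<Sum>y\<in>J. hweight (w y))" using assms(2) by (auto simp: tame_def)
  have 1: "integrable P (\<lambda>w. (c + (\<Sum>y\<in>J. hweight (w y)))\<^sup>2)"
    using assms(1)
  proof (induction J)
    case (insert y J)
    have "integrable P (\<lambda>w. (c + (\<Sum>y\<in>J. hweight (w y)) + hweight (w y))\<^sup>2)"
    proof (rule integrable_square_add[OF insert.IH])
      show "integrable P (\<lambda>w. (hweight (w y))\<^sup>2)"
        using integral_site(2)[of "\<lambda>d. (hweight d)\<^sup>2"] integrable_hweight_sq by simp
    qed measurable
    then show ?case using insert.hyps by (simp add: ac_simps)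
  qed simp
  show sq: "integrable P (\<lambda>w. (f w)\<^sup>2)"
    by (rule integrable_square_le[OF 1]) (use c in auto)
  show "integrable P f" by (rule P.square_integrable_imp_integrable[OF _ sq]) measurable
  have 2: "integrable D (\<lambda>d. ((c + (\<Sum>y\<in>J - {z}. hweight (w y))) + hweight d)\<^sup>2)"
    by (rule integrable_square_add[OF _ integrable_hweight_sq]) auto
  have le: "f (w(z := d)) \<le> (c + (\<Sum>y\<in>J - {z}. hweight (w y))) + hweight d" for d
  proof -
    have "(\<Sum>y\<in>J. hweight ((w(z := d)) y)) \<le> (\<Sum>y\<in>J - {z}. hweight (w y)) + hweight d"
    proof -
      have eq: "(\<Sum>y\<in>J - {z}. hweight ((w(z := d)) y)) = (\<Sum>y\<in>J - {z}. hweight (w y))"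
        by (intro sum.cong) auto
      show ?thesis
      proof (cases "z \<in> J")
        case True
        then show ?thesis using sum.remove[OF assms(1) True, of "\<lambda>y. hweight ((w(z := d)) y)"] eq by simp
      next
        case False
        then show ?thesis using eq by simp
      qed
    qed
    then show ?thesis using c(2)[of "w(z := d)"] by linarith
  qed
  show sqD: "integrable D (\<lambda>d. (f (w(z := d)))\<^sup>2)"
    by (rule integrable_square_le[OF 2]) (use c le in auto)
  show "integrable D (\<lambda>d. f (w(z := d)))" by (rule D.square_integrable_imp_integrable[OF _ sqD]) measurable
qed

lemma square_mean_le:
  assumes "integrable D f" "integrable D (\<lambda>d. (f d)\<^sup>2 :: real)"
  shows "(\<integral>d. f d \<partial>D)\<^sup>2 \<le> (\<integral>d. (f d)\<^sup>2 \<partial>D)"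
  using D.variance_positive[of f] D.variance_eq[OF assms] by simp

text \<open>A version with a fixed replacement value \<open>d0\<close> in place of an independent
  copy, which works because a second moment around any constant bounds the variance. A
  \<open>d0\<close> of weight zero will turn the terms into costs of pivotal edges.\<close>

theorem efron_stein:
  assumes "finite J" "tame J f"
  shows "(\<integral>w. (f w)\<^sup>2 \<partial>P) - (\<integral>w. f w \<partial>P)\<^sup>2 \<le> (\<Sum>z\<in>J. \<integral>w. (f w - f (w(z := d0)))\<^sup>2 \<partial>P)"
  using assms
proof (induction J arbitrary: f)
  case empty
  then have "f w = f undefined" for w by (auto simp: tame_def)
  then have "f = (\<lambda>_. f undefined)" by auto
  then obtain c where "f = (\<lambda>_. c)" by blast
  then show ?case using P.prob_space by simp
next
  case (insert z J)
  note fint = tame_square_integrable[OF _ insert.prems]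
  have fin: "finite (insert z J)" using insert.hyps by simp
  have [measurable]: "f \<in> borel_measurable P" using insert.prems by (simp add: tame_def)
  obtain c where c: "\<And>w. 0 \<le> f w" "\<And>w. f w \<le> c + (\<Sum>y\<in>insert z J. hweight (w y))"
    using insert.prems unfolding tame_def by blast
  have dep: "f w = f w'" if "\<And>y. y \<in> insert z J \<Longrightarrow> w y = w' y" for w w'
    using insert.prems that unfolding tame_def by blast
  \<comment> \<open>The variance of \<open>f\<close> is the mean conditional variance over the site
    \<open>z\<close>, estimated in \<open>first\<close>, plus the variance of \<open>g\<close>, left
    to the induction.\<close>
  define g where "g = (\<lambda>w. \<integral>d. f (w(z := d)) \<partial>D)"
  have [measurable]: "g \<in> borel_measurable P"
    unfolding g_def using integral_resample(2)[OF fint(2)[OF fin]] by auto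
  have g_tame: "tame J g"
    unfolding tame_def
  proof (intro conjI exI allI impI)
    show "g \<in> borel_measurable P" by measurable
    fix w w' :: "site \<Rightarrow> bool \<times> real"
    show "0 \<le> g w" unfolding g_def using c by simp
    have "g w \<le> (\<integral>d. (c + (\<Sum>y\<in>J. hweight (w y))) + hweight d \<partial>D)"
      unfolding g_def
    proof (rule integral_mono[OF fint(4)[OF fin]])
      show "integrable D (\<lambda>d. (c + (\<Sum>y\<in>J. hweight (w y))) + hweight d)" using integrable_hweight by simp
      fix d
      have "(\<Sum>y\<in>insert z J. hweight ((w(z := d)) y)) = hweight d + (\<Sum>y\<in>J. hweight (w y))"
        using insert.hyps by (simp, intro sum.cong) auto
      then show "f (w(z := d)) \<le> (c + (\<Sum>y\<in>J. hweight (w y))) + hweight d" using c(2)[of "w(z := d)"] by simp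
    qed
    then show "g w \<le> c + \<mu> + (\<Sum>y\<in>J. hweight (w y))"
      using integrable_hweight D.prob_space by (simp add: \<mu>_def)
    assume "\<forall>y\<in>J. w y = w' y"
    then show "g w = g w'" unfolding g_def by (intro Bochner_Integration.integral_cong dep) auto
  qed
  note gint = tame_square_integrable[OF insert.hyps(1) g_tame]
  have mean: "(\<integral>w. g w \<partial>P) = (\<integral>w. f w \<partial>P)"
    unfolding g_def by (rule integral_resample(1)[OF fint(2)[OF fin], symmetric])
  have diff_int: "integrable P (\<lambda>w. (f w - f (w(y := d0)))\<^sup>2)" for y
  proof -
    have "tame (insert z J) (\<lambda>w. f (w(y := d0)))"
      unfolding tame_def
    proof (intro conjI exI allI impI)
      show "(\<lambda>w. f (w(y := d0))) \<in> borel_measurable P" by measurable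
      fix w w' :: "site \<Rightarrow> bool \<times> real"
      show "0 \<le> f (w(y := d0))" using c by simp
      have "(\<Sum>x\<in>insert z J. hweight ((w(y := d0)) x)) \<le> (\<Sum>x\<in>insert z J. hweight (w x) + (if x = y then hweight d0 else 0))"
        by (intro sum_mono) auto
      also have "\<dots> = (\<Sum>x\<in>insert z J. hweight (w x)) + (\<Sum>x\<in>insert z J. if x = y then hweight d0 else 0)"
        by (simp only: sum.distrib)
      also have "(\<Sum>x\<in>insert z J. if x = y then hweight d0 else 0) \<le> hweight d0"
        using fin by (subst sum.delta) auto
      finally show "f (w(y := d0)) \<le> c + hweight d0 + (\<Sum>x\<in>insert z J. hweight (w x))"
        using c(2)[of "w(y := d0)"] by linarith
      assume "\<forall>x\<in>insert z J. w x = w' x"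
      then show "f (w(y := d0)) = f (w'(y := d0))" by (intro dep) auto
    qed
    note hint = tame_square_integrable[OF fin this]
    have "integrable P (\<lambda>w. (f w + (- f (w(y := d0))))\<^sup>2)"
      by (rule integrable_square_add) (use fint(1)[OF fin] hint(1) in auto)
    then show ?thesis by simp
  qed
  have first: "(\<integral>w. (f w)\<^sup>2 \<partial>P) - (\<integral>w. (g w)\<^sup>2 \<partial>P) \<le> (\<integral>w. (f w - f (w(z := d0)))\<^sup>2 \<partial>P)"
  proof -
    have a: "(\<integral>w. (f w)\<^sup>2 \<partial>P) = (\<integral>w. (\<integral>d. (f (w(z := d)))\<^sup>2 \<partial>D) \<partial>P)"
      by (rule integral_resample(1)[OF fint(1)[OF fin]])
    have b: "integrable P (\<lambda>w. \<integral>d. (f (w(z := d)))\<^sup>2 \<partial>D)"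
      by (rule integral_resample(2)[OF fint(1)[OF fin]])
    have "(\<integral>w. (f w)\<^sup>2 \<partial>P) - (\<integral>w. (g w)\<^sup>2 \<partial>P) = (\<integral>w. (\<integral>d. (f (w(z := d)))\<^sup>2 \<partial>D) - (g w)\<^sup>2 \<partial>P)"
      by (simp only: a Bochner_Integration.integral_diff[OF b gint(1)])
    also have "\<dots> \<le> (\<integral>w. (\<integral>d. (f (w(z := d)) - f ((w(z := d))(z := d0)))\<^sup>2 \<partial>D) \<partial>P)"
    proof (rule integral_mono)
      show "integrable P (\<lambda>w. (\<integral>d. (f (w(z := d)))\<^sup>2 \<partial>D) - (g w)\<^sup>2)"
        by (intro Bochner_Integration.integrable_diff b gint(1))
      show "integrable P (\<lambda>w. \<integral>d. (f (w(z := d)) - f ((w(z := d))(z := d0)))\<^sup>2 \<partial>D)"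
        by (rule integral_resample(2)[OF diff_int])
      fix w
      define k where "k = f (w(z := d0))"
      define u where "u = (\<lambda>d. f (w(z := d)))"
      have u: "integrable D u" "integrable D (\<lambda>d. (u d)\<^sup>2)" 
        unfolding u_def by (rule fint(4)[OF fin], rule fint(3)[OF fin])
      have "(\<integral>d. (u d - k)\<^sup>2 \<partial>D) = (\<integral>d. (u d)\<^sup>2 - 2 * k * u d + k\<^sup>2 \<partial>D)"
        by (intro Bochner_Integration.integral_cong) (auto simp: power2_eq_square algebra_simps)
      also have "\<dots> = (\<integral>d. (u d)\<^sup>2 \<partial>D) - 2 * k * (\<integral>d. u d \<partial>D) + k\<^sup>2"
        using u D.prob_space by simp
      finally have "(\<integral>d. (u d - k)\<^sup>2 \<partial>D) = (\<integral>d. (u d)\<^sup>2 \<partial>D) - (g w)\<^sup>2 + (g w - k)\<^sup>2"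
        by (simp add: g_def u_def power2_eq_square algebra_simps)
      then show "(\<integral>d. (f (w(z := d)))\<^sup>2 \<partial>D) - (g w)\<^sup>2 \<le> (\<integral>d. (f (w(z := d)) - f ((w(z := d))(z := d0)))\<^sup>2 \<partial>D)"
        by (simp add: u_def k_def)
    qed
    also have "\<dots> = (\<integral>w. (f w - f (w(z := d0)))\<^sup>2 \<partial>P)"
      by (rule integral_resample(1)[OF diff_int, symmetric])
    finally show ?thesis .
  qed
  \<comment> \<open>Differences of \<open>g\<close> are averages over \<open>z\<close> of
    differences of \<open>f\<close>, so Jensen's inequality applies.\<close>
  have rest: "(\<integral>w. (g w - g (w(y := d0)))\<^sup>2 \<partial>P) \<le> (\<integral>w. (f w - f (w(y := d0)))\<^sup>2 \<partial>P)" if y: "y \<in> J" for y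
  proof -
    have yz: "y \<noteq> z" using y insert.hyps by auto
    have tw: "(w(y := d0))(z := d) = (w(z := d))(y := d0)" for w d using yz by (simp add: fun_upd_twist)
    have pw: "(g w - g (w(y := d0)))\<^sup>2 \<le> (\<integral>d. (f (w(z := d)) - f ((w(z := d))(y := d0)))\<^sup>2 \<partial>D)" for w
    proof -
      let ?h = "\<lambda>d. f (w(z := d)) - f ((w(z := d))(y := d0))"
      have t1: "integrable D (\<lambda>d. f (w(z := d)))" by (rule fint(4)[OF fin])
      have t2: "integrable D (\<lambda>d. f ((w(z := d))(y := d0)))"
        using fint(4)[OF fin, of "w(y := d0)" z] unfolding tw .
      have t3: "integrable D (\<lambda>d. (f (w(z := d)))\<^sup>2)" by (rule fint(3)[OF fin])
      have t4: "integrable D (\<lambda>d. (- f ((w(z := d))(y := d0)))\<^sup>2)"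
        using fint(3)[OF fin, of "w(y := d0)" z] unfolding tw power2_minus .
      have i1: "integrable D ?h" by (intro Bochner_Integration.integrable_diff t1 t2)
      have "integrable D (\<lambda>d. (f (w(z := d)) + (- f ((w(z := d))(y := d0))))\<^sup>2)"
        by (rule integrable_square_add[OF t3 t4]) (use t1 t2 in auto)
      then have i2: "integrable D (\<lambda>d. (?h d)\<^sup>2)" by simp
      have "g w - g (w(y := d0)) = (\<integral>d. ?h d \<partial>D)"
        unfolding g_def tw by (rule Bochner_Integration.integral_diff[OF t1 t2, symmetric])
      then show ?thesis using square_mean_le[OF i1 i2] by simp
    qed
    have "(\<integral>w. (g w - g (w(y := d0)))\<^sup>2 \<partial>P)
        \<le> (\<integral>w. (\<integral>d. (f (w(z := d)) - f ((w(z := d))(y := d0)))\<^sup>2 \<partial>D) \<partial>P)"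
      using pw by (intro Bochner_Integration.integral_mono' integral_resample(2)[OF diff_int]) auto
    also have "\<dots> = (\<integral>w. (f w - f (w(y := d0)))\<^sup>2 \<partial>P)"
      by (rule integral_resample(1)[OF diff_int, symmetric])
    finally show ?thesis .
  qed
  have "(\<integral>w. (f w)\<^sup>2 \<partial>P) - (\<integral>w. f w \<partial>P)\<^sup>2
      \<le> (\<integral>w. (f w - f (w(z := d0)))\<^sup>2 \<partial>P) + ((\<integral>w. (g w)\<^sup>2 \<partial>P) - (\<integral>w. g w \<partial>P)\<^sup>2)"
    using first mean by simp
  also have "(\<integral>w. (g w)\<^sup>2 \<partial>P) - (\<integral>w. g w \<partial>P)\<^sup>2 \<le> (\<Sum>y\<in>J. \<integral>w. (g w - g (w(y := d0)))\<^sup>2 \<partial>P)"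
    by (rule insert.IH[OF g_tame])
  also have "\<dots> \<le> (\<Sum>y\<in>J. \<integral>w. (f w - f (w(y := d0)))\<^sup>2 \<partial>P)"
    by (intro sum_mono rest)
  finally show ?case by (simp only: sum.insert[OF insert.hyps])
qed

end

section \<open>Variance and concentration of the passage time\<close>

context site_moment
begin

lemma tame_FP:
  assumes "i \<le> a" "j \<le> b"
  shows "tame ({i..a} \<times> {j..b}) (\<lambda>w. FP w (i, j) (a, b))"
  unfolding tame_def
proof (intro conjI exI[of _ 0] allI impI)
  show "(\<lambda>w. FP w (i, j) (a, b)) \<in> borel_measurable P" by (rule measurable_FP[OF assms])
  fix w w' :: "site \<Rightarrow> bool \<times> real"
  show "0 \<le> FP w (i, j) (a, b)" by (rule FP_nonneg[OF assms])
  let ?e = "\<lambda>l::nat. (i + int l, j)"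
  have "FP w (i, j) (a, b) \<le> (\<Sum>l=1..nat (a - i). hweight (w (?e l)))" by (rule FP_le_row_sum[OF assms])
  also have "\<dots> = (\<Sum>y\<in>?e ` {1..nat (a - i)}. hweight (w y))"
    by (subst sum.reindex) (auto simp: inj_on_def)
  also have "\<dots> \<le> (\<Sum>y\<in>{i..a} \<times> {j..b}. hweight (w y))"
    using assms by (intro sum_mono2) auto
  finally show "FP w (i, j) (a, b) \<le> 0 + (\<Sum>y\<in>{i..a} \<times> {j..b}. hweight (w y))" by simp
  assume "\<forall>y\<in>{i..a} \<times> {j..b}. w y = w' y"
  then show "FP w (i, j) (a, b) = FP w' (i, j) (a, b)" by (intro FP_cong assms) auto
qed

lemma FP_integrable:
  assumes "i \<le> a" "j \<le> b"
  shows "integrable P (\<lambda>w. FP w (i, j) (a, b))" "integrable P (\<lambda>w. (FP w (i, j) (a, b))\<^sup>2)"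
  using tame_square_integrable(1,2)[OF _ tame_FP[OF assms]] by auto

definition V :: real where "V = (\<integral>d. (hweight d)\<^sup>2 \<partial>D)"

lemma V_nonneg: "0 \<le> V"
  by (simp add: V_def)

lemma off_measurable [measurable]: "Measurable.pred D fst"
proof -
  have "Measurable.pred (count_space UNIV \<Otimes>\<^sub>M (borel :: real measure)) fst" by measurable
  then show ?thesis by (simp cong: measurable_cong_sets add: sets_D)
qed

text \<open>In the Efron-Stein sum only pivotal sites matter. Pivotality of a site is independent of the value at the
  site, and a pivotal site that is off lies on every optimal path, which has \<open>a - i\<close> horizontal edges.\<close>

theorem FP_variance_le:
  assumes ij: "i \<le> a" "j \<le> b" and off: "0 < measure D {d. \<not> fst d}"
  shows "P.variance (\<lambda>w. FP w (i, j) (a, b)) \<le> V / measure D {d. \<not> fst d} * nat (a - i)"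
proof -
  define f where "f = (\<lambda>w. FP w (i, j) (a, b))"
  define J where "J = {i..a} \<times> {j..b}"
  define q where "q = measure D {d. \<not> fst d}"
  define d0 :: "bool \<times> real" where "d0 = (False, 0)"
  have hd0: "hweight d0 = 0" by (simp add: d0_def hweight_def)
  have finJ: "finite J" by (simp add: J_def)
  have tame: "tame J f" unfolding f_def J_def by (rule tame_FP[OF ij])
  note fint = tame_square_integrable[OF finJ tame]
  have [measurable]: "f \<in> borel_measurable P" using fint(2) by simp
  \<comment> \<open>Some large weight at \<open>z\<close> would raise \<open>f\<close> above its
    value for weight zero there. Integer test weights keep the event measurable; the actual value at
    \<open>z\<close> does not enter.\<close>
  define Piv where "Piv = (\<lambda>z w. \<exists>r::nat. f (w(z := d0)) < f (w(z := (True, real r))))"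
  define piv :: "site \<Rightarrow> (site \<Rightarrow> bool \<times> real) \<Rightarrow> real" where "piv = (\<lambda>z w. if Piv z w then 1 else 0)"
  have piv_meas [measurable]: "piv z \<in> borel_measurable P" for z
  proof -
    have [measurable]: "(\<lambda>w. f (w(z := d))) \<in> borel_measurable P" for d by measurable
    have "Measurable.pred P (\<lambda>w. \<exists>r::nat. f (w(z := d0)) < f (w(z := (True, real r))))" by measurable
    then show ?thesis unfolding piv_def Piv_def by measurable
  qed
  have piv01: "0 \<le> piv z w" "piv z w \<le> 1" for z w by (auto simp: piv_def)
  have piv_upd: "piv z (w(z := d)) = piv z w" for z w d unfolding piv_def Piv_def fun_upd_upd ..
  have f_mono: "f w \<le> f w'" if "\<And>y. hweight (w y) \<le> hweight (w' y)" for w w'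
    unfolding f_def using ij that by (intro FP_mono) auto
  have sq: "(f w - f (w(z := d0)))\<^sup>2 \<le> (hweight (w z))\<^sup>2 * piv z w" for z w
  proof -
    have lower: "f (w(z := d0)) \<le> f w" by (rule f_mono) (auto simp: hd0)
    have "f (w(z := w z)) \<le> f (w(z := d0)) + hweight (w z)"
      unfolding f_def by (rule FP_lipschitz[OF ij]) (auto simp: hd0)
    then have upper: "f w \<le> f (w(z := d0)) + hweight (w z)" by simp
    show ?thesis
    proof (cases "Piv z w")
      case True
      then show ?thesis using lower upper by (simp add: piv_def power_mono)
    next
      case False
      have "f w \<le> f (w(z := (True, real (nat \<lceil>hweight (w z)\<rceil>))))"
      proof (rule f_mono)
        fix y
        have "hweight (w z) \<le> real (nat \<lceil>hweight (w z)\<rceil>)" by (rule real_nat_ceiling_ge)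
        moreover have "hweight (True, real r) = real r" for r :: nat by (simp add: hweight_def)
        ultimately show "hweight (w y) \<le> hweight ((w(z := (True, real (nat \<lceil>hweight (w z)\<rceil>)))) y)"
          by (cases "y = z") (simp_all only: fun_upd_apply if_True if_False refl order_refl)
      qed
      then have "f w = f (w(z := d0))" using False lower unfolding Piv_def by (meson not_less order_antisym order_trans)
      then show ?thesis using piv01 by simp
    qed
  qed
  have factor: "integrable P (\<lambda>w. \<phi> (w z) * piv z w)"
     "(\<integral>w. \<phi> (w z) * piv z w \<partial>P) = (\<integral>d. \<phi> d \<partial>D) * (\<integral>w. piv z w \<partial>P)"
    if \<phi>: "integrable D \<phi>" for \<phi> :: "bool \<times> real \<Rightarrow> real" and z
  proof -
    have [measurable]: "\<phi> \<in> borel_measurable D" using \<phi> by simp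
    show int: "integrable P (\<lambda>w. \<phi> (w z) * piv z w)"
    proof (rule Bochner_Integration.integrable_bound)
      show "integrable P (\<lambda>w. \<phi> (w z))" using integral_site(2)[of \<phi> z] \<phi> by simp
      show "AE w in P. norm (\<phi> (w z) * piv z w) \<le> norm (\<phi> (w z))"
        by (intro AE_I2) (simp add: abs_mult piv01 mult_left_le)
    qed measurable
    have "(\<integral>w. \<phi> (w z) * piv z w \<partial>P) = (\<integral>w. (\<integral>d. \<phi> ((w(z := d)) z) * piv z (w(z := d)) \<partial>D) \<partial>P)"
      by (rule integral_resample(1)[OF int])
    also have "\<dots> = (\<integral>w. (\<integral>d. \<phi> d * piv z w \<partial>D) \<partial>P)" by (simp only: piv_upd fun_upd_same)
    finally show "(\<integral>w. \<phi> (w z) * piv z w \<partial>P) = (\<integral>d. \<phi> d \<partial>D) * (\<integral>w. piv z w \<partial>P)" by simp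
  qed
  define off :: "bool \<times> real \<Rightarrow> real" where "off = (\<lambda>d. if fst d then 0 else 1)"
  have off_set: "{d. \<not> fst d} \<in> sets D"
  proof -
    have "{d \<in> space D. \<not> fst d} \<in> sets D" by measurable
    then show ?thesis by simp
  qed
  have off_eq: "off = indicator {d. \<not> fst d}" by (auto simp: off_def indicator_def)
  have off_int: "integrable D off" "(\<integral>d. off d \<partial>D) = q"
    unfolding off_eq q_def using off_set by (auto simp: D.emeasure_eq_measure)
  \<comment> \<open>An off site outside the support \<open>H\<close> is not pivotal: its weight is
    already zero, and raising it leaves the optimal path at its cost.\<close>
  have count: "(\<Sum>z\<in>J. off (w z) * piv z w) \<le> nat (a - i)" for w
  proof -
    obtain H where H: "finite H" "card H \<le> nat (a - i)"
      "\<And>w'. (\<forall>z\<in>H. hweight (w' z) = hweight (w z)) \<Longrightarrow> f w' \<le> f w"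
      using FP_support[OF ij, of w] unfolding f_def by blast
    have "(\<Sum>z\<in>J. off (w z) * piv z w) \<le> (\<Sum>z\<in>J. if z \<in> H then 1 else 0)"
    proof (intro sum_mono)
      fix z
      show "off (w z) * piv z w \<le> (if z \<in> H then 1 else 0)"
      proof (cases "z \<in> H \<or> fst (w z)")
        case True
        then show ?thesis using piv01 by (auto simp: off_def)
      next
        case False
        have "f w \<le> f (w(z := d0))" using False by (intro f_mono) (auto simp: hd0 hweight_def)
        moreover have "f (w(z := (True, real r))) \<le> f w" for r :: nat using False by (intro H(3)) auto
        ultimately have "\<not> Piv z w" unfolding Piv_def by (meson not_less order_trans)
        then show ?thesis by (simp add: piv_def)
      qed
    qed
    also have "\<dots> = card (J \<inter> H)" using finJ by (simp add: sum.If_cases Int_def)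
    also have "\<dots> \<le> card H" using H(1) by (simp add: card_mono)
    finally show ?thesis using H(2) by linarith
  qed
  \<comment> \<open>Since pivotality is independent of the value at the site, the count of off
    pivotal sites bounds the expected number of all pivotal sites.\<close>
  have "q * (\<Sum>z\<in>J. \<integral>w. piv z w \<partial>P) = (\<Sum>z\<in>J. \<integral>w. off (w z) * piv z w \<partial>P)"
    using factor(2)[OF off_int(1)] off_int(2) by (simp add: sum_distrib_left)
  also have "\<dots> = (\<integral>w. (\<Sum>z\<in>J. off (w z) * piv z w) \<partial>P)"
    using factor(1)[OF off_int(1)] by simp
  also have "\<dots> \<le> (\<integral>w. real (nat (a - i)) \<partial>P)"
    using factor(1)[OF off_int(1)] count by (intro integral_mono) auto
  also have "\<dots> = real (nat (a - i))" using P.prob_space by simp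
  finally have piv_sum: "q * (\<Sum>z\<in>J. \<integral>w. piv z w \<partial>P) \<le> real (nat (a - i))" .
  have "P.variance f = (\<integral>w. (f w)\<^sup>2 \<partial>P) - (\<integral>w. f w \<partial>P)\<^sup>2"
    by (rule P.variance_eq[OF fint(2,1)])
  also have "\<dots> \<le> (\<Sum>z\<in>J. \<integral>w. (f w - f (w(z := d0)))\<^sup>2 \<partial>P)"
    by (rule efron_stein[OF finJ tame])
  also have "\<dots> \<le> (\<Sum>z\<in>J. V * (\<integral>w. piv z w \<partial>P))"
  proof (intro sum_mono)
    fix z
    have "(\<integral>w. (f w - f (w(z := d0)))\<^sup>2 \<partial>P) \<le> (\<integral>w. (hweight (w z))\<^sup>2 * piv z w \<partial>P)"
      using factor(1)[OF integrable_hweight_sq] sq by (intro Bochner_Integration.integral_mono') (simp_all add: piv01)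
    also have "\<dots> = V * (\<integral>w. piv z w \<partial>P)" unfolding V_def by (rule factor(2)[OF integrable_hweight_sq])
    finally show "(\<integral>w. (f w - f (w(z := d0)))\<^sup>2 \<partial>P) \<le> V * (\<integral>w. piv z w \<partial>P)" .
  qed
  also have "\<dots> = V / q * (q * (\<Sum>z\<in>J. \<integral>w. piv z w \<partial>P))"
    using off by (simp add: q_def sum_distrib_left)
  also have "\<dots> \<le> V / q * real (nat (a - i))"
    using V_nonneg piv_sum by (intro mult_left_mono) (auto simp: q_def)
  finally show ?thesis unfolding f_def q_def .
qed

definition mean_FP :: "nat \<Rightarrow> nat \<Rightarrow> real" where
  "mean_FP a b = (\<integral>w. FP w (0, 0) (int a, int b) \<partial>P)"

lemma distr_shift: "distr P P (\<lambda>w z. w (fst z + i, snd z + j)) = P"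
proof -
  have "distr (Pi\<^sub>M UNIV (\<lambda>_. D)) (\<Pi>\<^sub>M z\<in>UNIV. D) (\<lambda>w. \<lambda>z\<in>UNIV. w (fst z + i, snd z + j)) = (\<Pi>\<^sub>M z\<in>UNIV. D)"
    by (rule distr_PiM_reindex) (auto simp: prob_space_D inj_on_def)
  then show ?thesis by (simp add: P_def restrict_def)
qed

lemma integral_FP_shift:
  "(\<integral>w. FP w (i, j) (i + int a, j + int b) \<partial>P) = mean_FP a b"
proof -
  have [measurable]: "(\<lambda>w z. w (fst z + i, snd z + j)) \<in> measurable P P"
    unfolding P_def by (rule measurable_PiM_single') auto
  have [measurable]: "(\<lambda>w. FP w (0, 0) (int a, int b)) \<in> borel_measurable P" by (rule measurable_FP) auto
  have "mean_FP a b = (\<integral>w. FP w (0, 0) (int a, int b) \<partial>distr P P (\<lambda>w z. w (fst z + i, snd z + j)))"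
    by (simp add: mean_FP_def distr_shift)
  also have "\<dots> = (\<integral>w. FP (\<lambda>z. w (fst z + i, snd z + j)) (0, 0) (int a, int b) \<partial>P)"
    by (rule integral_distr) measurable
  also have "\<dots> = (\<integral>w. FP w (i, j) (i + int a, j + int b) \<partial>P)"
    by (intro Bochner_Integration.integral_cong refl FP_shift) auto
  finally show ?thesis by simp
qed

text \<open>The variance is of order \<open>k\<^sup>2\<close>, so deviations by \<delta>
  \<open>k\<^sup>2\<close> have probability of order 1 / \<open>k\<^sup>2\<close> by Chebyshev. End
  points, directions and tolerances of the form \<open>1 / Suc n\<close> are countable.\<close>

theorem AE_FP_concentration:
  assumes off: "0 < measure D {d. \<not> fst d}"
  shows "AE w in P. \<forall>x1 x2. \<forall>a b :: nat. \<forall>\<delta>>0. \<exists>k0. \<forall>k\<ge>k0.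
     \<bar>FP w (x1 - int (k\<^sup>2 * a), x2 - int (k\<^sup>2 * b)) (x1, x2) - mean_FP (k\<^sup>2 * a) (k\<^sup>2 * b)\<bar> \<le> \<delta> * (real k)\<^sup>2"
proof -
  have one: "AE w in P. \<forall>\<^sub>F k in sequentially.
     w \<notin> {w. 0 < k \<and> \<delta> * (real k)\<^sup>2 \<le> \<bar>FP w (x1 - int (k\<^sup>2 * a), x2 - int (k\<^sup>2 * b)) (x1, x2) - mean_FP (k\<^sup>2 * a) (k\<^sup>2 * b)\<bar>}"
    if \<delta>: "0 < \<delta>" for x1 x2 and a b :: nat and \<delta> :: real
  proof -
    define q where "q = measure D {d. \<not> fst d}"
    define f where "f = (\<lambda>(k::nat) w. FP w (x1 - int (k\<^sup>2 * a), x2 - int (k\<^sup>2 * b)) (x1, x2))"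
    define M where "M = (\<lambda>k. mean_FP (k\<^sup>2 * a) (k\<^sup>2 * b))"
    let ?A = "\<lambda>k. {w. 0 < k \<and> \<delta> * (real k)\<^sup>2 \<le> \<bar>f k w - M k\<bar>}"
    have fint: "integrable P (f k)" "integrable P (\<lambda>w. (f k w)\<^sup>2)" for k
      unfolding f_def by (rule FP_integrable; simp)+
    have mean: "P.expectation (f k) = M k" for k
      using integral_FP_shift[of "x1 - int (k\<^sup>2 * a)" "x2 - int (k\<^sup>2 * b)" "k\<^sup>2 * a" "k\<^sup>2 * b"]
      unfolding f_def M_def by simp
    have meas [measurable]: "f k \<in> borel_measurable P" for k using fint(1)[of k] by simp
    have set: "?A k \<in> sets P" for k
    proof -
      have "{w \<in> space P. 0 < k \<and> \<delta> * (real k)\<^sup>2 \<le> \<bar>f k w - M k\<bar>} \<in> sets P" by measurable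
      then show ?thesis by simp
    qed
    have bound: "P.prob (?A k) \<le> V * a / (q * \<delta>\<^sup>2) * (1 / (real k)\<^sup>2)" for k
    proof (cases "0 < k")
      case True
      have "P.prob (?A k) = P.prob {w \<in> space P. \<delta> * (real k)\<^sup>2 \<le> \<bar>f k w - P.expectation (f k)\<bar>}"
        using True mean by simp
      also have "\<dots> \<le> P.variance (f k) / (\<delta> * (real k)\<^sup>2)\<^sup>2"
        using fint(2)[of k] \<delta> True by (intro P.Chebyshev_inequality) auto
      also have "\<dots> \<le> (V / q * real (k\<^sup>2 * a)) / (\<delta> * (real k)\<^sup>2)\<^sup>2"
      proof (rule divide_right_mono)
        have "P.variance (f k) \<le> V / q * nat (x1 - (x1 - int (k\<^sup>2 * a)))"
          unfolding f_def q_def by (rule FP_variance_le[OF _ _ off]) auto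
        then show "P.variance (f k) \<le> V / q * real (k\<^sup>2 * a)" by (simp del: of_nat_mult of_nat_power)
      qed simp
      also have "\<dots> = V * a / (q * \<delta>\<^sup>2) * (1 / (real k)\<^sup>2)"
        using True by (simp add: power2_eq_square field_simps)
      finally show ?thesis .
    next
      case False
      then show ?thesis by simp
    qed
    have "summable (\<lambda>k. V * a / (q * \<delta>\<^sup>2) * (1 / (real k)\<^sup>2))"
      using inverse_power_summable[of 2, where ?'a = real] by (intro summable_mult) (simp add: inverse_eq_divide)
    from AE_eventually_not[OF set this bound] show ?thesis unfolding f_def M_def .
  qed
  have "AE w in P. \<forall>x1 x2. \<forall>a b :: nat. \<forall>n::nat. \<forall>\<^sub>F k in sequentially.
     w \<notin> {w. 0 < k \<and> 1 / real (Suc n) * (real k)\<^sup>2 \<le> \<bar>FP w (x1 - int (k\<^sup>2 * a), x2 - int (k\<^sup>2 * b)) (x1, x2) - mean_FP (k\<^sup>2 * a) (k\<^sup>2 * b)\<bar>}"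
    unfolding AE_all_countable by (intro allI one) simp
  then show ?thesis
  proof eventually_elim
    case (elim w)
    show ?case
    proof (intro allI impI)
      fix x1 x2 and a b :: nat and \<delta> :: real assume "0 < \<delta>"
      then obtain n where n: "1 / real (Suc n) < \<delta>" using reals_Archimedean[of \<delta>] by (auto simp: inverse_eq_divide)
      obtain k0 where k0: "\<And>k. k0 \<le> k \<Longrightarrow> w \<notin> {w. 0 < k \<and> 1 / real (Suc n) * (real k)\<^sup>2 \<le> \<bar>FP w (x1 - int (k\<^sup>2 * a), x2 - int (k\<^sup>2 * b)) (x1, x2) - mean_FP (k\<^sup>2 * a) (k\<^sup>2 * b)\<bar>}"
        using elim unfolding eventually_sequentially by blast
      show "\<exists>k0. \<forall>k\<ge>k0. \<bar>FP w (x1 - int (k\<^sup>2 * a), x2 - int (k\<^sup>2 * b)) (x1, x2) - mean_FP (k\<^sup>2 * a) (k\<^sup>2 * b)\<bar> \<le> \<delta> * (real k)\<^sup>2"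
      proof (intro exI[of _ "Suc k0"] allI impI)
        fix k assume "Suc k0 \<le> k"
        then have "k0 \<le> k" "0 < k" by auto
        then have "\<bar>FP w (x1 - int (k\<^sup>2 * a), x2 - int (k\<^sup>2 * b)) (x1, x2) - mean_FP (k\<^sup>2 * a) (k\<^sup>2 * b)\<bar> < 1 / real (Suc n) * (real k)\<^sup>2"
          using k0[of k] by (simp only: mem_Collect_eq not_less[symmetric] de_Morgan_conj) simp
        also have "\<dots> \<le> \<delta> * (real k)\<^sup>2" using n by (intro mult_right_mono) auto
        finally show "\<bar>FP w (x1 - int (k\<^sup>2 * a), x2 - int (k\<^sup>2 * b)) (x1, x2) - mean_FP (k\<^sup>2 * a) (k\<^sup>2 * b)\<bar> \<le> \<delta> * (real k)\<^sup>2"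
          by simp
      qed
    qed
  qed
qed

end

section \<open>Recursion and long jumps for the means\<close>

context site_moment
begin

lemma integral_factor:
  fixes \<phi> :: "bool \<times> real \<Rightarrow> real"
  assumes \<phi> [measurable]: "\<phi> \<in> borel_measurable D" and bound: "\<And>d. \<bar>\<phi> d\<bar> \<le> 1"
    and g: "integrable P g" and const: "\<And>w d. g (w(z := d)) = g w"
  shows "integrable P (\<lambda>w. \<phi> (w z) * g w)"
    and "(\<integral>w. \<phi> (w z) * g w \<partial>P) = (\<integral>d. \<phi> d \<partial>D) * (\<integral>w. g w \<partial>P)"
proof -
  have [measurable]: "g \<in> borel_measurable P" using g by simp
  show int: "integrable P (\<lambda>w. \<phi> (w z) * g w)"
  proof (rule Bochner_Integration.integrable_bound[OF g])
    show "AE w in P. norm (\<phi> (w z) * g w) \<le> norm (g w)"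
      by (intro AE_I2) (simp add: abs_mult mult_left_le_one_le bound)
  qed measurable
  have "(\<integral>w. \<phi> (w z) * g w \<partial>P) = (\<integral>w. (\<integral>d. \<phi> ((w(z := d)) z) * g (w(z := d)) \<partial>D) \<partial>P)"
    by (rule integral_resample(1)[OF int])
  also have "\<dots> = (\<integral>w. (\<integral>d. \<phi> d * g w \<partial>D) \<partial>P)" by (simp only: const fun_upd_same)
  finally show "(\<integral>w. \<phi> (w z) * g w \<partial>P) = (\<integral>d. \<phi> d \<partial>D) * (\<integral>w. g w \<partial>P)" by simp
qed

lemma integral_of_bool:
  assumes "Measurable.pred D q"
  shows "(\<lambda>d. of_bool (q d) :: real) \<in> borel_measurable D" "(\<integral>d. of_bool (q d) \<partial>D) = measure D {d. q d}"
proof -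
  note [measurable] = assms
  show "(\<lambda>d. of_bool (q d) :: real) \<in> borel_measurable D" unfolding of_bool_def by measurable
  have "{d. q d} \<in> sets D" using assms by (simp add: pred_def)
  moreover have "(\<lambda>d. of_bool (q d) :: real) = indicator {d. q d}" by (auto simp: indicator_def)
  ultimately show "(\<integral>d. of_bool (q d) \<partial>D) = measure D {d. q d}" by simp
qed

lemma integral_row_product:
  fixes \<phi> :: "bool \<times> real \<Rightarrow> real"
  assumes \<phi>: "\<phi> \<in> borel_measurable D" "\<And>d. \<bar>\<phi> d\<bar> \<le> 1"
    and g: "integrable P g" and const: "\<And>l w d. g (w((a - int l, b) := d)) = g w"
  shows "integrable P (\<lambda>w. (\<Prod>l=1..k. \<phi> (w (a - int l, b))) * g w)"
    and "(\<integral>w. (\<Prod>l=1..k. \<phi> (w (a - int l, b))) * g w \<partial>P) = (\<integral>d. \<phi> d \<partial>D) ^ k * (\<integral>w. g w \<partial>P)"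
proof -
  have "integrable P (\<lambda>w. (\<Prod>l=1..k. \<phi> (w (a - int l, b))) * g w) \<and>
     (\<integral>w. (\<Prod>l=1..k. \<phi> (w (a - int l, b))) * g w \<partial>P) = (\<integral>d. \<phi> d \<partial>D) ^ k * (\<integral>w. g w \<partial>P)"
  proof (induction k)
    case 0
    then show ?case using g by simp
  next
    case (Suc k)
    let ?h = "\<lambda>w. (\<Prod>l=1..k. \<phi> (w (a - int l, b))) * g w"
    let ?z = "(a - int (Suc k), b)"
    have h_const: "?h (w(?z := d)) = ?h w" for w d
    proof -
      have "(\<Prod>l=1..k. \<phi> ((w(?z := d)) (a - int l, b))) = (\<Prod>l=1..k. \<phi> (w (a - int l, b)))"
        by (intro prod.cong) auto
      then show ?thesis by (simp only: const)
    qed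
    have eq: "(\<lambda>w. (\<Prod>l=1..Suc k. \<phi> (w (a - int l, b))) * g w) = (\<lambda>w. \<phi> (w ?z) * ?h w)"
      by (rule ext) (simp add: mult.commute mult.left_commute)
    show ?case
      unfolding eq using integral_factor[OF \<phi> conjunct1[OF Suc] h_const] Suc by simp
  qed
  then show "integrable P (\<lambda>w. (\<Prod>l=1..k. \<phi> (w (a - int l, b))) * g w)"
    "(\<integral>w. (\<Prod>l=1..k. \<phi> (w (a - int l, b))) * g w \<partial>P) = (\<integral>d. \<phi> d \<partial>D) ^ k * (\<integral>w. g w \<partial>P)" by auto
qed

lemma FP_switched:
  assumes "i < a" "j < b"
  shows "FP w (i, j) (a, b) \<le> of_bool (\<not> fst (w (a, b))) * FP w (i, j) (a - 1, b) + of_bool (fst (w (a, b))) * FP w (i, j) (a, b - 1)"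
  using FP_step[OF assms, of w] assms by (auto simp: hweights_def hweight_def)

lemma FP_zero_run:
  assumes "i \<le> a - int k" "j \<le> b" "\<And>l. l < k \<Longrightarrow> hweight (w (a - int l, b)) = 0"
  shows "FP w (i, j) (a, b) \<le> FP w (i, j) (a - int k, b)"
  using assms
proof (induction k)
  case (Suc k)
  have ik: "i < a - int k" using Suc.prems by simp
  have "FP w (i, j) (a - int k, b) \<le> FP w (i, j) (a - int k - 1, b)"
  proof (cases "j = b")
    case True
    then show ?thesis using FP_row[OF ik, of w j] Suc.prems(3)[of k] by (simp add: hweights_def)
  next
    case False
    then show ?thesis using FP_step[OF ik, of j b w] Suc.prems(2) Suc.prems(3)[of k] by (simp add: hweights_def)
  qed
  moreover have "FP w (i, j) (a, b) \<le> FP w (i, j) (a - int k, b)" using Suc by simp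
  moreover have "a - int (Suc k) = a - int k - 1" by simp
  ultimately show ?case by (simp only:)
qed simp

end

locale switched_law = site_moment +
  fixes \<alpha> :: real
  assumes \<alpha>: "measure D {d. fst d} = \<alpha>" "0 < \<alpha>" "\<alpha> < 1"
begin

lemma prob_off: "measure D {d. \<not> fst d} = 1 - \<alpha>"
proof -
  have "{d. fst d} \<in> D.events" using off_measurable by (simp add: pred_def)
  then show ?thesis using D.prob_neg[of fst] \<alpha>(1) by simp
qed

lemma on_off:
  "(\<lambda>d. of_bool (fst d) :: real) \<in> borel_measurable D" "(\<integral>d. of_bool (fst d) \<partial>D) = \<alpha>"
  "(\<lambda>d. of_bool (\<not> fst d) :: real) \<in> borel_measurable D" "(\<integral>d. of_bool (\<not> fst d) \<partial>D) = 1 - \<alpha>"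
proof -
  have "Measurable.pred D (\<lambda>d. \<not> fst d)" by measurable
  from integral_of_bool[OF this] integral_of_bool[OF off_measurable] 
  show "(\<lambda>d. of_bool (fst d) :: real) \<in> borel_measurable D" "(\<integral>d. of_bool (fst d) \<partial>D) = \<alpha>"
  "(\<lambda>d. of_bool (\<not> fst d) :: real) \<in> borel_measurable D" "(\<integral>d. of_bool (\<not> fst d) \<partial>D) = 1 - \<alpha>"
    using \<alpha>(1) prob_off by auto
qed

lemma FP_origin_integrable: "integrable P (\<lambda>w. FP w (0, 0) (int a, int b))"
  by (rule FP_integrable) auto

lemma FP_switched_integrals:
  shows "integrable P (\<lambda>w. of_bool (\<not> fst (w (int (Suc a), int (Suc b)))) * FP w (0, 0) (int a, int (Suc b)))"
    and "integrable P (\<lambda>w. of_bool (fst (w (int (Suc a), int (Suc b)))) * FP w (0, 0) (int (Suc a), int b))"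
    and "(\<integral>w. of_bool (\<not> fst (w (int (Suc a), int (Suc b)))) * FP w (0, 0) (int a, int (Suc b)) \<partial>P) = (1 - \<alpha>) * mean_FP a (Suc b)"
    and "(\<integral>w. of_bool (fst (w (int (Suc a), int (Suc b)))) * FP w (0, 0) (int (Suc a), int b) \<partial>P) = \<alpha> * mean_FP (Suc a) b"
proof -
  let ?z = "(int (Suc a), int (Suc b))"
  have c: "FP (w(?z := d)) (0, 0) (int a, int (Suc b)) = FP w (0, 0) (int a, int (Suc b))"
     "FP (w(?z := d)) (0, 0) (int (Suc a), int b) = FP w (0, 0) (int (Suc a), int b)" for w d
    by (rule FP_update_outside; simp)+
  note i1 = integral_factor[OF on_off(3) _ FP_origin_integrable c(1)] 
    and i2 = integral_factor[OF on_off(1) _ FP_origin_integrable c(2)]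
  show "integrable P (\<lambda>w. of_bool (\<not> fst (w ?z)) * FP w (0, 0) (int a, int (Suc b)))" by (rule i1(1)) simp
  show "integrable P (\<lambda>w. of_bool (fst (w ?z)) * FP w (0, 0) (int (Suc a), int b))" by (rule i2(1)) simp
  show "(\<integral>w. of_bool (\<not> fst (w ?z)) * FP w (0, 0) (int a, int (Suc b)) \<partial>P) = (1 - \<alpha>) * mean_FP a (Suc b)"
    unfolding mean_FP_def on_off(4)[symmetric] by (rule i1(2)) simp
  show "(\<integral>w. of_bool (fst (w ?z)) * FP w (0, 0) (int (Suc a), int b) \<partial>P) = \<alpha> * mean_FP (Suc a) b"
    unfolding mean_FP_def on_off(2)[symmetric] by (rule i2(2)) simp
qed

lemma mean_FP_step: "mean_FP (Suc a) (Suc b) \<le> (1 - \<alpha>) * mean_FP a (Suc b) + \<alpha> * mean_FP (Suc a) b"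
proof -
  let ?z = "(int (Suc a), int (Suc b))"
  have "mean_FP (Suc a) (Suc b) \<le> (\<integral>w. of_bool (\<not> fst (w ?z)) * FP w (0, 0) (int a, int (Suc b))
       + of_bool (fst (w ?z)) * FP w (0, 0) (int (Suc a), int b) \<partial>P)"
    unfolding mean_FP_def
  proof (rule integral_mono[OF FP_origin_integrable Bochner_Integration.integrable_add[OF FP_switched_integrals(1,2)]])
    fix w
    show "FP w (0, 0) ?z \<le> of_bool (\<not> fst (w ?z)) * FP w (0, 0) (int a, int (Suc b))
       + of_bool (fst (w ?z)) * FP w (0, 0) (int (Suc a), int b)"
      using FP_switched[of 0 "int (Suc a)" 0 "int (Suc b)" w] by simp
  qed
  then show ?thesis
    by (simp only: Bochner_Integration.integral_add[OF FP_switched_integrals(1,2)] FP_switched_integrals(3,4))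
qed

lemma ex_prob_bounded: "\<exists>C\<ge>0. 0 < measure D {d. fst d \<and> \<bar>snd d\<bar> \<le> C}"
proof (rule ccontr)
  assume "\<not> ?thesis"
  then have zero: "measure D {d. fst d \<and> \<bar>snd d\<bar> \<le> real n} = 0" for n
    using measure_nonneg[of D "{d. fst d \<and> \<bar>snd d\<bar> \<le> real n}"] by (auto simp: not_less intro: order_antisym)
  have meas: "{d. fst d \<and> \<bar>snd d\<bar> \<le> real n} \<in> sets D" for n
  proof -
    have "{d \<in> space D. fst d \<and> \<bar>snd d\<bar> \<le> real n} \<in> sets D" by measurable
    then show ?thesis by simp
  qed
  have "{d :: bool \<times> real. fst d} = (\<Union>n. {d. fst d \<and> \<bar>snd d\<bar> \<le> real n})"
    using real_arch_simple by auto
  moreover have "emeasure D (\<Union>n. {d. fst d \<and> \<bar>snd d\<bar> \<le> real n}) = 0"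
    using zero meas by (intro emeasure_UN_eq_0) (auto simp: D.emeasure_eq_measure)
  ultimately have "measure D {d. fst d} = 0" by (simp add: measure_def)
  then show False using \<alpha> by simp
qed

text \<open>The jump event: the end site is on with weight at most C and the k sites to its left are
  off, with probability \<pi> (1 - \<alpha>)^k. One edge of cost at most C, k free ones and a free
  step down then lead back \<open>Suc k\<close> columns. As the end site is on, the event is taken
  out of the share \<alpha>.\<close>

lemma mean_FP_jump:
  "\<exists>C. \<forall>k. \<exists>\<kappa>>0. \<kappa> \<le> \<alpha> \<and> (\<forall>a b. Suc k \<le> a \<longrightarrow>
     mean_FP a (Suc b) \<le> (1 - \<alpha>) * mean_FP (a - 1) (Suc b) + (\<alpha> - \<kappa>) * mean_FP a b + \<kappa> * (mean_FP (a - Suc k) b + C))"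
proof -
  obtain C where C: "0 \<le> C" "0 < measure D {d. fst d \<and> \<bar>snd d\<bar> \<le> C}" using ex_prob_bounded by auto
  define \<pi> where "\<pi> = measure D {d. fst d \<and> \<bar>snd d\<bar> \<le> C}"
  define near :: "bool \<times> real \<Rightarrow> real" where "near = (\<lambda>d. of_bool (fst d \<and> \<bar>snd d\<bar> \<le> C))"
  have near: "near \<in> borel_measurable D" "(\<integral>d. near d \<partial>D) = \<pi>" "\<bar>near d\<bar> \<le> 1" for d
  proof -
    have "Measurable.pred D (\<lambda>d. fst d \<and> \<bar>snd d\<bar> \<le> C)" by measurable
    from integral_of_bool[OF this] show "near \<in> borel_measurable D" "(\<integral>d. near d \<partial>D) = \<pi>"
      by (simp_all only: near_def \<pi>_def)
  qed (simp add: near_def)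
  have \<pi>: "0 < \<pi>" "\<pi> \<le> \<alpha>"
  proof -
    show "0 < \<pi>" using C by (simp add: \<pi>_def)
    have "{d. fst d} \<in> D.events" using off_measurable by (simp add: pred_def)
    then show "\<pi> \<le> \<alpha>" unfolding \<pi>_def \<alpha>(1)[symmetric] by (intro D.finite_measure_mono) auto
  qed
  have "mean_FP a (Suc b) \<le> (1 - \<alpha>) * mean_FP (a - 1) (Suc b) + (\<alpha> - \<pi> * (1 - \<alpha>) ^ k) * mean_FP a b
       + \<pi> * (1 - \<alpha>) ^ k * (mean_FP (a - Suc k) b + C)" if ka: "Suc k \<le> a" for k a b
  proof -
    obtain a' where a': "a = Suc a'" using ka by (cases a) auto
    define z :: site where "z = (int a, int (Suc b))"
    define R :: "(site \<Rightarrow> bool \<times> real) \<Rightarrow> real" where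
      "R = (\<lambda>w. \<Prod>l=1..k. of_bool (\<not> fst (w (int a - int l, int (Suc b)))))"
    have R_app: "R w = (\<Prod>l=1..k. of_bool (\<not> fst (w (int a - int l, int (Suc b)))))" for w
      by (simp add: R_def)
    have R_const: "R (w(z := d)) = R w" for w d
      unfolding R_def z_def by (intro prod.cong) auto
    have R01: "R w = 0 \<or> R w = 1" for w
      unfolding R_def of_bool_def by (induction k) auto
    have prod: "integrable P (\<lambda>w. near (w z) * (R w * g w))"
      "(\<integral>w. near (w z) * (R w * g w) \<partial>P) = \<pi> * (1 - \<alpha>) ^ k * (\<integral>w. g w \<partial>P)"
      if g: "integrable P g" and g_const: "\<And>l w d. g (w((int a - int l, int (Suc b)) := d)) = g w" for g
    proof -
      have abs1: "\<bar>of_bool (\<not> fst (d :: bool \<times> real)) :: real\<bar> \<le> 1" for d by simp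
      note r = integral_row_product[OF on_off(3) abs1 g g_const, of k, folded R_app, unfolded on_off(4)]
      have c: "R (w(z := d)) * g (w(z := d)) = R w * g w" for w d
        using g_const[of w 0 d] R_const by (simp add: z_def)
      show "integrable P (\<lambda>w. near (w z) * (R w * g w))"
        by (rule integral_factor(1)[OF near(1,3) r(1) c])
      show "(\<integral>w. near (w z) * (R w * g w) \<partial>P) = \<pi> * (1 - \<alpha>) ^ k * (\<integral>w. g w \<partial>P)"
        using integral_factor(2)[OF near(1,3) r(1) c] r(2) near(2) by simp
    qed
    define g1 where "g1 = (\<lambda>w. FP w (0, 0) (int a, int b))"
    define g2 where "g2 = (\<lambda>w. FP w (0, 0) (int (a - Suc k), int b) + C)"
    have g1: "integrable P g1" "(\<integral>w. g1 w \<partial>P) = mean_FP a b"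
      unfolding g1_def mean_FP_def by (auto intro: FP_origin_integrable)
    have g2: "integrable P g2" "(\<integral>w. g2 w \<partial>P) = mean_FP (a - Suc k) b + C"
      unfolding g2_def mean_FP_def using FP_origin_integrable[of "a - Suc k" b] P.prob_space by simp_all
    have gc: "g1 (w((int a - int l, int (Suc b)) := d)) = g1 w" "g2 (w((int a - int l, int (Suc b)) := d)) = g2 w" for l w d
      unfolding g1_def g2_def by (simp_all add: FP_update_outside)
    note p1 = prod[OF g1(1) gc(1)] and p2 = prod[OF g2(1) gc(2)]
    define f1 where "f1 = (\<lambda>w. of_bool (\<not> fst (w z)) * FP w (0, 0) (int a', int (Suc b)))"
    define f2 where "f2 = (\<lambda>w. of_bool (fst (w z)) * FP w (0, 0) (int a, int b))"
    have f: "integrable P f1" "integrable P f2"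
       "(\<integral>w. f1 w \<partial>P) = (1 - \<alpha>) * mean_FP a' (Suc b)" "(\<integral>w. f2 w \<partial>P) = \<alpha> * mean_FP a b"
      unfolding f1_def f2_def z_def a' by (rule FP_switched_integrals)+
    \<comment> \<open>On the event \<open>f1\<close> vanishes and \<open>f2\<close> equals
      \<open>g1\<close>, so this says that \<open>FP\<close> is at most \<open>g2\<close>; elsewhere
      it is \<open>FP_switched\<close>.\<close>
    have pw: "FP w (0, 0) z + near (w z) * (R w * g1 w) \<le> f1 w + f2 w + near (w z) * (R w * g2 w)" for w
    proof (cases "near (w z) = 1 \<and> R w = 1")
      case True
      then have nz: "fst (w z)" "\<bar>snd (w z)\<bar> \<le> C" by (auto simp: near_def split: if_splits)
      have "\<forall>l\<in>{1..k}. \<not> fst (w (int a - int l, int (Suc b)))"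
      proof (rule ccontr)
        assume "\<not> ?thesis"
        then have "R w = 0" unfolding R_def by (intro prod_zero) auto
        then show False using True by simp
      qed
      then have off: "\<not> fst (w (int a - int l, int (Suc b)))" if "1 \<le> l" "l \<le> k" for l using that by auto
      have "FP w (0, 0) (int a - 1, int (Suc b)) \<le> FP w (0, 0) (int a - 1 - int k, int (Suc b))"
      proof (rule FP_zero_run)
        fix l assume "l < k"
        then show "hweight (w (int a - 1 - int l, int (Suc b))) = 0"
          using off[of "Suc l"] by (simp add: hweight_def diff_diff_eq)
      qed (use ka in auto)
      also have "\<dots> \<le> FP w (0, 0) (int a - 1 - int k, int b)"
        using FP_mono_up[of 0 "int a - 1 - int k" 0 "int (Suc b)" w] ka by simp
      also have "int a - 1 - int k = int (a - Suc k)" using ka by simp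
      finally have "FP w (0, 0) (int a - 1, int (Suc b)) + C \<le> g2 w" by (simp add: g2_def)
      moreover have "FP w (0, 0) z \<le> FP w (0, 0) (int a - 1, int (Suc b)) + C"
        using FP_step[of 0 "int a" 0 "int (Suc b)" w] ka nz by (simp add: z_def hweights_def hweight_def)
      ultimately show ?thesis using True nz by (simp add: f1_def f2_def g1_def)
    next
      case False
      then have "near (w z) * R w = 0" using R01[of w] by (auto simp: near_def)
      then have "near (w z) * (R w * g1 w) = 0" "near (w z) * (R w * g2 w) = 0" by auto
      moreover have "FP w (0, 0) z \<le> f1 w + f2 w"
        using FP_switched[of 0 "int a" 0 "int (Suc b)" w] a' by (simp add: f1_def f2_def z_def)
      ultimately show ?thesis by linarith
    qed
    have "mean_FP a (Suc b) + \<pi> * (1 - \<alpha>) ^ k * mean_FP a b = (\<integral>w. FP w (0, 0) z + near (w z) * (R w * g1 w) \<partial>P)"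
      using p1 g1(2) FP_origin_integrable[of a "Suc b"] by (simp add: mean_FP_def z_def)
    also have "\<dots> \<le> (\<integral>w. f1 w + f2 w + near (w z) * (R w * g2 w) \<partial>P)"
      using p1 p2 f FP_origin_integrable[of a "Suc b"] by (intro integral_mono pw) (auto simp: z_def)
    also have "\<dots> = (1 - \<alpha>) * mean_FP a' (Suc b) + \<alpha> * mean_FP a b + \<pi> * (1 - \<alpha>) ^ k * (mean_FP (a - Suc k) b + C)"
      using p2 f g2 by simp
    finally show ?thesis by (simp add: a' left_diff_distrib)
  qed
  moreover have "0 < \<pi> * (1 - \<alpha>) ^ k" "\<pi> * (1 - \<alpha>) ^ k \<le> \<alpha>" for k
  proof -
    show "0 < \<pi> * (1 - \<alpha>) ^ k" using \<pi> \<alpha> by simp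
    have "\<pi> * (1 - \<alpha>) ^ k \<le> \<pi> * 1" using \<pi> \<alpha> by (intro mult_left_mono power_le_one) auto
    then show "\<pi> * (1 - \<alpha>) ^ k \<le> \<alpha>" using \<pi> by linarith
  qed
  ultimately show ?thesis by (intro exI[of _ C] allI exI[of _ "\<pi> * (1 - \<alpha>) ^ k" for k]) auto
qed

lemma mean_profile_mean_FP: "mean_profile mean_FP \<alpha> \<mu>"
proof
  show "0 < \<alpha>" "\<alpha> < 1" "0 \<le> \<mu>" using \<alpha> \<mu>_nonneg by auto
  fix a b c d :: nat
  show "0 \<le> mean_FP a b" unfolding mean_FP_def by (intro Bochner_Integration.integral_nonneg FP_nonneg) auto
  show "mean_FP 0 b = 0" by (simp add: mean_FP_def FP_col0)
  show "mean_FP (Suc a) (Suc b) \<le> (1 - \<alpha>) * mean_FP a (Suc b) + \<alpha> * mean_FP (Suc a) b" by (rule mean_FP_step)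
  have "mean_FP (a + c) (b + d) \<le> (\<integral>w. FP w (0, 0) (int a, int b) + FP w (int a, int b) (int a + int c, int b + int d) \<partial>P)"
    unfolding mean_FP_def
  proof (rule integral_mono[OF FP_origin_integrable])
    show "integrable P (\<lambda>w. FP w (0, 0) (int a, int b) + FP w (int a, int b) (int a + int c, int b + int d))"
      by (intro Bochner_Integration.integrable_add FP_integrable) auto
    show "FP w (0, 0) (int (a + c), int (b + d)) \<le> FP w (0, 0) (int a, int b) + FP w (int a, int b) (int a + int c, int b + int d)" for w
      using passage_time_triangle[of 0 "int a" 0 "int b" "int a + int c" "int b + int d" "hweights w"] by simp
  qed
  also have "\<dots> = mean_FP a b + mean_FP c d"
    using FP_integrable(1)[of "int a" "int a + int c" "int b" "int b + int d"] FP_origin_integrable[of a b]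
      integral_FP_shift[of "int a" "int b" c d] by (simp add: mean_FP_def[of a b])
  finally show "mean_FP (a + c) (b + d) \<le> mean_FP a b + mean_FP c d" .
  have hint: "integrable P (\<lambda>w. hweight (w z))" for z using integral_site(2)[of hweight z] integrable_hweight by simp
  have "mean_FP a 0 \<le> (\<integral>w. (\<Sum>l=1..a. hweight (w (int l, 0))) \<partial>P)"
    unfolding mean_FP_def
  proof (rule integral_mono[OF FP_origin_integrable])
    show "FP w (0, 0) (int a, int 0) \<le> (\<Sum>l=1..a. hweight (w (int l, 0)))" for w
      using FP_le_row_sum[of 0 "int a" 0 0 w] by simp
  qed (use hint in auto)
  also have "\<dots> = \<mu> * a" using hint integral_site(1)[of hweight] by (simp add: \<mu>_def)
  finally show "mean_FP a 0 \<le> \<mu> * a" .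
qed (rule mean_FP_jump)

end

section \<open>Linear growth of the mean from Laplace transforms\<close>

context site_moment
begin

lemma exp_FP_integrable:
  assumes "0 \<le> \<theta>"
  shows "integrable P (\<lambda>w. exp (- \<theta> * FP w (0, 0) (int a, int b)))"
proof (rule P.integrable_const_bound[where B = 1])
  have [measurable]: "(\<lambda>w. FP w (0, 0) (int a, int b)) \<in> borel_measurable P" by (rule measurable_FP) auto
  show "(\<lambda>w. exp (- \<theta> * FP w (0, 0) (int a, int b))) \<in> borel_measurable P" by measurable
  have "0 \<le> \<theta> * FP w (0, 0) (int a, int b)" for w using assms FP_nonneg[of 0 "int a" 0 "int b" w] by simp
  then show "AE w in P. norm (exp (- \<theta> * FP w (0, 0) (int a, int b))) \<le> 1" by simp
qed

lemma ex_small_laplace: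
  assumes "0 < \<epsilon>"
  shows "\<exists>\<theta>>0. (\<integral>d. (if hweight d = 0 then 0 else exp (- \<theta> * hweight d)) \<partial>D) < \<epsilon>"
proof -
  have "(\<lambda>n. \<integral>d. (if hweight d = 0 then 0 else exp (- real n * hweight d)) \<partial>D) \<longlonglongrightarrow> (\<integral>d. 0 \<partial>D)"
  proof (rule integral_dominated_convergence[where w = "\<lambda>_. 1"])
    show "AE d in D. (\<lambda>n. if hweight d = 0 then 0 else exp (- real n * hweight d)) \<longlonglongrightarrow> 0"
    proof (rule AE_I2)
      fix d
      show "(\<lambda>n. if hweight d = 0 then 0 else exp (- real n * hweight d)) \<longlonglongrightarrow> 0"
      proof (cases "hweight d = 0")
        case False
        then have "0 < hweight d" by (simp add: less_le)
        then have "(\<lambda>n. exp (- real n * hweight d)) \<longlonglongrightarrow> 0" by real_asymp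
        then show ?thesis using False by simp
      qed simp
    qed
    show "AE d in D. norm (if hweight d = 0 then 0 else exp (- real n * hweight d)) \<le> 1" for n
      by (intro AE_I2) simp
    show "(\<lambda>d. if hweight d = 0 then 0 else exp (- real n * hweight d)) \<in> borel_measurable D" for n by measurable
  qed auto
  then have "\<forall>\<^sub>F n in sequentially. (\<integral>d. (if hweight d = 0 then 0 else exp (- real n * hweight d)) \<partial>D) < \<epsilon>"
    using assms by (intro order_tendstoD) auto
  then have "\<forall>\<^sub>F n in sequentially. 0 < n \<and> (\<integral>d. (if hweight d = 0 then 0 else exp (- real n * hweight d)) \<partial>D) < \<epsilon>"
    using eventually_gt_at_top[of 0] by eventually_elim simp
  then obtain n where "0 < n" "(\<integral>d. (if hweight d = 0 then 0 else exp (- real n * hweight d)) \<partial>D) < \<epsilon>"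
    by (auto dest: eventually_happens)
  then show ?thesis by (intro exI[of _ "real n"]) simp
qed

text \<open>The sites with non-zero weight have density \<open>\<beta>\<close>; linear growth holds as soon as
  the direction is flatter than \<open>(1 - \<beta>, \<beta>)\<close>.\<close>

lemma laplace_FP_le:
  fixes u \<theta> :: real
  defines "\<beta> \<equiv> measure D {d. hweight d \<noteq> 0}"
  assumes l: "0 < u" "u \<le> 1" and \<theta>: "0 < \<theta>"
    and small: "(\<integral>d. (if hweight d = 0 then 0 else exp (- \<theta> * hweight d)) \<partial>D) * exp u \<le> u\<^sup>2"
  shows "(\<integral>w. exp (- \<theta> * FP w (0, 0) (int a, int b)) \<partial>P) \<le> exp (- u * drift \<beta> (real a) (real b) + 2 * u\<^sup>2 * (real a + real b))"
proof -
  define \<delta> where "\<delta> = (\<integral>d. (if hweight d = 0 then 0 else exp (- \<theta> * hweight d)) \<partial>D)"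
  define Z where "Z = (\<lambda>a b. \<integral>w. exp (- \<theta> * FP w (0, 0) (int a, int b)) \<partial>P)"
  define E where "E = (\<lambda>(a :: nat) (b :: nat). exp (- u * drift \<beta> (real a) (real b) + 2 * u\<^sup>2 * (real a + real b)))"
  have \<beta>: "0 \<le> \<beta>" "\<beta> \<le> 1" by (auto simp: \<beta>_def)
  have \<delta>0: "0 \<le> \<delta>" unfolding \<delta>_def by (intro Bochner_Integration.integral_nonneg) simp
  define up :: "bool \<times> real \<Rightarrow> real" where "up = (\<lambda>d. of_bool (hweight d \<noteq> 0))"
  define left :: "bool \<times> real \<Rightarrow> real" where "left = (\<lambda>d. exp (- \<theta> * hweight d))"
  have "Measurable.pred D (\<lambda>d. hweight d \<noteq> 0)" by measurable
  note up_int = integral_of_bool[OF this, folded up_def \<beta>_def]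
  have left_meas: "left \<in> borel_measurable D" unfolding left_def by measurable
  have abs: "\<bar>up d\<bar> \<le> 1" "\<bar>left d\<bar> \<le> 1" for d using \<theta> by (auto simp: up_def left_def)
  have left_int: "(\<integral>d. left d \<partial>D) = 1 - \<beta> + \<delta>"
  proof -
    have [measurable]: "up \<in> borel_measurable D" by (rule up_int(1))
    have i1: "integrable D up" by (rule D.integrable_const_bound[where B = 1]) (use abs in auto)
    have i2: "integrable D (\<lambda>d. if hweight d = 0 then 0 else exp (- \<theta> * hweight d))"
      by (rule D.integrable_const_bound[where B = 1]) (use \<theta> in auto)
    have "(\<integral>d. left d \<partial>D) = (\<integral>d. (1 - up d) + (if hweight d = 0 then 0 else exp (- \<theta> * hweight d)) \<partial>D)"
      by (intro Bochner_Integration.integral_cong) (auto simp: left_def up_def)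
    also have "\<dots> = 1 - \<beta> + \<delta>"
      using i1 i2 up_int(2) D.prob_space by (simp add: \<delta>_def)
    finally show ?thesis .
  qed
  have const: "exp (- \<theta> * FP (w((int (Suc a), int b) := d)) (0, 0) (int a, int b)) = exp (- \<theta> * FP w (0, 0) (int a, int b))"
    for a b w d by (simp add: FP_update_outside)
  have const2: "exp (- \<theta> * FP (w((int (Suc a), int (Suc b)) := d)) (0, 0) (int (Suc a), int b)) = exp (- \<theta> * FP w (0, 0) (int (Suc a), int b))"
    for a b w d by (simp add: FP_update_outside)
  note left_fac = integral_factor[OF left_meas abs(2) exp_FP_integrable[OF less_imp_le[OF \<theta>]] const]
    and up_fac = integral_factor[OF up_int(1) abs(1) exp_FP_integrable[OF less_imp_le[OF \<theta>]] const2]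
  have E_left: "E a b = E (Suc a) b * exp (- 2 * u\<^sup>2) * exp (u * \<beta>)" for a b
    by (simp add: E_def drift_def algebra_simps flip: exp_add)
  have E_up: "E (Suc a) b = E (Suc a) (Suc b) * exp (- 2 * u\<^sup>2) * exp (- u * (1 - \<beta>))" for a b
    by (simp add: E_def drift_def algebra_simps flip: exp_add)
  \<comment> \<open>Makes \<open>E\<close> a supersolution: \<open>bernoulli_mgf_le\<close> gives
    exp(u^2), crossing positive weights adds at most u^2 by \<open>small\<close>, and the 2 in the
    exponent has room for both.\<close>
  have factor: "exp (u * \<beta>) * (1 - \<beta> + \<delta>) + exp (- u * (1 - \<beta>)) * \<beta> \<le> exp (2 * u\<^sup>2)"
  proof -
    have "\<beta> * exp (- u * (1 - \<beta>)) + (1 - \<beta>) * exp (- (- u) * \<beta>) \<le> exp ((- u)\<^sup>2)"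
      using l \<beta> by (intro bernoulli_mgf_le) auto
    moreover have "exp (u * \<beta>) * \<delta> \<le> exp u * \<delta>"
      using l \<beta> \<delta>0 by (intro mult_right_mono) (auto intro: mult_left_le)
    ultimately have "exp (u * \<beta>) * (1 - \<beta> + \<delta>) + exp (- u * (1 - \<beta>)) * \<beta> \<le> exp (u\<^sup>2) + u\<^sup>2"
      using small unfolding \<delta>_def[symmetric] by (simp add: algebra_simps)
    also have "\<dots> \<le> exp (u\<^sup>2) + u\<^sup>2 * exp (u\<^sup>2)"
      by (simp add: mult_le_cancel_left1)
    also have "\<dots> = (1 + u\<^sup>2) * exp (u\<^sup>2)" by (simp add: algebra_simps)
    also have "\<dots> \<le> exp (u\<^sup>2) * exp (u\<^sup>2)" by (intro mult_right_mono) auto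
    also have "\<dots> = exp (2 * u\<^sup>2)" unfolding exp_add[symmetric] by simp
    finally show ?thesis .
  qed
  have E_pos: "0 \<le> E a b" for a b by (simp add: E_def)
  have row_le: "exp (- \<theta> * FP w (0, 0) (int (Suc a), int 0)) \<le> left (w (int (Suc a), int 0)) * exp (- \<theta> * FP w (0, 0) (int a, int 0))" for w a
    using FP_row[of 0 "int (Suc a)" w 0] by (simp add: left_def hweights_def algebra_simps flip: exp_add)
  \<comment> \<open>The exponential of minus a minimum is at most the sum of both exponentials. At
    weight zero the left term alone suffices by \<open>FP_mono_right\<close>, so \<open>up\<close>
    may vanish there; this is where the density \<beta> comes from.\<close>
  have step_le: "exp (- \<theta> * FP w (0, 0) (int (Suc a), int (Suc b)))
     \<le> left (w (int (Suc a), int (Suc b))) * exp (- \<theta> * FP w (0, 0) (int a, int (Suc b)))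
       + up (w (int (Suc a), int (Suc b))) * exp (- \<theta> * FP w (0, 0) (int (Suc a), int b))" for w a b
  proof (cases "hweight (w (int (Suc a), int (Suc b))) = 0")
    case True
    have "FP w (0, 0) (int a, int (Suc b)) \<le> FP w (0, 0) (int (Suc a), int (Suc b))"
      using FP_mono_right[of 0 "int (Suc a)" 0 "int (Suc b)" w] by simp
    then show ?thesis using True \<theta> by (simp add: left_def up_def)
  next
    case False
    have "FP w (0, 0) (int (Suc a), int (Suc b)) = min (FP w (0, 0) (int a, int (Suc b)) + hweight (w (int (Suc a), int (Suc b)))) (FP w (0, 0) (int (Suc a), int b))"
      using FP_step[of 0 "int (Suc a)" 0 "int (Suc b)" w] by (simp add: hweights_def)
    then show ?thesis using False by (auto simp: min_def left_def up_def algebra_simps simp flip: exp_add)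
  qed
  have "Z a b \<le> E a b"
  proof (induction b arbitrary: a)
    case 0
    show ?case
    proof (induction a)
      case 0
      then show ?case using P.prob_space by (simp add: Z_def E_def drift_def)
    next
      case (Suc a)
      have "Z (Suc a) 0 \<le> (\<integral>w. left (w (int (Suc a), int 0)) * exp (- \<theta> * FP w (0, 0) (int a, int 0)) \<partial>P)"
        unfolding Z_def by (rule integral_mono[OF exp_FP_integrable left_fac(1) row_le]) (use \<theta> in auto)
      also have "\<dots> = (1 - \<beta> + \<delta>) * Z a 0" unfolding Z_def left_int[symmetric] by (rule left_fac(2))
      also have "\<dots> \<le> (1 - \<beta> + \<delta>) * E a 0" using Suc \<beta> \<delta>0 by (intro mult_left_mono) auto
      also have "\<dots> = E (Suc a) 0 * exp (- 2 * u\<^sup>2) * (exp (u * \<beta>) * (1 - \<beta> + \<delta>))"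
        by (simp only: E_left[of a 0] ac_simps)
      also have "\<dots> \<le> E (Suc a) 0 * exp (- 2 * u\<^sup>2) * exp (2 * u\<^sup>2)"
      proof (rule mult_left_mono)
        have "0 \<le> exp (- u * (1 - \<beta>)) * \<beta>" using \<beta> by simp
        then show "exp (u * \<beta>) * (1 - \<beta> + \<delta>) \<le> exp (2 * u\<^sup>2)" using factor by linarith
      qed (simp add: E_pos)
      also have "\<dots> = E (Suc a) 0" by (simp add: mult.assoc flip: exp_add)
      finally show ?case .
    qed
  next
    case (Suc b)
    show ?case
    proof (induction a)
      case 0
      have "0 \<le> - u * drift \<beta> (real 0) (real (Suc b)) + 2 * u\<^sup>2 * (real 0 + real (Suc b))"
        using l \<beta> by (auto simp: drift_def intro!: add_nonneg_nonneg mult_nonneg_nonneg)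
      then show ?case using P.prob_space by (simp add: Z_def E_def FP_col0)
    next
      case (Suc a)
      have "Z (Suc a) (Suc b) \<le> (\<integral>w. left (w (int (Suc a), int (Suc b))) * exp (- \<theta> * FP w (0, 0) (int a, int (Suc b)))
           + up (w (int (Suc a), int (Suc b))) * exp (- \<theta> * FP w (0, 0) (int (Suc a), int b)) \<partial>P)"
        unfolding Z_def
        by (rule integral_mono[OF exp_FP_integrable Bochner_Integration.integrable_add[OF left_fac(1) up_fac(1)] step_le]) (use \<theta> in auto)
      also have "\<dots> = (1 - \<beta> + \<delta>) * Z a (Suc b) + \<beta> * Z (Suc a) b"
        unfolding Z_def by (simp only: Bochner_Integration.integral_add[OF left_fac(1) up_fac(1)] left_fac(2) up_fac(2) left_int up_int(2))
      also have "\<dots> \<le> (1 - \<beta> + \<delta>) * E a (Suc b) + \<beta> * E (Suc a) b"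
        using Suc.IH \<open>\<And>a. Z a b \<le> E a b\<close> \<beta> \<delta>0 by (intro add_mono mult_left_mono) auto
      also have "\<dots> = E (Suc a) (Suc b) * exp (- 2 * u\<^sup>2) * (exp (u * \<beta>) * (1 - \<beta> + \<delta>) + exp (- u * (1 - \<beta>)) * \<beta>)"
      proof -
        have "x * (e * k * p) + y * (e * k * q) = e * k * (p * x + q * y)" for x y e k p q :: real
          by (simp add: algebra_simps)
        then show ?thesis unfolding E_left[of a "Suc b"] E_up[of a b] .
      qed
      also have "\<dots> \<le> E (Suc a) (Suc b) * exp (- 2 * u\<^sup>2) * exp (2 * u\<^sup>2)"
        using factor by (intro mult_left_mono) (simp_all add: E_pos)
      also have "\<dots> = E (Suc a) (Suc b)" by (simp add: mult.assoc flip: exp_add)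
      finally show ?case .
    qed
  qed
  then show ?thesis by (simp only: Z_def E_def)
qed

text \<open>Jensen's inequality turns the exponentially small Laplace transform, at a \<theta> that
  does not depend on n, into a linear lower bound for the mean.\<close>

lemma mean_FP_linear:
  assumes d: "0 < drift (measure D {d. hweight d \<noteq> 0}) (real a) (real b)"
  shows "\<exists>c>0. \<forall>n::nat. real n * c \<le> mean_FP (n * a) (n * b)"
proof -
  define \<beta> where "\<beta> = measure D {d. hweight d \<noteq> 0}"
  define r where "r = drift \<beta> (real a) (real b)"
  have r: "0 < r" using d by (simp add: r_def \<beta>_def)
  then have ab: "0 < real a + real b" by (cases "a + b = 0") (auto simp: r_def drift_def)
  \<comment> \<open>Lets the quadratic term 2 l^2 (a + b) consume at most half of the linear gain l
    r.\<close>
  define l where "l = min 1 (r / (4 * (real a + real b)))"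
  have l: "0 < l" "l \<le> 1" using r ab by (auto simp: l_def)
  have "l \<le> r / (4 * (real a + real b))" by (simp add: l_def)
  then have l2: "2 * (l * (real a + real b)) \<le> r / 2" using ab by (simp add: field_simps)
  obtain \<theta> where \<theta>: "0 < \<theta>" "(\<integral>d. (if hweight d = 0 then 0 else exp (- \<theta> * hweight d)) \<partial>D) < l\<^sup>2 / exp l"
    using ex_small_laplace[of "l\<^sup>2 / exp l"] l by auto
  then have small: "(\<integral>d. (if hweight d = 0 then 0 else exp (- \<theta> * hweight d)) \<partial>D) * exp l \<le> l\<^sup>2"
    by (simp add: field_simps)
  have "n * (l * r / 2 / \<theta>) \<le> mean_FP (n * a) (n * b)" for n :: nat
  proof -
    define F where "F = (\<lambda>w. FP w (0, 0) (int (n * a), int (n * b)))"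
    define M where "M = mean_FP (n * a) (n * b)"
    have Fint: "integrable P F" unfolding F_def by (rule FP_integrable) auto
    have FM: "(\<integral>w. F w \<partial>P) = M" by (simp add: F_def M_def mean_FP_def)
    \<comment> \<open>Jensen's inequality by hand, with the tangent at the mean M.\<close>
    have "exp (- \<theta> * M) = (\<integral>w. exp (- \<theta> * M) * (1 - \<theta> * (F w - M)) \<partial>P)"
      using Fint FM P.prob_space by simp
    also have "\<dots> \<le> (\<integral>w. exp (- \<theta> * F w) \<partial>P)"
    proof (rule integral_mono)
      show "integrable P (\<lambda>w. exp (- \<theta> * M) * (1 - \<theta> * (F w - M)))" using Fint by simp
      show "integrable P (\<lambda>w. exp (- \<theta> * F w))" unfolding F_def using \<theta> by (intro exp_FP_integrable) auto
      fix w
      have "exp (- \<theta> * M) * (1 + (- \<theta> * (F w - M))) \<le> exp (- \<theta> * M) * exp (- \<theta> * (F w - M))"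
        by (intro mult_left_mono exp_ge_add_one_self) auto
      also have "\<dots> = exp (- \<theta> * F w)" by (simp add: algebra_simps flip: exp_add)
      finally show "exp (- \<theta> * M) * (1 - \<theta> * (F w - M)) \<le> exp (- \<theta> * F w)" by simp
    qed
    also have "\<dots> \<le> exp (- l * drift \<beta> (real (n * a)) (real (n * b)) + 2 * l\<^sup>2 * (real (n * a) + real (n * b)))"
      using laplace_FP_le[OF l \<theta>(1) small, of "n * a" "n * b"] unfolding F_def \<beta>_def by simp
    finally have "exp (- \<theta> * M) \<le> exp (- l * drift \<beta> (real (n * a)) (real (n * b)) + 2 * l\<^sup>2 * (real (n * a) + real (n * b)))" .
    then have "- \<theta> * M \<le> - l * drift \<beta> (real (n * a)) (real (n * b)) + 2 * l\<^sup>2 * (real (n * a) + real (n * b))"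
      by (simp only: exp_le_cancel_iff)
    also have "\<dots> = real n * l * (- r + 2 * (l * (real a + real b)))"
      by (simp add: r_def drift_def algebra_simps power2_eq_square)
    also have "\<dots> \<le> real n * l * (- (r / 2))" using l2 l by (intro mult_left_mono) auto
    finally have "real n * l * (r / 2) \<le> M * \<theta>" by (simp only: mult_minus_right mult_minus_left neg_le_iff_le mult.commute[of \<theta>])
    then have "real n * l * (r / 2) / \<theta> \<le> M" by (simp only: pos_divide_le_eq[OF \<theta>(1)])
    then show ?thesis by (simp add: M_def)
  qed
  moreover have "0 < l * r / 2 / \<theta>" using l r \<theta> by simp
  ultimately show ?thesis by (intro exI[of _ "l * r / 2 / \<theta>"] conjI allI)
qed

end

text \<open>\<open>strict_slope\<close> for the means, transferred by concentration along squares;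
  half of the gap is given up for the fluctuations.\<close>

theorem (in switched_law) AE_gap_law:
  "AE w in P. gap_law \<alpha> (measure D {d. hweight d \<noteq> 0}) (hweights w)"
proof -
  interpret mean_profile mean_FP \<alpha> \<mu> by (rule mean_profile_mean_FP)
  have "0 < measure D {d. \<not> fst d}" using prob_off \<alpha> by simp
  from AE_FP_concentration[OF this] show ?thesis
  proof eventually_elim
    case (elim w)
    show ?case
      unfolding gap_law_def
    proof (intro allI impI)
      fix P Q P' Q' :: nat
      assume PQ: "0 < Q" "0 < Q'" "0 < drift \<alpha> P Q" "P * Q' < P' * Q"
        and \<beta>: "0 < drift (measure D {d. hweight d \<noteq> 0}) P' Q'"
      obtain c0 where c0: "0 < c0" "\<And>n::nat. real n * c0 \<le> mean_FP (n * P') (n * Q')"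
        using mean_FP_linear[OF \<beta>] by blast
      obtain s c n0 where sc: "0 < s" "0 < c"
        "\<And>n. n0 \<le> n \<Longrightarrow> mean_FP (n * P) (n * Q) \<le> n * (s * drift \<alpha> P Q - c)"
        "\<And>n::nat. n * (s * drift \<alpha> P' Q') \<le> mean_FP (n * P') (n * Q')"
        using strict_slope[OF PQ(1,4,3) c0] by blast
      have "\<exists>k0. \<forall>k\<ge>k0. FP w (x1 - int (k\<^sup>2 * P), x2 - int (k\<^sup>2 * Q)) (x1, x2) \<le> (real k)\<^sup>2 * (s * drift \<alpha> P Q - c / 2) \<and>
        (real k)\<^sup>2 * (s * drift \<alpha> P' Q' - \<eta>) \<le> FP w (x1 - int (k\<^sup>2 * P'), x2 - int (k\<^sup>2 * Q')) (x1, x2)"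
        if \<eta>: "0 < \<eta>" for \<eta> x1 x2
      proof -
        have "0 < c / 2" using sc by simp
        then obtain k1 where k1: "\<And>k. k1 \<le> k \<Longrightarrow>
          \<bar>FP w (x1 - int (k\<^sup>2 * P), x2 - int (k\<^sup>2 * Q)) (x1, x2) - mean_FP (k\<^sup>2 * P) (k\<^sup>2 * Q)\<bar> \<le> c / 2 * (real k)\<^sup>2"
          using elim by blast
        obtain k2 where k2: "\<And>k. k2 \<le> k \<Longrightarrow>
          \<bar>FP w (x1 - int (k\<^sup>2 * P'), x2 - int (k\<^sup>2 * Q')) (x1, x2) - mean_FP (k\<^sup>2 * P') (k\<^sup>2 * Q')\<bar> \<le> \<eta> * (real k)\<^sup>2"
          using elim \<eta> by blast
        show ?thesis
        proof (intro exI[of _ "max n0 (max k1 k2)"] allI impI)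
          fix k assume k: "max n0 (max k1 k2) \<le> k"
          have "n0 \<le> k\<^sup>2" using k self_le_power[of k 2] by (cases "k = 0") auto
          then have "mean_FP (k\<^sup>2 * P) (k\<^sup>2 * Q) \<le> (real k)\<^sup>2 * (s * drift \<alpha> P Q - c)" using sc(3)[of "k\<^sup>2"] by simp
          moreover have "(real k)\<^sup>2 * (s * drift \<alpha> P' Q') \<le> mean_FP (k\<^sup>2 * P') (k\<^sup>2 * Q')" using sc(4)[of "k\<^sup>2"] by simp
          ultimately show "FP w (x1 - int (k\<^sup>2 * P), x2 - int (k\<^sup>2 * Q)) (x1, x2) \<le> (real k)\<^sup>2 * (s * drift \<alpha> P Q - c / 2) \<and>
            (real k)\<^sup>2 * (s * drift \<alpha> P' Q' - \<eta>) \<le> FP w (x1 - int (k\<^sup>2 * P'), x2 - int (k\<^sup>2 * Q')) (x1, x2)"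
            using k1[of k] k2[of k] k unfolding abs_le_iff by (simp add: algebra_simps)
        qed
      qed
      moreover have "0 < c / 2" using sc by simp
      ultimately show "\<exists>s>0. \<exists>c>0. \<forall>\<eta>>0. \<forall>x1 x2. \<exists>k0. \<forall>k\<ge>k0.
        FP w (x1 - int (k\<^sup>2 * P), x2 - int (k\<^sup>2 * Q)) (x1, x2) \<le> (real k)\<^sup>2 * (s * drift \<alpha> P Q - c) \<and>
        (real k)\<^sup>2 * (s * drift \<alpha> P' Q' - \<eta>) \<le> FP w (x1 - int (k\<^sup>2 * P'), x2 - int (k\<^sup>2 * Q')) (x1, x2)"
        using sc(1) by blast
    qed
  qed
qed

section \<open>Equality of the Busemann functions\<close>

lemma busemann_sjr_eq:
  fixes S :: "site \<Rightarrow> bool" and W1 W2 :: "site \<Rightarrow> real"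
  defines "w \<equiv> \<lambda>z. (S z, W1 z)"
  assumes nonneg: "\<And>z. 0 \<le> W1 z" "\<And>z. 0 \<le> W2 z"
    and laws: "exit_law \<alpha> (\<lambda>z. fst (w z))" "exit_law \<beta> (\<lambda>z. hweight (w z) \<noteq> 0)"
      "row_law (hweights w)" "gap_law \<alpha> \<beta> (hweights w)"
    and "0 < \<alpha>" "\<alpha> < 1" "0 < \<beta>" "\<beta> < 1" "1 - \<alpha> < t" "t < 1"
  shows "busemann (sjr_weights S W1 W2) t x y = busemann (swfpp_weights S W1) t x y"
proof -
  have eq: "swfpp_weights S W1 = hweights w"
    using nonneg by (auto simp: fun_eq_iff swfpp_weights_def hweights_def hweight_def w_def)
  interpret switched_weights S "sjr_weights S W1 W2" "swfpp_weights S W1"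
    by unfold_locales (auto simp: sjr_weights_def swfpp_weights_def nonneg)
  have "row_law (sjr_weights S W1 W2)"
    using laws(3) nonneg unfolding eq[symmetric] row_law_def by (simp add: sjr_weights_def swfpp_weights_def)
  moreover have "free_field (\<lambda>z. hweight (w z) \<noteq> 0)"
    by (auto simp: free_field_def sjr_weights_def hweight_def w_def)
  moreover have "exit_law \<alpha> S" using laws(1) by (simp add: w_def)
  ultimately show ?thesis
    using laws(2,4) assms(8-) unfolding eq[symmetric]
    by (intro busemann_eq[where \<beta> = \<beta> and B = "\<lambda>z. hweight (w z) \<noteq> 0"]) auto
qed

section \<open>From the given probability space to the product space, and from almost sure equality
  to equality in law\<close>

lemma (in prob_space) distr_iid:
  assumes indep: "indep_vars (\<lambda>_. N) X UNIV" and law: "\<And>z. distr M N (X z) = D"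
  shows "(\<lambda>\<omega> z. X z \<omega>) \<in> measurable M (PiM UNIV (\<lambda>_. N))"
    and "distr M (PiM UNIV (\<lambda>_. N)) (\<lambda>\<omega> z. X z \<omega>) = PiM UNIV (\<lambda>_. D)"
proof -
  have X [measurable]: "X z \<in> measurable M N" for z using indep by (simp add: indep_vars_def)
  show "(\<lambda>\<omega> z. X z \<omega>) \<in> measurable M (PiM UNIV (\<lambda>_. N))"
    by (rule measurable_PiM_single') (auto simp: measurable_space[OF X])
  show "distr M (PiM UNIV (\<lambda>_. N)) (\<lambda>\<omega> z. X z \<omega>) = PiM UNIV (\<lambda>_. D)"
    using indep indep_vars_iff_distr_eq_PiM'[of UNIV X "\<lambda>_. N"] by (simp add: X law restrict_UNIV)
qed

text \<open>No measurability is needed: the preimages of a set under \<open>f\<close> and \<open>g\<close> differ by a null set, so in the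
  completion they are both measurable or both not.\<close>

lemma distr_completion_cong_AE:
  assumes "AE x in M. f x = g x"
  shows "distr (completion M) N f = distr (completion M) N g"
proof -
  obtain Z where Z: "Z \<in> null_sets (completion M)" "{x \<in> space M. f x \<noteq> g x} \<subseteq> Z"
    using AE_completion[OF assms] unfolding eventually_ae_filter by auto
  have sub: "g' -` A \<inter> space M \<in> sets (completion M)"
    if "f' -` A \<inter> space M \<in> sets (completion M)" "{x \<in> space M. f' x \<noteq> g' x} \<subseteq> Z" for f' g' :: "'a \<Rightarrow> 'b" and A
  proof -
    have "g' -` A \<inter> space M = (f' -` A \<inter> space M - Z) \<union> (g' -` A \<inter> space M \<inter> Z)"
      using that(2) by auto
    moreover have "g' -` A \<inter> space M \<inter> Z \<in> null_sets (completion M)"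
      by (rule null_sets_completion_subset[OF _ Z(1)]) auto
    ultimately show ?thesis using sets.Un[OF sets.Diff[OF that(1) null_setsD2[OF Z(1)]] null_setsD2] by metis
  qed
  have "emeasure (completion M) (f -` A \<inter> space M) = emeasure (completion M) (g -` A \<inter> space M)" for A
  proof (cases "f -` A \<inter> space M \<in> sets (completion M)")
    case True
    moreover have "g -` A \<inter> space M \<in> sets (completion M)" by (rule sub[OF True Z(2)])
    moreover have "AE x in completion M. x \<in> f -` A \<inter> space M \<longleftrightarrow> x \<in> g -` A \<inter> space M"
      using AE_completion[OF assms] by eventually_elim auto
    ultimately show ?thesis by (intro emeasure_eq_AE)
  next
    case False
    moreover have "g -` A \<inter> space M \<notin> sets (completion M)"
      using False sub[of g A f] Z(2) by (auto simp: eq_commute)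
    ultimately show ?thesis by (simp add: emeasure_notin_sets)
  qed
  then show ?thesis unfolding distr_def by simp
qed

theorem theorem2p6:
  fixes M :: "'a measure" and \<alpha> :: real
    and S :: "int \<times> int \<Rightarrow> 'a \<Rightarrow> bool"
    and W1 W2 :: "int \<times> int \<Rightarrow> 'a \<Rightarrow> real"
    and n :: nat and t :: "nat \<Rightarrow> real"
  assumes "prob_space M"
    and "0 < \<alpha>" and "\<alpha> < 1"
    and "\<And>x. S x \<in> measurable M (count_space UNIV)"
    and "\<And>x. W1 x \<in> borel_measurable M"
    and "\<And>x. W2 x \<in> borel_measurable M"
    and "prob_space.indep_vars M (\<lambda>_. count_space UNIV \<Otimes>\<^sub>M borel \<Otimes>\<^sub>M borel)
           (\<lambda>x \<omega>. (S x \<omega>, W1 x \<omega>, W2 x \<omega>)) UNIV"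
    and "\<And>x. distr M (count_space UNIV \<Otimes>\<^sub>M borel \<Otimes>\<^sub>M borel) (\<lambda>\<omega>. (S x \<omega>, W1 x \<omega>, W2 x \<omega>))
             = distr M (count_space UNIV \<Otimes>\<^sub>M borel \<Otimes>\<^sub>M borel) (\<lambda>\<omega>. (S (0,0) \<omega>, W1 (0,0) \<omega>, W2 (0,0) \<omega>))"
    and "\<And>x. distr M (count_space UNIV \<Otimes>\<^sub>M (borel \<Otimes>\<^sub>M borel)) (\<lambda>\<omega>. (S x \<omega>, W1 x \<omega>, W2 x \<omega>))
             = distr M (count_space UNIV) (S x) \<Otimes>\<^sub>M distr M (borel \<Otimes>\<^sub>M borel) (\<lambda>\<omega>. (W1 x \<omega>, W2 x \<omega>))"
    and "\<And>x. measure M {\<omega> \<in> space M. S x \<omega>} = \<alpha>"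
    and "\<And>x. AE \<omega> in M. 0 \<le> W1 x \<omega>"
    and "\<And>x. AE \<omega> in M. 0 \<le> W2 x \<omega>"
    and "\<And>x c. \<not> (AE \<omega> in M. W1 x \<omega> = c)"
    and "\<And>x c. \<not> (AE \<omega> in M. W2 x \<omega> = c)"
    and "\<exists>\<epsilon>>0. \<forall>x. integrable M (\<lambda>\<omega>. \<bar>W1 x \<omega>\<bar> powr (2 + \<epsilon>))
                   \<and> integrable M (\<lambda>\<omega>. \<bar>W2 x \<omega>\<bar> powr (2 + \<epsilon>))"
    and "\<And>i. i < n \<Longrightarrow> 0 < t i \<and> t i < 1"
    and "\<And>i j. i < j \<Longrightarrow> j < n \<Longrightarrow> t j < t i"
    and "\<And>i. i < n \<Longrightarrow> 1 - \<alpha> < t i"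
  shows "distr (completion M) (PiM ({..<n} \<times> UNIV \<times> UNIV) (\<lambda>_. borel))
           (\<lambda>\<omega>. restrict (\<lambda>(i, x, y).
              busemann (sjr_weights (\<lambda>z. S z \<omega>) (\<lambda>z. W1 z \<omega>) (\<lambda>z. W2 z \<omega>)) (t i) x y)
              ({..<n} \<times> UNIV \<times> UNIV))
       = distr (completion M) (PiM ({..<n} \<times> UNIV \<times> UNIV) (\<lambda>_. borel))
           (\<lambda>\<omega>. restrict (\<lambda>(i, x, y).
              busemann (swfpp_weights (\<lambda>z. S z \<omega>) (\<lambda>z. W1 z \<omega>)) (t i) x y)
              ({..<n} \<times> UNIV \<times> UNIV))"
proof -
  interpret prob_space M by fact
  note [measurable] = assms(4-6)
  define N where "N = (count_space UNIV :: bool measure) \<Otimes>\<^sub>M (borel :: real measure)"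
  define X where "X = (\<lambda>z \<omega>. (S z \<omega>, W1 z \<omega>))"
  define D where "D = distr M N (X (0, 0))"
  define \<beta> where "\<beta> = measure D {d. hweight d \<noteq> 0}"
  obtain \<epsilon> where \<epsilon>: "0 < \<epsilon>" "integrable M (\<lambda>\<omega>. \<bar>W1 (0, 0) \<omega>\<bar> powr (2 + \<epsilon>))" using assms(15) by blast
  have X_meas [measurable]: "X z \<in> measurable M N" for z unfolding X_def N_def by measurable
  have proj: "(\<lambda>(s, a, b). (s, a)) \<in> measurable (count_space UNIV \<Otimes>\<^sub>M borel \<Otimes>\<^sub>M borel) N"
    unfolding N_def by measurable
  have law: "distr M N (X z) = D" for z
  proof -
    have "distr M N (X z) = distr (distr M (count_space UNIV \<Otimes>\<^sub>M borel \<Otimes>\<^sub>M borel) (\<lambda>\<omega>. (S z \<omega>, W1 z \<omega>, W2 z \<omega>))) N (\<lambda>(s, a, b). (s, a))" for z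
      by (subst distr_distr[OF proj]) (auto simp: X_def comp_def)
    from this[of z] this[of "(0, 0)"] show ?thesis unfolding D_def assms(8)[of z] by simp
  qed
  have indep: "indep_vars (\<lambda>_. N) X UNIV"
    using indep_vars_compose2[OF assms(7) proj] by (simp add: X_def)
  have space_D: "space D = UNIV" by (simp add: D_def N_def space_pair_measure)
  have on: "measure D {d. fst d} = \<alpha>"
  proof -
    have "{d \<in> space N. fst d} \<in> sets N" unfolding N_def by measurable
    then have "measure D {d. fst d} = prob (X (0, 0) -` {d. fst d} \<inter> space M)"
      unfolding D_def using X_meas[of "(0, 0)"] by (intro measure_distr) (auto simp: N_def space_pair_measure)
    also have "X (0, 0) -` {d. fst d} \<inter> space M = {\<omega> \<in> space M. S (0, 0) \<omega>}" by (auto simp: X_def)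
    finally show ?thesis using assms(10) by simp
  qed
  interpret D: switched_law D "2 + \<epsilon>" \<alpha>
  proof (intro switched_law.intro site_moment.intro site_law.intro site_moment_axioms.intro switched_law_axioms.intro)
    show "prob_space D" unfolding D_def by (rule prob_space_distr) measurable
    show "sets D = sets (count_space UNIV \<Otimes>\<^sub>M borel)" by (simp add: D_def N_def)
    have "(\<lambda>d. \<bar>snd d\<bar> powr (2 + \<epsilon>)) \<in> borel_measurable N" unfolding N_def by measurable
    then show "integrable D (\<lambda>d. \<bar>snd d\<bar> powr (2 + \<epsilon>))"
      unfolding D_def using \<epsilon> by (subst integrable_distr_eq[OF X_meas]) (auto simp: X_def)
  qed (use \<epsilon> on assms(2,3) in auto)
  have hw_set: "{d. hweight d \<noteq> 0} \<in> sets D"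
  proof -
    have "{d \<in> space D. hweight d \<noteq> 0} \<in> sets D" by measurable
    then show ?thesis by (simp add: space_D)
  qed
  \<comment> \<open>By independence of switch and weights, \<beta> is \<alpha> times the probability
    that W1 is non-zero; this is positive because W1 is not almost surely the constant 0. Also
    \<beta> \<le> \<alpha> < 1.\<close>
  have \<beta>: "0 < \<beta>" "\<beta> < 1"
  proof -
    have "{d. fst d} \<in> sets D" using D.off_measurable by (simp add: pred_def)
    then have "\<beta> \<le> \<alpha>"
      unfolding \<beta>_def on[symmetric] by (intro D.D.finite_measure_mono) (auto simp: hweight_def)
    then show "\<beta> < 1" using assms(3) by simp
    have "{a :: real. a \<noteq> 0} = - {0}" by auto
    then have nz: "{a :: real. a \<noteq> 0} \<in> sets borel" using borel_open[OF open_Compl[of "{0 :: real}"]] by simp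
    let ?T = "{True} \<times> ({a :: real. a \<noteq> 0} \<times> (UNIV :: real set))"
    have T: "?T \<in> sets (count_space UNIV \<Otimes>\<^sub>M (borel \<Otimes>\<^sub>M borel))" using nz by (intro pair_measureI) auto
    have "X (0, 0) -` {d. hweight d \<noteq> 0} \<inter> space M = (\<lambda>\<omega>. (S (0, 0) \<omega>, W1 (0, 0) \<omega>, W2 (0, 0) \<omega>)) -` ?T \<inter> space M"
      by (auto simp: X_def hweight_def)
    then have "emeasure D {d. hweight d \<noteq> 0}
      = emeasure (distr M (count_space UNIV \<Otimes>\<^sub>M (borel \<Otimes>\<^sub>M borel)) (\<lambda>\<omega>. (S (0, 0) \<omega>, W1 (0, 0) \<omega>, W2 (0, 0) \<omega>))) ?T"
      using hw_set T unfolding D_def by (simp add: emeasure_distr)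
    also have "\<dots> = emeasure (distr M (count_space UNIV) (S (0, 0))) {True}
        * emeasure (distr M (borel \<Otimes>\<^sub>M borel) (\<lambda>\<omega>. (W1 (0, 0) \<omega>, W2 (0, 0) \<omega>))) ({a. a \<noteq> 0} \<times> UNIV)"
    proof -
      interpret W: prob_space "distr M (borel \<Otimes>\<^sub>M borel) (\<lambda>\<omega>. (W1 (0, 0) \<omega>, W2 (0, 0) \<omega>))"
        by (rule prob_space_distr) measurable
      show ?thesis unfolding assms(9) using nz by (intro W.emeasure_pair_measure_Times) auto
    qed
    finally have prod: "emeasure D {d. hweight d \<noteq> 0} = emeasure M (S (0, 0) -` {True} \<inter> space M)
        * emeasure M ((\<lambda>\<omega>. (W1 (0, 0) \<omega>, W2 (0, 0) \<omega>)) -` ({a. a \<noteq> 0} \<times> UNIV) \<inter> space M)"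
      using nz by (simp add: emeasure_distr)
    have "emeasure M (S (0, 0) -` {True} \<inter> space M) = \<alpha>"
    proof -
      have "S (0, 0) -` {True} \<inter> space M = {\<omega> \<in> space M. S (0, 0) \<omega>}" by auto
      then show ?thesis using assms(10)[of "(0, 0)"] by (simp add: emeasure_eq_measure)
    qed
    moreover have "emeasure M ((\<lambda>\<omega>. (W1 (0, 0) \<omega>, W2 (0, 0) \<omega>)) -` ({a. a \<noteq> 0} \<times> UNIV) \<inter> space M) \<noteq> 0"
    proof
      have eq: "(\<lambda>\<omega>. (W1 (0, 0) \<omega>, W2 (0, 0) \<omega>)) -` ({a. a \<noteq> 0} \<times> UNIV) \<inter> space M = {\<omega> \<in> space M. \<not> W1 (0, 0) \<omega> = 0}"
        by auto
      assume "emeasure M ((\<lambda>\<omega>. (W1 (0, 0) \<omega>, W2 (0, 0) \<omega>)) -` ({a. a \<noteq> 0} \<times> UNIV) \<inter> space M) = 0"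
      moreover have "{\<omega> \<in> space M. \<not> W1 (0, 0) \<omega> = 0} \<in> sets M" by measurable
      ultimately have "AE \<omega> in M. W1 (0, 0) \<omega> = 0"
        unfolding eq by (intro AE_I[of _ _ "{\<omega> \<in> space M. \<not> W1 (0, 0) \<omega> = 0}"]) auto
      then show False using assms(13) by blast
    qed
    ultimately have "emeasure D {d. hweight d \<noteq> 0} \<noteq> 0" using prod assms(2) by auto
    then show "0 < \<beta>" by (simp add: \<beta>_def D.D.emeasure_eq_measure zero_less_measure_iff)
  qed
  note iid = distr_iid[OF indep law]
  have transfer: "AE \<omega> in M. Q (\<lambda>z. X z \<omega>)" if "AE w in D.P. Q w" for Q
    using AE_distrD[OF iid(1), of Q] that unfolding iid(2) D.P_def .
  have hw_pred: "Measurable.pred D (\<lambda>d. hweight d \<noteq> 0)" by measurable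
  have "AE \<omega> in M. \<forall>z. 0 \<le> W1 z \<omega>" "AE \<omega> in M. \<forall>z. 0 \<le> W2 z \<omega>"
    unfolding AE_all_countable using assms(11,12) by auto
  moreover note transfer[OF D.AE_exit_law[OF D.off_measurable]] transfer[OF D.AE_exit_law[OF hw_pred]]
    transfer[OF D.AE_row_law] transfer[OF D.AE_gap_law]
  \<comment> \<open>None of the six statements collected involves a direction or a pair of sites, so
    one null set serves all i, x and y at once.\<close>
  ultimately have "AE \<omega> in M. \<forall>i<n. \<forall>x y.
     busemann (sjr_weights (\<lambda>z. S z \<omega>) (\<lambda>z. W1 z \<omega>) (\<lambda>z. W2 z \<omega>)) (t i) x y
     = busemann (swfpp_weights (\<lambda>z. S z \<omega>) (\<lambda>z. W1 z \<omega>)) (t i) x y"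
  proof eventually_elim
    case (elim \<omega>)
    show ?case
    proof (intro allI impI)
      fix i x y assume "i < n"
      then show "busemann (sjr_weights (\<lambda>z. S z \<omega>) (\<lambda>z. W1 z \<omega>) (\<lambda>z. W2 z \<omega>)) (t i) x y
         = busemann (swfpp_weights (\<lambda>z. S z \<omega>) (\<lambda>z. W1 z \<omega>)) (t i) x y"
        using elim \<beta> assms(2,3) assms(16)[of i] assms(18)[of i] on
        by (intro busemann_sjr_eq[where \<alpha> = \<alpha> and \<beta> = \<beta>]) (simp_all add: X_def \<beta>_def del: split_paired_All)
    qed
  qed
  then show ?thesis
    by (intro distr_completion_cong_AE) (auto elim!: eventually_mono intro!: restrict_ext)
qed

end
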